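(* Let $0<\alpha<n$. Suppose that $1\le p<n/\alpha$ and that $q$ satisfies $1/q=1/p-\alpha/n$. Then there is a constant $c$ such that for all weights $w\in A_{p,q}$ and all $f$ with $wf\in L^p(\mathbb{R}^n)$, $$\|I_\alpha f\|_{L^{q,\infty}(w^q)}\le c\,[w]_{A_{p,q}}^{1-\frac{\alpha}{n}}\,\|wf\|_{L^p(\mathbb{R}^n)}.$$ Furthermore, the exponent $1-\frac{\alpha}{n}$ is sharp: for no $\beta<1-\frac{\alpha}{n}$ is there a constant $c$ such that the inequality with $[w]_{A_{p,q}}^{1-\alpha/n}$ replaced by $[w]_{A_{p,q}}^{\beta}$ holds for all $w\in A_{p,q}$ and all such $f$.
   Context: For $0<\alpha<n$, the fractional integral operator (Riesz potential) is $I_\alpha f(x)=\int_{\mathbb{R}^n}\frac{f(y)}{|x-y|^{n-\alpha}}\,dy$. A weight is a non-negative locally integrable function on $\mathbb{R}^n$; $p'$ is defined by $1/p+1/p'=1$. Cubes have sides parallel to the axes. For $1<p\le q<\infty$, a weight $w$ belongs to $A_{p,q}$ if $$[w]_{A_{p,q}}=\sup_Q\left(\frac1{|Q|}\int_Q w^q\,dx\right)\left(\frac1{|Q|}\int_Q w^{-p'}\,dx\right)^{q/p'}<\infty,$$ the supremum being over all cubes $Q$. For $1\le q<\infty$, $w\in A_{1,q}$ if there is a constant $c$ with $\frac1{|Q|}\int_Q w^q\,dx\le c\,\inf_Q w^q$ (essential infimum) for all cubes $Q$, and $[w]_{A_{1,q}}$ is the smallest such $c$. For a weight $u$, write $u(E)=\int_E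 u\,dx$ and $\|g\|_{L^{q,\infty}(u)}=\sup_{\lambda>0}\lambda\,u(\{x:|g(x)|>\lambda\})^{1/q}$. *)

theory Defs
  imports "HOL-Analysis.Analysis"
begin

(* Real powers on [0, infinity] with 0 ^ r = infinity and infinity ^ r = 0 for r < 0.
   In contrast, 0 powr r = 0 on the reals for all r, so that w x powr (-p') would have the
   wrong value at the zeros of a weight w. *)
definition ennpowr :: "ennreal \<Rightarrow> real \<Rightarrow> ennreal" where
  "ennpowr x r =
     (if r = 0 then 1
      else if x = 0 then (if r < 0 then top else 0)
      else if x = top then (if r < 0 then 0 else top)
      else ennreal (enn2real x powr r))"

definition weight :: "(real ^ 'n \<Rightarrow> real) \<Rightarrow> bool" where
  "weight w \<longleftrightarrow> (\<forall>x. 0 \<le> w x) \<and> (\<forall>K. compact K \<longrightarrow> set_integrable lebesgue K w)"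

definition cubes :: "(real ^ 'n) set set" where
  "cubes = {cbox a (\<chi> i. a $ i + s) | a s. 0 < s}"

definition average :: "(real ^ 'n) set \<Rightarrow> (real ^ 'n \<Rightarrow> ennreal) \<Rightarrow> ennreal" where
  "average Q g = (\<integral>\<^sup>+x\<in>Q. g x \<partial>lebesgue) / emeasure lebesgue Q"

definition ess_inf_on :: "(real ^ 'n) set \<Rightarrow> (real ^ 'n \<Rightarrow> ennreal) \<Rightarrow> ennreal" where
  "ess_inf_on Q g = Sup {t. AE x in lebesgue. x \<in> Q \<longrightarrow> t \<le> g x}"

definition conj_exponent :: "real \<Rightarrow> real" where
  "conj_exponent p = 1 / (1 - 1 / p)"

(* The infimum for p = 1 is infinite when no finite constant is admissible. *)
definition Apq_const :: "real \<Rightarrow> real \<Rightarrow> (real ^ 'n \<Rightarrow> real) \<Rightarrow> ennreal" where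
  "Apq_const p q w =
     (if p = 1 then
        Inf {c. \<forall>Q\<in>cubes. average Q (\<lambda>x. ennpowr (ennreal (w x)) q)
                         \<le> c * ess_inf_on Q (\<lambda>x. ennpowr (ennreal (w x)) q)}
      else
        (SUP Q\<in>cubes. average Q (\<lambda>x. ennpowr (ennreal (w x)) q) *
           ennpowr (average Q (\<lambda>x. ennpowr (ennreal (w x)) (- conj_exponent p)))
                   (q / conj_exponent p)))"

definition Apq :: "real \<Rightarrow> real \<Rightarrow> (real ^ 'n \<Rightarrow> real) set" where
  "Apq p q = {w. weight w \<and> Apq_const p q w < top}"

definition Lp_norm :: "real \<Rightarrow> (real ^ 'n \<Rightarrow> complex) \<Rightarrow> ennreal" where
  "Lp_norm p g = ennpowr (\<integral>\<^sup>+x. ennpowr (ennreal (norm (g x))) p \<partial>lebesgue) (1 / p)"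

definition in_Lp :: "real \<Rightarrow> (real ^ 'n \<Rightarrow> complex) \<Rightarrow> bool" where
  "in_Lp p g \<longleftrightarrow> g \<in> borel_measurable lebesgue \<and> Lp_norm p g < top"

definition riesz_integrand ::
    "real \<Rightarrow> (real ^ 'n \<Rightarrow> complex) \<Rightarrow> real ^ 'n \<Rightarrow> real ^ 'n \<Rightarrow> complex" where
  "riesz_integrand \<alpha> f x y = f y /\<^sub>R (norm (x - y) powr (real CARD('n) - \<alpha>))"

definition fractional_integral ::
    "real \<Rightarrow> (real ^ 'n \<Rightarrow> complex) \<Rightarrow> real ^ 'n \<Rightarrow> complex" where
  "fractional_integral \<alpha> f x = (\<integral>y. riesz_integrand \<alpha> f x y \<partial>lebesgue)"

(* The modulus of the fractional integral in [0, infinity]. The Bochner integral of a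
   non-integrable function is 0 by convention, which would make norm estimates trivially true at
   points of divergence; there the modulus is infinite instead, as it must be for nonnegative f. *)
definition fractional_integral_abs ::
    "real \<Rightarrow> (real ^ 'n \<Rightarrow> complex) \<Rightarrow> real ^ 'n \<Rightarrow> ennreal" where
  "fractional_integral_abs \<alpha> f x =
     (if integrable lebesgue (riesz_integrand \<alpha> f x)
      then ennreal (norm (fractional_integral \<alpha> f x)) else top)"

definition weighted_measure :: "(real ^ 'n \<Rightarrow> ennreal) \<Rightarrow> (real ^ 'n) set \<Rightarrow> ennreal" where
  "weighted_measure u E = (\<integral>\<^sup>+x\<in>E. u x \<partial>lebesgue)"

(* The weak norm in L^(q, infinity)(u) of a function g, in terms of its modulus. *)
definition weak_norm ::
    "real \<Rightarrow> (real ^ 'n \<Rightarrow> ennreal) \<Rightarrow> (real ^ 'n \<Rightarrow> ennreal) \<Rightarrow> ennreal" where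
  "weak_norm q u abs_g =
     (SUP t\<in>{0<..}. ennreal t * ennpowr (weighted_measure u {x. ennreal t < abs_g x}) (1 / q))"

end

theory Submission
  imports Defs
begin

text \<open>
  Write \<theta> = 1 - \<alpha>/n = 1/q + 1/p', u = w^q, \<sigma> = w^(-p') and A for the A_{p,q} constant of w.

  \<^bold>\<open>Upper bound.\<close> Let E be a part of {I_\<alpha> |f| > t} with u(E) finite. Since I_\<alpha> is symmetric,
  t u(E) is at most the integral of I_\<alpha> |f| over E with respect to u, hence at most the integral
  of |f| I_\<alpha>(u 1_E). Hedberg's inequality bounds the potential of a function g by
  C (\<integral>g)^(\<alpha>/n) (M g)^\<theta>, so for g = u 1_E a factor u(E)^(\<alpha>/n) comes out and
  \<integral> |f| M(u 1_E)^\<theta> is left. For p > 1 Hoelder's inequality separates the norm of w f from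
  the 1/p'-th power of \<integral> M(u 1_E)^s \<sigma>, where s = \<theta> p' = 1 + p'/q. As \<sigma> = u^(1-s), this is
  the boundedness of M on L^s(u^(1-s)) with Buckley's constant, tested on u 1_E: it is at most
  C A^s u(E). Altogether t u(E) \<le> C A^\<theta> ||w f||_p u(E)^(\<alpha>/n + 1/p'), and the exponent of u(E)
  on the right is 1 - 1/q. For p = 1 the pointwise bound M(u 1_E) \<le> A u replaces the last two
  steps.

  Buckley's estimate (\<open>maximal_fn_restricted_bound\<close>) follows Lerner's argument. It dominates M by two
  maximal operators, one with respect to the measure u and one with respect to \<sigma>, whose bounds on
  L^s(u) and L^s'(\<sigma>) do not depend on the weight. This independence holds for dyadic-type maximal
  operators: the proof of \<open>maximal_fn_strong_type\<close> uses only that the cubes in the supremum are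
  countably many and pairwise nested or disjoint, for any measure. The maximal operator over all
  balls is recovered from the 2^n triadic grids that are shifted by half a cube in some of the
  coordinates (\<open>ball_in_grid\<close>).

  \<^bold>\<open>Sharpness.\<close> For J = 1, 2, ... and \<epsilon> = 1/J take u = |x|^(\<epsilon>-n) and f = |y|^(\<epsilon>-\<alpha>) on the unit
  ball. The dyadic annuli between the radii 2^(-2J) and 1 all contribute comparable amounts to the
  relevant integrals, so these grow like powers of J: A is at most a
  multiple of J, ||w f||_p is at most a multiple of J^(1/p), whereas I_\<alpha> f is at least a multiple of
  J on the ball of radius 2^(-J), whose u-measure is at least a multiple of J. Therefore the
  quotient of the two norms grows at least like J^(1 + 1/q - 1/p) = J^\<theta>.
\<close>

section \<open>Extended powers, Hoelder and the layer cake formula\<close>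

lemma ennpowr_ennreal: "0 < x \<Longrightarrow> ennpowr (ennreal x) r = ennreal (x powr r)"
  by (auto simp: ennpowr_def)

lemma ennpowr_ennreal_nonneg: "0 \<le> x \<Longrightarrow> 0 < r \<Longrightarrow> ennpowr (ennreal x) r = ennreal (x powr r)"
  by (auto simp: ennpowr_def)

lemma ennpowr_zero [simp]: "0 < r \<Longrightarrow> ennpowr 0 r = 0"
  and ennpowr_top [simp]: "0 < r \<Longrightarrow> ennpowr top r = top"
  and ennpowr_exp_0 [simp]: "ennpowr x 0 = 1"
  and ennpowr_1 [simp]: "ennpowr 1 r = 1"
  by (auto simp: ennpowr_def)

lemma ennreal_pos_cases:
  obtains "x = (0::ennreal)" | "x = top" | y where "0 < y" "x = ennreal y"
  by (cases x) (auto, metis ennreal_eq_0_iff not_le order_le_less)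

lemma ennpowr_exp_1 [simp]: "ennpowr x 1 = x"
  by (cases x rule: ennreal_pos_cases) (auto simp: ennpowr_ennreal)

lemma ennpowr_mono:
  assumes "x \<le> y" "0 \<le> r"
  shows "ennpowr x r \<le> ennpowr y r"
proof (cases "x = 0 \<or> y = top \<or> r = 0")
  case False
  with assms obtain a b where "0 < a" "x = ennreal a" "0 < b" "y = ennreal b"
    by (cases x rule: ennreal_pos_cases; cases y rule: ennreal_pos_cases) (auto simp: top_unique)
  with assms False show ?thesis by (simp add: ennpowr_ennreal powr_mono2)
qed (use assms in \<open>auto simp: ennpowr_def\<close>)

lemma ennpowr_ennpowr: "ennpowr (ennpowr x r) s = ennpowr x (r * s)"
proof (cases x rule: ennreal_pos_cases)
  case (3 y)
  then show ?thesis by (simp add: ennpowr_ennreal powr_powr)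
qed (cases "0 < r"; cases "r = 0"; cases "0 < s"; cases "s = 0";
     simp add: ennpowr_def mult_less_0_iff)+

lemma ennpowr_mult: "0 \<le> r \<Longrightarrow> ennpowr (x * y) r = ennpowr x r * ennpowr y r"
proof (cases "r = 0")
  case False
  assume "0 \<le> r"
  with False have r: "0 < r" by simp
  have T: "ennreal a * top = top" "top * ennreal a = top" if "0 < a" for a
    using that by (simp_all add: ennreal_mult_top ennreal_top_mult)
  show ?thesis
  proof (cases x rule: ennreal_pos_cases; cases y rule: ennreal_pos_cases)
    fix a b assume ab: "0 < a" "x = ennreal a" "0 < b" "y = ennreal b"
    then have "ennpowr (x * y) r = ennreal ((a * b) powr r)"
      by (simp add: ennpowr_ennreal flip: ennreal_mult)
    with ab show ?thesis by (simp add: ennpowr_ennreal powr_mult ennreal_mult)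
  qed (use r in \<open>simp_all add: T ennpowr_ennreal\<close>)
qed simp

lemma ennpowr_add_fin:
  assumes "x \<noteq> 0" "x \<noteq> top"
  shows "ennpowr x (r + s) = ennpowr x r * ennpowr x s"
proof -
  obtain y where y: "0 < y" "x = ennreal y" using assms by (cases x rule: ennreal_pos_cases) auto
  have "ennpowr x (r + s) = ennreal (y powr r * y powr s)"
    using y by (simp add: ennpowr_ennreal powr_add)
  with y show ?thesis by (simp add: ennpowr_ennreal ennreal_mult)
qed

lemma ennpowr_add: "0 < r \<Longrightarrow> 0 < s \<Longrightarrow> ennpowr x (r + s) = ennpowr x r * ennpowr x s"
  by (cases "x = 0 \<or> x = top") (auto simp: ennpowr_add_fin)

lemma ennpowr_eq_0_iff: "0 < r \<Longrightarrow> ennpowr x r = 0 \<longleftrightarrow> x = 0"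
  by (cases x rule: ennreal_pos_cases) (auto simp: ennpowr_ennreal)

lemma ennpowr_eq_top_iff: "0 < r \<Longrightarrow> ennpowr x r = top \<longleftrightarrow> x = top"
  by (cases x rule: ennreal_pos_cases) (auto simp: ennpowr_ennreal)

lemma ennpowr_measurable [measurable]:
  assumes [measurable]: "f \<in> borel_measurable M"
  shows "(\<lambda>x. ennpowr (f x) r) \<in> borel_measurable M"
proof -
  define g where "g = (\<lambda>x. ennreal (enn2real (f x) powr r))"
  have [measurable]: "g \<in> borel_measurable M" unfolding g_def by measurable
  define a b :: ennreal where "a = (if r < 0 then top else 0)" and "b = (if r < 0 then 0 else top)"
  have "(\<lambda>x. if f x = 0 then a else if f x = top then b else g x) \<in> borel_measurable M"
    by measurable
  then show ?thesis
    by (cases "r = 0") (simp_all add: ennpowr_def g_def a_def b_def cong: if_cong)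
qed

lemma Young_ennreal:
  assumes p: "1 < p" "1 < p'" "1/p + 1/p' = 1"
  shows "x * y \<le> ennreal (1/p) * ennpowr x p + ennreal (1/p') * ennpowr y p'"
proof -
  have T: "ennreal a * top = top" if "0 < a" for a using that by (simp add: ennreal_mult_top)
  show ?thesis
  proof (cases x rule: ennreal_pos_cases; cases y rule: ennreal_pos_cases)
    fix a b assume ab: "0 < a" "x = ennreal a" "0 < b" "y = ennreal b"
    have "a * b \<le> a powr p / p + b powr p' / p'"
      using Youngs_inequality[of p p' a b] p ab by auto
    then show ?thesis using ab p
      by (simp add: ennpowr_ennreal flip: ennreal_mult ennreal_plus)
  qed (use p T in auto)
qed

lemma Holder_nn_integral:
  assumes p: "1 < p" "1 < p'" "1/p + 1/p' = 1"
    and [measurable]: "f \<in> borel_measurable M" "g \<in> borel_measurable M"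
  shows "(\<integral>\<^sup>+x. f x * g x \<partial>M)
     \<le> ennpowr (\<integral>\<^sup>+x. ennpowr (f x) p \<partial>M) (1/p) * ennpowr (\<integral>\<^sup>+x. ennpowr (g x) p' \<partial>M) (1/p')"
proof -
  define F where "F = (\<integral>\<^sup>+x. ennpowr (f x) p \<partial>M)"
  define G where "G = (\<integral>\<^sup>+x. ennpowr (g x) p' \<partial>M)"
  have zero: "(\<integral>\<^sup>+x. f x * g x \<partial>M) = 0" if "F = 0 \<or> G = 0"
  proof -
    have "(AE x in M. ennpowr (f x) p = 0) \<or> (AE x in M. ennpowr (g x) p' = 0)"
      using that unfolding F_def G_def by (subst (asm) (1 2) nn_integral_0_iff_AE) auto
    then have "AE x in M. f x * g x = 0"
      using p by (auto elim!: eventually_mono simp: ennpowr_eq_0_iff)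
    then show ?thesis by (subst nn_integral_0_iff_AE) auto
  qed
  show ?thesis
  proof (cases "F = 0 \<or> G = 0 \<or> F = top \<or> G = top")
    case True
    then show ?thesis using zero p unfolding F_def[symmetric] G_def[symmetric]
      by (cases "F = 0 \<or> G = 0") (auto simp: ennreal_mult_top ennreal_top_mult ennpowr_eq_0_iff)
  next
    case False
    then obtain a b where ab: "0 < a" "F = ennreal a" "0 < b" "G = ennreal b"
      by (cases F rule: ennreal_pos_cases; cases G rule: ennreal_pos_cases) auto
    define \<alpha> \<beta> where "\<alpha> = a powr (1/p)" and "\<beta> = b powr (1/p')"
    have pos: "0 < \<alpha>" "0 < \<beta>" using ab by (auto simp: \<alpha>_def \<beta>_def)
    have \<alpha>p: "ennpowr (ennreal (1/\<alpha>)) p = ennreal (1 / a)"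
      using ab p pos by (simp add: ennpowr_ennreal \<alpha>_def powr_divide powr_powr)
    have \<beta>p: "ennpowr (ennreal (1/\<beta>)) p' = ennreal (1 / b)"
      using ab p pos by (simp add: ennpowr_ennreal \<beta>_def powr_divide powr_powr)
    \<comment> \<open>Both factors are normalised before Young's inequality is applied.\<close>
    have eq: "(\<integral>\<^sup>+x. f x * g x \<partial>M)
      = ennreal (\<alpha> * \<beta>) * (\<integral>\<^sup>+x. (ennreal (1/\<alpha>) * f x) * (ennreal (1/\<beta>) * g x) \<partial>M)"
    proof -
      have "ennreal (\<alpha> * \<beta>) * ((ennreal (1/\<alpha>) * s) * (ennreal (1/\<beta>) * t)) = s * t" for s t
      proof -
        have "ennreal (\<alpha> * \<beta>) * ((ennreal (1/\<alpha>) * s) * (ennreal (1/\<beta>) * t))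
          = (ennreal (\<alpha> * \<beta>) * (ennreal (1/\<alpha>) * ennreal (1/\<beta>))) * (s * t)"
          by (simp add: ac_simps)
        also have "ennreal (\<alpha> * \<beta>) * (ennreal (1/\<alpha>) * ennreal (1/\<beta>)) = 1"
          using pos by (simp flip: ennreal_mult)
        finally show ?thesis by simp
      qed
      then show ?thesis by (subst nn_integral_cmult[symmetric]) (simp, simp)
    qed
    have "(\<integral>\<^sup>+x. (ennreal (1/\<alpha>) * f x) * (ennreal (1/\<beta>) * g x) \<partial>M)
      \<le> (\<integral>\<^sup>+x. ennreal (1/p) * ennpowr (ennreal (1/\<alpha>) * f x) p
            + ennreal (1/p') * ennpowr (ennreal (1/\<beta>) * g x) p' \<partial>M)"
      using Young_ennreal[OF p] by (intro nn_integral_mono) auto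
    also have "\<dots> = ennreal (1/p) * (ennreal (1/a) * F) + ennreal (1/p') * (ennreal (1/b) * G)"
      using p by (simp add: nn_integral_add nn_integral_cmult ennpowr_mult \<alpha>p \<beta>p F_def G_def)
    also have "\<dots> = 1" using p ab by (simp flip: ennreal_mult ennreal_plus)
    finally have "(\<integral>\<^sup>+x. f x * g x \<partial>M) \<le> ennreal (\<alpha> * \<beta>)"
      unfolding eq using mult_left_mono[of _ 1 "ennreal (\<alpha> * \<beta>)"] by auto
    also have "\<dots> = ennpowr F (1/p) * ennpowr G (1/p')"
      using ab by (simp add: \<alpha>_def \<beta>_def ennpowr_ennreal ennreal_mult)
    finally show ?thesis by (simp add: F_def G_def)
  qed
qed

text \<open>
  The integrand is singular at 0 for s < 1. The formula includes X = \<infinity>, which the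
  maximal function may attain.
\<close>
lemma layer_cake_ennpowr:
  assumes s: "0 < s"
  shows "ennpowr X s = (\<integral>\<^sup>+t. ennreal (s * t powr (s - 1)) * indicator {t. 0 < t \<and> ennreal t < X} t \<partial>lborel)"
    (is "_ = ?I X")
proof -
  have fin: "?I (ennreal c) = ennpowr (ennreal c) s" if "0 \<le> c" for c
  proof -
    have "((\<lambda>x. s * x powr (s - 1)) has_integral s * (c powr (s - 1 + 1) / (s - 1 + 1))) {0..c}"
      using s that by (intro has_integral_mult_right[OF has_integral_powr_from_0]) auto
    from nn_integral_has_integral_lebesgue[OF _ this] s
    have "(\<integral>\<^sup>+t. ennreal (indicator {0..c} t * (s * t powr (s - 1))) \<partial>lborel) = ennreal (c powr s)"
      by simp
    also have "(\<integral>\<^sup>+t. ennreal (indicator {0..c} t * (s * t powr (s - 1))) \<partial>lborel) = ?I (ennreal c)"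
    proof (intro nn_integral_cong_AE)
      have "AE t in lborel. t \<noteq> 0 \<and> t \<noteq> c"
        using AE_lborel_singleton[of 0] AE_lborel_singleton[of c] by eventually_elim auto
      then show "AE t in lborel. ennreal (indicator {0..c} t * (s * t powr (s - 1)))
          = ennreal (s * t powr (s - 1)) * indicator {t. 0 < t \<and> ennreal t < ennreal c} t"
        by eventually_elim (use that in \<open>auto simp: indicator_def ennreal_less_iff\<close>)
    qed
    finally show ?thesis using s that by (simp add: ennpowr_ennreal_nonneg)
  qed
  show ?thesis
  proof (cases X)
    case (real r)
    then show ?thesis using fin by simp
  next
    case top
    have le: "ennreal c \<le> ?I top" if c: "0 \<le> c" for c
    proof -
      have "ennreal c = ?I (ennreal (c powr (1/s)))"
        using s c by (simp add: fin ennpowr_ennreal_nonneg powr_powr)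
      also have "\<dots> \<le> ?I top"
        by (intro nn_integral_mono mult_left_mono) (auto simp: indicator_def)
      finally show ?thesis .
    qed
    have "?I top = top"
    proof (rule ccontr)
      assume "?I top \<noteq> top"
      then obtain c where c: "0 \<le> c" "?I top = ennreal c" by (cases "?I top") auto
      with le[of "c + 1"] show False by simp
    qed
    with top s show ?thesis by simp
  qed
qed

section \<open>Maximal functions over nested families of sets\<close>

definition laminar :: "'a set set \<Rightarrow> bool" where
  "laminar D \<longleftrightarrow> (\<forall>P\<in>D. \<forall>Q\<in>D. P \<inter> Q = {} \<or> P \<subseteq> Q \<or> Q \<subseteq> P)"

definition maximal_fn :: "'a measure \<Rightarrow> 'a set set \<Rightarrow> ('a \<Rightarrow> ennreal) \<Rightarrow> 'a \<Rightarrow> ennreal" where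
  "maximal_fn N D g x = (SUP Q\<in>{Q\<in>D. x \<in> Q}. (\<integral>\<^sup>+y\<in>Q. g y \<partial>N) / emeasure N Q)"

lemma maximal_fn_upper:
  "Q \<in> D \<Longrightarrow> x \<in> Q \<Longrightarrow> (\<integral>\<^sup>+y\<in>Q. g y \<partial>N) / emeasure N Q \<le> maximal_fn N D g x"
  unfolding maximal_fn_def by (rule SUP_upper) auto

lemma maximal_fn_measurable:
  assumes "countable D" "D \<subseteq> sets N"
  shows "maximal_fn N D g \<in> borel_measurable N"
proof -
  have "maximal_fn N D g x
      = (SUP Q\<in>D. (\<integral>\<^sup>+y\<in>Q. g y \<partial>N) / emeasure N Q * indicator Q x)" for x
    unfolding maximal_fn_def
    by (intro antisym SUP_least) (auto intro!: SUP_upper2 simp: indicator_def)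
  moreover have "(\<lambda>x. SUP Q\<in>D. (\<integral>\<^sup>+y\<in>Q. g y \<partial>N) / emeasure N Q * indicator Q x) \<in> borel_measurable N"
    using assms by (intro borel_measurable_SUP borel_measurable_times_ennreal
      borel_measurable_const borel_measurable_indicator) auto
  ultimately show ?thesis by (simp cong: measurable_cong)
qed

lemma ennreal_divide_self_le: "(c * b) / b \<le> (c::ennreal)"
proof (cases "b = 0 \<or> b = top")
  case True
  then show ?thesis by (auto simp: divide_ennreal_def)
next
  case False
  then show ?thesis by (simp add: ennreal_mult_divide_eq)
qed

lemma ennreal_less_divide_imp: "t < a / b \<Longrightarrow> t * b \<le> (a::ennreal)"
proof (cases "b = 0 \<or> b = top")
  case True
  moreover assume "t < a / b"
  ultimately show ?thesis by (auto simp: divide_ennreal_def)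
next
  case False
  moreover assume "t < a / b"
  then have "t * b \<le> (a / b) * b" by (intro mult_right_mono) auto
  ultimately show ?thesis using False by (simp add: ennreal_divide_times ennreal_divide_self top.not_eq_extremum)
qed

text \<open>
  The maximal members of F are disjoint and have the same union as F, so the inequalities for
  the single members add up to the one for the union.
\<close>
lemma Union_laminar_finite:
  assumes F: "finite F" "laminar F" "F \<subseteq> sets N"
    and [measurable]: "g \<in> borel_measurable N"
    and avg: "\<And>Q. Q \<in> F \<Longrightarrow> t * emeasure N Q \<le> (\<integral>\<^sup>+x\<in>Q. g x \<partial>N)"
  shows "t * emeasure N (\<Union>F) \<le> (\<integral>\<^sup>+x\<in>\<Union>F. g x \<partial>N)"
proof -
  define G where "G = {Q\<in>F. \<forall>P\<in>F. Q \<subseteq> P \<longrightarrow> P = Q}"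
  have G: "finite G" "G \<subseteq> F" using F by (auto simp: G_def)
  have "\<exists>P\<in>G. Q \<subseteq> P" if "Q \<in> F" for Q
  proof -
    obtain P where "P \<in> F" "Q \<subseteq> P" "\<forall>R\<in>F. P \<subseteq> R \<longrightarrow> P = R"
      using finite_has_maximal2[OF F(1) \<open>Q \<in> F\<close>] by auto
    then show ?thesis unfolding G_def by blast
  qed
  then have U: "\<Union>F = (\<Union>Q\<in>G. Q)" using G by blast
  have disj: "disjoint_family_on (\<lambda>Q. Q) G"
    unfolding disjoint_family_on_def
  proof (intro ballI impI)
    fix P Q assume PQ: "P \<in> G" "Q \<in> G" "P \<noteq> Q"
    then have "P \<inter> Q = {} \<or> P \<subseteq> Q \<or> Q \<subseteq> P" using F(2) unfolding laminar_def G_def by simp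
    with PQ show "P \<inter> Q = {}" unfolding G_def by auto
  qed
  have "t * emeasure N (\<Union>F) = (\<Sum>Q\<in>G. t * emeasure N Q)"
    unfolding U using disj G F(3)
    by (subst sum_emeasure[symmetric, OF _ disj G(1)]) (auto simp: sum_distrib_left)
  also have "\<dots> \<le> (\<Sum>Q\<in>G. emeasure (density N g) Q)"
    using G F avg by (intro sum_mono) (auto simp: emeasure_density subset_iff)
  also have "\<dots> = emeasure (density N g) (\<Union>F)"
    unfolding U using disj G F by (intro sum_emeasure) auto
  also have "\<dots> = (\<integral>\<^sup>+x\<in>\<Union>F. g x \<partial>N)"
    using F by (intro emeasure_density) (auto intro!: sets.finite_Union)
  finally show ?thesis .
qed

lemma Union_laminar_countable:
  assumes C: "countable C" "laminar C" "C \<subseteq> sets N"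
    and [measurable]: "g \<in> borel_measurable N"
    and avg: "\<And>Q. Q \<in> C \<Longrightarrow> t * emeasure N Q \<le> (\<integral>\<^sup>+x\<in>Q. g x \<partial>N)"
  shows "t * emeasure N (\<Union>C) \<le> (\<integral>\<^sup>+x\<in>\<Union>C. g x \<partial>N)"
proof (cases "C = {}")
  case False
  define A where "A = (\<lambda>n. \<Union>(from_nat_into C ` {..n::nat}))"
  have e: "from_nat_into C n \<in> C" for n using False by (rule from_nat_into)
  have U: "\<Union>C = (\<Union>n. A n)"
  proof -
    have "C = range (from_nat_into C)" using C(1) False by (simp add: range_from_nat_into)
    then have *: "\<Union>C = (\<Union>n. from_nat_into C n)" by simp
    have "from_nat_into C n \<subseteq> A n" for n unfolding A_def by (rule Union_upper) simp
    moreover have "A n \<subseteq> (\<Union>n. from_nat_into C n)" for n unfolding A_def by (rule Union_mono) auto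
    ultimately show ?thesis unfolding * by (intro antisym UN_least) (blast intro: UN_I)+
  qed
  have sets: "A n \<in> sets N" for n 
    using subsetD[OF C(3) e] unfolding A_def by (intro sets.finite_UN) simp_all
  have "incseq A" unfolding A_def by (intro incseq_SucI Union_mono image_mono) simp
  then have "emeasure N (\<Union>C) = (SUP n. emeasure N (A n))"
    unfolding U using sets by (intro SUP_emeasure_incseq[symmetric]) auto
  then have "t * emeasure N (\<Union>C) = (SUP n. t * emeasure N (A n))"
    by (simp add: SUP_mult_left_ennreal)
  also have "\<dots> \<le> (\<integral>\<^sup>+x\<in>\<Union>C. g x \<partial>N)"
  proof (intro SUP_least)
    fix n
    have "t * emeasure N (A n) \<le> (\<integral>\<^sup>+x\<in>A n. g x \<partial>N)"
      unfolding A_def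
    proof (rule Union_laminar_finite)
      show "laminar (from_nat_into C ` {..n})" using C(2) e by (simp add: laminar_def)
    qed (use subsetD[OF C(3) e] avg[OF e] in auto)
    also have "\<dots> \<le> (\<integral>\<^sup>+x\<in>\<Union>C. g x \<partial>N)"
      unfolding U by (intro nn_integral_mono mult_left_mono) (auto simp: indicator_def)
    finally show "t * emeasure N (A n) \<le> (\<integral>\<^sup>+x\<in>\<Union>C. g x \<partial>N)" .
  qed
  finally show ?thesis .
qed simp

lemma maximal_fn_weak_type:
  assumes D: "countable D" "laminar D" "D \<subseteq> sets N"
    and g: "g \<in> borel_measurable N"
  shows "t * emeasure N {x\<in>space N. t < maximal_fn N D g x} \<le> (\<integral>\<^sup>+x. g x \<partial>N)"
proof -
  define C where "C = {Q\<in>D. t < (\<integral>\<^sup>+y\<in>Q. g y \<partial>N) / emeasure N Q}"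
  have "{x\<in>space N. t < maximal_fn N D g x} = \<Union>C"
    using subsetD[OF sets.sets_into_space[OF subsetD[OF D(3)]]]
    unfolding C_def maximal_fn_def by (auto simp: less_SUP_iff)
  moreover have "t * emeasure N (\<Union>C) \<le> (\<integral>\<^sup>+x\<in>\<Union>C. g x \<partial>N)"
  proof (rule Union_laminar_countable)
    show "countable C" using D(1) unfolding C_def by (rule countable_subset[rotated]) auto
    show "laminar C" using D(2) unfolding C_def laminar_def by simp
  qed (use D(3) g ennreal_less_divide_imp in \<open>auto simp: C_def\<close>)
  moreover have "(\<integral>\<^sup>+x\<in>\<Union>C. g x \<partial>N) \<le> (\<integral>\<^sup>+x. g x \<partial>N)"
    by (intro nn_integral_mono) (auto simp: indicator_def)
  ultimately show ?thesis by simp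
qed

text \<open>
  Values of g up to t raise an average by at most t; hence only the part of g above t matters at
  the level 2t. In this sharper form the weak type inequality can be integrated over all levels.
\<close>
lemma maximal_fn_le_truncated:
  assumes D: "D \<subseteq> sets N" and [measurable]: "g \<in> borel_measurable N"
  shows "maximal_fn N D g x \<le> maximal_fn N D (\<lambda>y. g y * indicator {y. t < g y} y) x + t"
  unfolding maximal_fn_def
proof (intro SUP_least)
  fix Q assume Q: "Q \<in> {Q \<in> D. x \<in> Q}"
  then have [measurable]: "Q \<in> sets N" using D by auto
  let ?h = "\<lambda>y. g y * indicator {y. t < g y} y"
  have "(\<integral>\<^sup>+y\<in>Q. g y \<partial>N) \<le> (\<integral>\<^sup>+y. ?h y * indicator Q y + t * indicator Q y \<partial>N)"
    by (intro nn_integral_mono) (auto simp: indicator_def)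
  also have "\<dots> = (\<integral>\<^sup>+y\<in>Q. ?h y \<partial>N) + t * emeasure N Q"
    by (simp add: nn_integral_add nn_integral_cmult_indicator)
  finally have "(\<integral>\<^sup>+y\<in>Q. g y \<partial>N) / emeasure N Q \<le> ((\<integral>\<^sup>+y\<in>Q. ?h y \<partial>N) + t * emeasure N Q) / emeasure N Q"
    by (rule divide_right_mono_ennreal)
  also have "\<dots> \<le> (\<integral>\<^sup>+y\<in>Q. ?h y \<partial>N) / emeasure N Q + t"
    unfolding add_divide_distrib_ennreal by (intro add_left_mono ennreal_divide_self_le)
  also have "\<dots> \<le> (SUP Q\<in>{Q \<in> D. x \<in> Q}. (\<integral>\<^sup>+y\<in>Q. ?h y \<partial>N) / emeasure N Q) + t"
    using Q by (intro add_right_mono SUP_upper) auto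
  finally show "(\<integral>\<^sup>+y\<in>Q. g y \<partial>N) / emeasure N Q \<le> \<dots>" .
qed

text \<open>
  The constant depends on s only, not on N or D; the weighted estimates below rest on this. The
  level set of M g at height t is controlled by g on {2 g > t}, and integrating these bounds
  against s t^(s-1) dt gives the claim by the layer cake formula, used for M g and for 2 g.
\<close>
theorem maximal_fn_strong_type:
  assumes N: "sigma_finite_measure N"
    and D: "countable D" "laminar D" "D \<subseteq> sets N"
    and [measurable]: "g \<in> borel_measurable N"
    and s: "1 < s"
  shows "(\<integral>\<^sup>+x. ennpowr (maximal_fn N D g x) s \<partial>N)
    \<le> ennreal (s / (s - 1) * 2 powr s) * (\<integral>\<^sup>+x. ennpowr (g x) s \<partial>N)"
proof -
  interpret N: sigma_finite_measure N by fact
  interpret P: pair_sigma_finite N lborel by standard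
  let ?M = "maximal_fn N D g"
  have [measurable]: "?M \<in> borel_measurable N" using D by (intro maximal_fn_measurable)
  have level: "emeasure N {x\<in>space N. ennreal t < ?M x}
      \<le> ennreal (2 / t) * (\<integral>\<^sup>+x. g x * indicator {x. ennreal t < 2 * g x} x \<partial>N)" if t: "0 < t" for t
  proof -
    let ?h = "\<lambda>y. g y * indicator {y. ennreal (t/2) < g y} y"
    have half: "ennreal t = ennreal (t/2) + ennreal (t/2)"
      using t by (simp flip: ennreal_plus)
    have iff: "ennreal t < 2 * a \<longleftrightarrow> ennreal (t/2) < a" for a
      using t by (cases a) (auto simp: ennreal_less_iff ennreal_mult_top simp flip: ennreal_numeral ennreal_mult)
    have "{x\<in>space N. ennreal t < ?M x} \<subseteq> {x\<in>space N. ennreal (t/2) < maximal_fn N D ?h x}"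
    proof safe
      fix x assume "ennreal t < ?M x"
      also have "?M x \<le> maximal_fn N D ?h x + ennreal (t/2)"
        using D(3) by (rule maximal_fn_le_truncated) simp
      finally show "ennreal (t/2) < maximal_fn N D ?h x"
        unfolding half by (metis add_right_mono not_le)
    qed
    then have "ennreal (t/2) * emeasure N {x\<in>space N. ennreal t < ?M x}
      \<le> ennreal (t/2) * emeasure N {x\<in>space N. ennreal (t/2) < maximal_fn N D ?h x}"
      using D by (intro mult_left_mono emeasure_mono) (auto intro!: borel_measurable_less maximal_fn_measurable)
    also have "\<dots> \<le> (\<integral>\<^sup>+x. ?h x \<partial>N)"
      using D by (rule maximal_fn_weak_type) simp
    finally have "ennreal (2/t) * (ennreal (t/2) * emeasure N {x\<in>space N. ennreal t < ?M x})
       \<le> ennreal (2/t) * (\<integral>\<^sup>+x. ?h x \<partial>N)" by (rule mult_left_mono) simp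
    moreover have "ennreal (2/t) * (ennreal (t/2) * c) = c" for c
      using t by (simp add: mult.assoc[symmetric] flip: ennreal_mult)
    ultimately show ?thesis by (simp add: iff)
  qed
  have "(\<integral>\<^sup>+x. ennpowr (?M x) s \<partial>N)
    = (\<integral>\<^sup>+x. \<integral>\<^sup>+t. ennreal (s * t powr (s - 1)) * indicator {t. 0 < t \<and> ennreal t < ?M x} t \<partial>lborel \<partial>N)"
    using s by (subst layer_cake_ennpowr) auto
  also have "\<dots> = (\<integral>\<^sup>+t. \<integral>\<^sup>+x. ennreal (s * t powr (s - 1)) * indicator {t. 0 < t \<and> ennreal t < ?M x} t \<partial>N \<partial>lborel)"
    by (subst P.Fubini') (auto simp: split_beta' indicator_def intro!: measurable_If)
  also have "\<dots> \<le> (\<integral>\<^sup>+t. \<integral>\<^sup>+x. ennreal (2 * s * t powr (s - 2)) * (g x * indicator {t. 0 < t \<and> ennreal t < 2 * g x} t) \<partial>N \<partial>lborel)"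
  proof (rule nn_integral_mono)
    fix t :: real
    show "(\<integral>\<^sup>+x. ennreal (s * t powr (s - 1)) * indicator {t. 0 < t \<and> ennreal t < ?M x} t \<partial>N)
      \<le> (\<integral>\<^sup>+x. ennreal (2 * s * t powr (s - 2)) * (g x * indicator {t. 0 < t \<and> ennreal t < 2 * g x} t) \<partial>N)"
    proof (cases "0 < t")
      case t: True
      have "(\<integral>\<^sup>+x. ennreal (s * t powr (s - 1)) * indicator {t. 0 < t \<and> ennreal t < ?M x} t \<partial>N)
        = ennreal (s * t powr (s - 1)) * (\<integral>\<^sup>+x. indicator {x\<in>space N. ennreal t < ?M x} x \<partial>N)"
        using t by (subst nn_integral_cmult[symmetric]) (auto intro!: nn_integral_cong simp: indicator_def)
      also have "\<dots> \<le> ennreal (s * t powr (s - 1)) * (ennreal (2 / t) * (\<integral>\<^sup>+x. g x * indicator {x. ennreal t < 2 * g x} x \<partial>N))"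
        using level[OF t] by (intro mult_left_mono) auto
      also have "\<dots> = ennreal (2 * s * t powr (s - 2)) * (\<integral>\<^sup>+x. g x * indicator {x. ennreal t < 2 * g x} x \<partial>N)"
      proof -
        have "s * t powr (s - 1) * (2 / t) = 2 * s * t powr (s - 2)"
          using t by (simp add: powr_diff power2_eq_square)
        then show ?thesis using t s by (simp add: mult.assoc[symmetric] flip: ennreal_mult)
      qed
      also have "\<dots> = (\<integral>\<^sup>+x. ennreal (2 * s * t powr (s - 2)) * (g x * indicator {t. 0 < t \<and> ennreal t < 2 * g x} t) \<partial>N)"
        using t by (subst nn_integral_cmult[symmetric]) (auto intro!: nn_integral_cong simp: indicator_def)
      finally show ?thesis .
    qed simp
  qed
  also have "\<dots> = (\<integral>\<^sup>+x. \<integral>\<^sup>+t. ennreal (2 * s * t powr (s - 2)) * (g x * indicator {t. 0 < t \<and> ennreal t < 2 * g x} t) \<partial>lborel \<partial>N)"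
    by (subst P.Fubini') (auto simp: split_beta' indicator_def intro!: measurable_If)
  also have "\<dots> = (\<integral>\<^sup>+x. ennreal (s / (s - 1) * 2 powr s) * ennpowr (g x) s \<partial>N)"
  proof (rule nn_integral_cong)
    fix x
    have "(\<integral>\<^sup>+t. ennreal (2 * s * t powr (s - 2)) * (g x * indicator {t. 0 < t \<and> ennreal t < 2 * g x} t) \<partial>lborel)
      = (\<integral>\<^sup>+t. (ennreal (2 * s / (s - 1)) * g x) * (ennreal ((s - 1) * t powr (s - 1 - 1)) * indicator {t. 0 < t \<and> ennreal t < 2 * g x} t) \<partial>lborel)"
    proof (rule nn_integral_cong)
      fix t :: real
      have "ennreal (2 * s * t powr (s - 2)) = ennreal (2 * s / (s - 1)) * ennreal ((s - 1) * t powr (s - 1 - 1))"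
        using s by (simp flip: ennreal_mult)
      then show "ennreal (2 * s * t powr (s - 2)) * (g x * indicator {t. 0 < t \<and> ennreal t < 2 * g x} t)
        = (ennreal (2 * s / (s - 1)) * g x) * (ennreal ((s - 1) * t powr (s - 1 - 1)) * indicator {t. 0 < t \<and> ennreal t < 2 * g x} t)"
        by (simp only: ac_simps)
    qed
    also have "\<dots> = ennreal (2 * s / (s - 1)) * g x * ennpowr (2 * g x) (s - 1)"
      using s by (subst nn_integral_cmult) (auto simp: layer_cake_ennpowr[of "s - 1"])
    also have "\<dots> = ennreal (2 * s / (s - 1)) * ennreal (2 powr (s - 1)) * (g x * ennpowr (g x) (s - 1))"
    proof -
      have "ennpowr 2 (s - 1) = ennreal (2 powr (s - 1))"
        using ennpowr_ennreal[of 2 "s - 1"] by simp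
      then show ?thesis using s by (simp add: ennpowr_mult ac_simps)
    qed
    also have "g x * ennpowr (g x) (s - 1) = ennpowr (g x) s"
      using ennpowr_add[of 1 "s - 1" "g x"] s by simp
    also have "ennreal (2 * s / (s - 1)) * ennreal (2 powr (s - 1)) = ennreal (s / (s - 1) * 2 powr s)"
      using s by (simp add: powr_diff field_simps flip: ennreal_mult)
    finally show "(\<integral>\<^sup>+t. ennreal (2 * s * t powr (s - 2)) * (g x * indicator {t. 0 < t \<and> ennreal t < 2 * g x} t) \<partial>lborel)
      = ennreal (s / (s - 1) * 2 powr s) * ennpowr (g x) s" .
  qed
  also have "\<dots> = ennreal (s / (s - 1) * 2 powr s) * (\<integral>\<^sup>+x. ennpowr (g x) s \<partial>N)"
    by (rule nn_integral_cmult) simp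
  finally show ?thesis .
qed

section \<open>Shifted triadic grids\<close>

text \<open>
  The parameter \<tau> shifts the partition at every scale by the same fraction of the cell
  length, not by a fixed vector.
\<close>
definition cell :: "('n \<Rightarrow> real) \<Rightarrow> int \<Rightarrow> ('n \<Rightarrow> int) \<Rightarrow> (real ^ 'n) set" where
  "cell \<tau> k m = {x. \<forall>i. \<lfloor>x $ i / 3 powi k + \<tau> i\<rfloor> = m i}"

definition grid :: "('n \<Rightarrow> real) \<Rightarrow> (real ^ 'n) set set" where
  "grid \<tau> = range (\<lambda>(k, m). cell \<tau> k m)"

definition shifts :: "('n::finite \<Rightarrow> real) set" where
  "shifts = {\<tau>. \<forall>i. \<tau> i \<in> {0, 1/2}}"

lemma finite_shifts: "finite (shifts :: ('n::finite \<Rightarrow> real) set)"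
proof -
  have "shifts = (UNIV \<rightarrow>\<^sub>E {0, 1/2} :: ('n \<Rightarrow> real) set)" by (auto simp: shifts_def PiE_def Pi_def)
  moreover have "finite (UNIV \<rightarrow>\<^sub>E {0, 1/2} :: ('n \<Rightarrow> real) set)" by (intro finite_PiE) auto
  ultimately show ?thesis by (simp only:)
qed

lemma countable_grid: "countable (grid \<tau> :: (real ^ 'n) set set)"
  unfolding grid_def by simp

lemma cell_measurable: "cell \<tau> k m \<in> sets borel"
  unfolding cell_def by measurable

text \<open>
  For t = 1/2 the shifted partition at scale 3^(l+1) is again a union of shifted cells at scale
  3^l: the point z/3^(l+1) + t is a third of (z/3^l + t) + 2t, and 2t is an integer. This is why
  the base is 3: with base 2 the half-shifted partitions are not nested.
\<close>
lemma floor_coarser: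
  assumes t: "t \<in> {0, 1/2}" and kl: "k \<le> l"
    and eq: "\<lfloor>x / 3 powi k + t\<rfloor> = \<lfloor>y / 3 powi k + (t::real)\<rfloor>"
  shows "\<lfloor>x / 3 powi l + t\<rfloor> = \<lfloor>y / 3 powi l + t\<rfloor>"
  using kl
proof (induction l rule: int_ge_induct)
  case base
  then show ?case by (rule eq)
next
  case (step l)
  obtain j :: int where j: "2 * t = of_int j"
    using t by (auto intro: that[of 0] that[of 1])
  have "\<lfloor>z / 3 powi (l + 1) + t\<rfloor> = (\<lfloor>z / 3 powi l + t\<rfloor> + j) div 3" for z :: real
  proof -
    have "z / 3 powi (l + 1) + t = (z / 3 powi l + t + 2 * t) / of_int 3"
      by (simp add: power_int_add field_simps)
    also have "\<lfloor>\<dots>\<rfloor> = \<lfloor>z / 3 powi l + t + 2 * t\<rfloor> div 3"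
      by (rule floor_divide_real_eq_div) simp
    finally show ?thesis by (simp add: j)
  qed
  with step.IH show ?case by simp
qed

lemma laminar_grid:
  assumes "\<tau> \<in> shifts"
  shows "laminar (grid \<tau>)"
proof -
  have sub: "cell \<tau> k m \<subseteq> cell \<tau> l m'"
    if "k \<le> l" "x \<in> cell \<tau> k m" "x \<in> cell \<tau> l m'" for k l m m' x
  proof
    fix y assume "y \<in> cell \<tau> k m"
    then have "\<lfloor>y $ i / 3 powi l + \<tau> i\<rfloor> = \<lfloor>x $ i / 3 powi l + \<tau> i\<rfloor>" for i
      using that assms by (intro floor_coarser[OF _ that(1)]) (auto simp: cell_def shifts_def)
    with that show "y \<in> cell \<tau> l m'" by (simp add: cell_def)
  qed
  show ?thesis unfolding laminar_def grid_def
  proof (intro ballI)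
    fix P Q assume "P \<in> range (\<lambda>(k, m). cell \<tau> k m)" "Q \<in> range (\<lambda>(k, m). cell \<tau> k m)"
    then obtain k m l m' where PQ: "P = cell \<tau> k m" "Q = cell \<tau> l m'" by auto
    show "P \<inter> Q = {} \<or> P \<subseteq> Q \<or> Q \<subseteq> P"
    proof (cases "P \<inter> Q = {}")
      case False
      then obtain x where "x \<in> P" "x \<in> Q" by auto
      with sub[of k l x m m'] sub[of l k x m' m] PQ show ?thesis by (cases "k \<le> l") auto
    qed simp
  qed
qed

lemma emeasure_cube:
  fixes a :: "real ^ 'n"
  assumes "0 \<le> s"
  shows "emeasure lborel (cbox a (\<chi> i. a $ i + s)) = ennreal (s ^ CARD('n))"
    and "emeasure lborel (box a (\<chi> i. a $ i + s)) = ennreal (s ^ CARD('n))"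
proof -
  have *: "((\<chi> i. a $ i + s) - a) \<bullet> b = s" if "b \<in> Basis" for b
    using that by (auto simp: Basis_vec_def inner_axis)
  have "a \<bullet> b \<le> (\<chi> i. a $ i + s) \<bullet> b" if "b \<in> Basis" for b
    using *[OF that] assms by (simp add: inner_diff_left)
  then show "emeasure lborel (cbox a (\<chi> i. a $ i + s)) = ennreal (s ^ CARD('n))"
    "emeasure lborel (box a (\<chi> i. a $ i + s)) = ennreal (s ^ CARD('n))"
    using * by (simp_all add: emeasure_lborel_cbox emeasure_lborel_box)
qed

lemma cell_almost_cube:
  fixes \<tau> :: "'n::finite \<Rightarrow> real"
  obtains a where "box a (\<chi> i. a $ i + 3 powi k) \<subseteq> cell \<tau> k m"
    "cell \<tau> k m \<subseteq> cbox a (\<chi> i. a $ i + 3 powi k)"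
proof
  define a :: "real ^ 'n" where "a = (\<chi> i. (of_int (m i) - \<tau> i) * 3 powi k)"
  have pos: "(0::real) < 3 powi k" by simp
  have iff: "x \<in> cell \<tau> k m \<longleftrightarrow> (\<forall>i. a $ i \<le> x $ i \<and> x $ i < a $ i + 3 powi k)" for x
    using pos by (auto simp: cell_def a_def floor_eq_iff field_simps)
  show "box a (\<chi> i. a $ i + 3 powi k) \<subseteq> cell \<tau> k m"
    by (auto simp: mem_box_cart iff less_imp_le)
  show "cell \<tau> k m \<subseteq> cbox a (\<chi> i. a $ i + 3 powi k)"
    by (auto simp: mem_box_cart iff less_imp_le)
qed

lemma emeasure_cell: 
  fixes \<tau> :: "'n::finite \<Rightarrow> real"
  shows "emeasure lborel (cell \<tau> k m) = ennreal ((3 powi k) ^ CARD('n))"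
proof -
  obtain a where a: "box a (\<chi> i. a $ i + 3 powi k) \<subseteq> cell \<tau> k m"
    "cell \<tau> k m \<subseteq> cbox a (\<chi> i. a $ i + 3 powi k)" by (rule cell_almost_cube)
  have "ennreal ((3 powi k) ^ CARD('n)) \<le> emeasure lborel (cell \<tau> k m)"
    using emeasure_mono[OF a(1), of lborel] by (simp add: emeasure_cube cell_measurable)
  moreover have "emeasure lborel (cell \<tau> k m) \<le> ennreal ((3 powi k) ^ CARD('n))"
    using emeasure_mono[OF a(2), of lborel] by (simp add: emeasure_cube)
  ultimately show ?thesis by (rule antisym[rotated])
qed

lemma grid_cube:
  assumes "Q \<in> grid (\<tau> :: 'n::finite \<Rightarrow> real)"
  obtains R where "R \<in> cubes" "Q \<subseteq> R" "emeasure lborel R = emeasure lborel Q"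
proof -
  obtain k m where Q: "Q = cell \<tau> k m" using assms by (auto simp: grid_def)
  obtain a where a: "cell \<tau> k m \<subseteq> cbox a (\<chi> i. a $ i + 3 powi k)" by (rule cell_almost_cube)
  have "cbox a (\<chi> i. a $ i + 3 powi k) \<in> cubes"
    unfolding cubes_def by (intro CollectI exI[of _ a] exI[of _ "3 powi k"]) simp
  with a that show ?thesis by (simp add: Q emeasure_cell emeasure_cube)
qed

lemma grid_sets: "grid \<tau> \<subseteq> sets borel"
  by (auto simp: grid_def cell_measurable)

lemma grid_emeasure:
  assumes "Q \<in> grid (\<tau> :: 'n::finite \<Rightarrow> real)"
  shows "0 < emeasure lborel Q" "emeasure lborel Q < top"
  using assms by (auto simp: grid_def emeasure_cell)

text \<open>
  In each coordinate, the end points of the unshifted and of the shifted intervals of length h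
  are h/2 apart, so an interval of length at most h/2 lies in a cell of one of the two families.
  The factor 12 comes from choosing the least power of 3 above 4 \<rho>.
\<close>
lemma ball_in_grid:
  fixes y :: "real ^ 'n"
  assumes \<rho>: "0 < \<rho>"
  obtains \<tau> Q where "\<tau> \<in> shifts" "Q \<in> grid \<tau>" "ball y \<rho> \<subseteq> Q"
    "emeasure lborel Q \<le> ennreal ((12 * \<rho>) ^ CARD('n))"
proof -
  define k where "k = \<lceil>log 3 (4 * \<rho>)\<rceil>"
  have pw: "3 powi k = 3 powr (of_int k :: real)" by (simp add: powr_real_of_int')
  have "4 * \<rho> = 3 powr (log 3 (4 * \<rho>))" using \<rho> by simp
  also have "\<dots> \<le> 3 powr (of_int k)" unfolding k_def by (intro powr_mono) linarith+
  finally have k1: "4 * \<rho> \<le> 3 powi k" by (simp add: pw)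
  have "3 powr (of_int k) \<le> 3 powr (log 3 (4 * \<rho>) + 1)" unfolding k_def by (intro powr_mono) linarith+
  also have "\<dots> = 12 * \<rho>" using \<rho> by (simp add: powr_add)
  finally have k2: "3 powi k \<le> 12 * \<rho>" by (simp add: pw)
  have pos: "(0::real) < 3 powi k" by simp
  \<comment> \<open>The unshifted cell works if the fractional part of a is in the middle half, the shifted one otherwise.\<close>
  have "\<exists>t\<in>{0,1/2::real}. \<exists>j. \<forall>z. \<bar>z - a\<bar> < 1/4 \<longrightarrow> \<lfloor>z + t\<rfloor> = j" for a
  proof (cases "1/4 \<le> frac a \<and> frac a \<le> 3/4")
    case True
    then have "\<forall>z. \<bar>z - a\<bar> < 1/4 \<longrightarrow> \<lfloor>z + 0\<rfloor> = \<lfloor>a\<rfloor>"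
      unfolding frac_def by (intro allI impI, subst floor_eq_iff, intro conjI) linarith+
    then show ?thesis by blast
  next
    case False
    show ?thesis
    proof (cases "frac a < 1/4")
      case True
      then have "\<forall>z. \<bar>z - a\<bar> < 1/4 \<longrightarrow> \<lfloor>z + 1/2\<rfloor> = \<lfloor>a\<rfloor>"
        using frac_ge_0[of a] unfolding frac_def by (intro allI impI, subst floor_eq_iff, intro conjI) linarith+
      then show ?thesis by blast
    next
      case F: False
      have "\<forall>z. \<bar>z - a\<bar> < 1/4 \<longrightarrow> \<lfloor>z + 1/2\<rfloor> = \<lfloor>a\<rfloor> + 1"
        using False F frac_lt_1[of a] unfolding frac_def by (intro allI impI, subst floor_eq_iff, intro conjI) linarith+
      then show ?thesis by blast
    qed
  qed
  then have "\<forall>i. \<exists>t j. t \<in> {0,1/2::real} \<and> (\<forall>z. \<bar>z - y $ i / 3 powi k\<bar> < 1/4 \<longrightarrow> \<lfloor>z + t\<rfloor> = j)" by blast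
  then obtain \<tau> m where *: "\<And>i. \<tau> i \<in> {0,1/2::real}"
    "\<And>i z. \<bar>z - y $ i / 3 powi k\<bar> < 1/4 \<Longrightarrow> \<lfloor>z + \<tau> i\<rfloor> = m i" by metis
  show ?thesis
  proof
    show "\<tau> \<in> shifts" using * by (simp add: shifts_def)
    show "cell \<tau> k m \<in> grid \<tau>" by (auto simp: grid_def)
    show "ball y \<rho> \<subseteq> cell \<tau> k m"
    proof
      fix x assume "x \<in> ball y \<rho>"
      then have less: "\<bar>x $ i - y $ i\<bar> < \<rho>" for i
        using dist_vec_nth_le[of x i y] by (simp add: dist_commute dist_real_def)
      have "\<bar>x $ i - y $ i\<bar> / 3 powi k < 1/4" for i
        using k1 less[of i] by (simp add: pos_divide_less_eq[OF pos])
      then have "\<bar>x $ i / 3 powi k - y $ i / 3 powi k\<bar> < 1/4" for i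
        using pos by (simp add: diff_divide_distrib[symmetric] abs_divide)
      then show "x \<in> cell \<tau> k m" using *(2) by (simp add: cell_def)
    qed
    show "emeasure lborel (cell \<tau> k m) \<le> ennreal ((12 * \<rho>) ^ CARD('n))"
      unfolding emeasure_cell using k2 pos by (intro ennreal_leI power_mono) auto
  qed
qed

definition grid_maximal :: "(real ^ 'n \<Rightarrow> ennreal) \<Rightarrow> real ^ 'n \<Rightarrow> ennreal" where
  "grid_maximal g y = (SUP \<tau>\<in>shifts. maximal_fn lborel (grid \<tau>) g y)"

lemma ball_integral_le_grid_maximal:
  fixes y :: "real ^ 'n"
  assumes "0 < \<rho>"
  shows "(\<integral>\<^sup>+x\<in>ball y \<rho>. g x \<partial>lborel) \<le> ennreal ((12 * \<rho>) ^ CARD('n)) * grid_maximal g y"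
proof -
  obtain \<tau> Q where Q: "\<tau> \<in> shifts" "Q \<in> grid \<tau>" "ball y \<rho> \<subseteq> Q"
    "emeasure lborel Q \<le> ennreal ((12 * \<rho>) ^ CARD('n))" using ball_in_grid[OF assms] by blast
  note em = grid_emeasure[OF Q(2)]
  have "(\<integral>\<^sup>+x\<in>ball y \<rho>. g x \<partial>lborel) \<le> (\<integral>\<^sup>+x\<in>Q. g x \<partial>lborel)"
    using Q(3) by (intro nn_integral_mono mult_left_mono) (auto simp: indicator_def)
  also have "\<dots> = emeasure lborel Q * ((\<integral>\<^sup>+x\<in>Q. g x \<partial>lborel) / emeasure lborel Q)"
    using em by (simp add: ennreal_times_divide mult.commute[of "emeasure lborel Q"] mult_divide_eq_ennreal)
  also have "\<dots> \<le> ennreal ((12 * \<rho>) ^ CARD('n)) * grid_maximal g y"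
  proof (intro mult_mono)
    have "(\<integral>\<^sup>+x\<in>Q. g x \<partial>lborel) / emeasure lborel Q \<le> maximal_fn lborel (grid \<tau>) g y"
      using Q assms by (intro maximal_fn_upper) auto
    also have "\<dots> \<le> grid_maximal g y" unfolding grid_maximal_def using Q(1) by (rule SUP_upper)
    finally show "(\<integral>\<^sup>+x\<in>Q. g x \<partial>lborel) / emeasure lborel Q \<le> grid_maximal g y" .
  qed (use Q in auto)
  finally show ?thesis .
qed

lemma grid_maximal_measurable [measurable]:
  fixes g :: "real ^ 'n \<Rightarrow> ennreal"
  shows "grid_maximal g \<in> borel_measurable borel"
proof -
  have "maximal_fn lborel (grid \<tau>) g \<in> borel_measurable lborel" for \<tau> :: "'n \<Rightarrow> real"
    by (rule maximal_fn_measurable) (simp_all add: countable_grid grid_sets)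
  then show ?thesis unfolding grid_maximal_def
    by (intro borel_measurable_SUP) (auto intro: countable_finite finite_shifts)
qed

section \<open>Hedberg's inequality\<close>

text \<open>
  Decompose the ball into the annuli R/2^(j+1) \<le> |x - y| < R/2^j; the contributions form a
  geometric series with ratio 2^(-a). The centre contributes nothing, since the kernel takes the
  value 0 there. With \<nu> = g dx this is the local half of Hedberg's inequality; with Lebesgue
  measure and small a it computes the mass of the weights |x|^(a-n), where the factor 1/(1 -
  2^(-a)) of order 1/a is essential.
\<close>
lemma nn_integral_riesz_ball:
  fixes y :: "real ^ 'n" and \<nu> :: "(real ^ 'n) measure"
  assumes [measurable_cong]: "sets \<nu> = sets borel"
    and a: "0 < a" "a \<le> real CARD('n)" and R: "0 < R"
    and D: "\<And>\<rho>. 0 < \<rho> \<Longrightarrow> \<rho> \<le> R \<Longrightarrow> emeasure \<nu> (ball y \<rho>) \<le> D * ennreal (\<rho> ^ CARD('n))"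
  shows "(\<integral>\<^sup>+x\<in>ball y R. ennreal (norm (x - y) powr (a - real CARD('n))) \<partial>\<nu>)
    \<le> ennreal (2 powr (real CARD('n) - a) / (1 - 2 powr - a) * R powr a) * D"
proof -
  let ?n = "real CARD('n)"
  define c where "c = (\<lambda>j::nat. (R / 2 ^ (j + 1)) powr (a - ?n))"
  have c0: "0 \<le> c j" for j by (simp add: c_def)
  have pt: "ennreal (norm (x - y) powr (a - ?n)) * indicator (ball y R) x
      \<le> (\<Sum>j. ennreal (c j) * indicator (ball y (R / 2 ^ j)) x)" for x
  proof (cases "x \<in> ball y R \<and> x \<noteq> y")
    case True
    define d where "d = norm (x - y)"
    have d: "0 < d" "d < R" using True by (auto simp: d_def dist_norm norm_minus_commute)
    have "\<exists>j. R / 2 ^ (j + 1) \<le> d"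
    proof -
      obtain j where "R / d < 2 ^ j" using real_arch_pow[of 2 "R / d"] by auto
      then have "R < d * 2 ^ j" using d by (simp add: field_simps)
      also have "\<dots> \<le> d * 2 ^ (j + 1)" using d by simp
      finally show ?thesis using d by (intro exI[of _ j]) (simp add: field_simps)
    qed
    define j where "j = (LEAST j. R / 2 ^ (j + 1) \<le> d)"
    have j1: "R / 2 ^ (j + 1) \<le> d" unfolding j_def by (rule LeastI_ex) fact
    have j2: "d < R / 2 ^ j"
    proof (cases j)
      case (Suc i)
      then have "\<not> R / 2 ^ (i + 1) \<le> d" unfolding j_def by (intro not_less_Least) simp
      with Suc show ?thesis by simp
    qed (use d in simp)
    have "d powr (a - ?n) \<le> c j" unfolding c_def
      using j1 R a by (intro powr_mono2') auto
    then have "ennreal (norm (x - y) powr (a - ?n)) * indicator (ball y R) x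
      \<le> ennreal (c j) * indicator (ball y (R / 2 ^ j)) x"
      using j2 d by (simp add: d_def dist_norm norm_minus_commute ennreal_leI)
    also have "\<dots> \<le> (\<Sum>j. ennreal (c j) * indicator (ball y (R / 2 ^ j)) x)"
      using sum_le_suminf[OF summableI, of "{j}" "\<lambda>j. ennreal (c j) * indicator (ball y (R / 2 ^ j)) x"]
      by (simp only: sum.insert sum.empty finite.intros empty_iff not_False_eq_True add_0_right) simp
    finally show ?thesis .
  qed auto
  define r where "r = (2::real) powr - a"
  have r: "0 < r" "r < 1" using a by (auto simp: r_def powr_less_one)
  have scale_j: "c j * (R / 2 ^ j) ^ CARD('n) = 2 powr (?n - a) * R powr a * r ^ j" for j
  proof -
    have "(R / 2 ^ j) ^ CARD('n) = (R / 2 ^ j) powr ?n" using R by (simp add: powr_realpow)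
    moreover have "c j = (R / 2 ^ j) powr (a - ?n) * (1/2) powr (a - ?n)"
    proof -
      have "R / 2 ^ (j + 1) = (R / 2 ^ j) * (1/2)" by simp
      then show ?thesis using R unfolding c_def by (simp only: powr_mult)
    qed
    moreover have "(1/2::real) powr (a - ?n) = 2 powr (?n - a)"
      by (simp add: powr_divide powr_minus_divide[symmetric])
    moreover have "(R / 2 ^ j) powr (a - ?n) * (R / 2 ^ j) powr ?n = R powr a * r ^ j"
    proof -
      have "(R / 2 ^ j) powr (a - ?n) * (R / 2 ^ j) powr ?n = (R / 2 ^ j) powr a"
        by (simp add: powr_add[symmetric])
      also have "\<dots> = R powr a / (2 ^ j) powr a" using R by (simp add: powr_divide)
      also have "((2::real) ^ j) powr a = 2 powr (a * j)"
        by (simp add: powr_realpow[symmetric] powr_powr mult.commute)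
      also have "R powr a / 2 powr (a * j) = R powr a * r ^ j"
      proof -
        have "r ^ j = 2 powr (- (a * j))" by (simp add: r_def powr_realpow[symmetric] powr_powr)
        then show ?thesis by (simp add: powr_minus_divide)
      qed
      finally show ?thesis .
    qed
    ultimately show ?thesis by simp
  qed
  have "(\<integral>\<^sup>+x\<in>ball y R. ennreal (norm (x - y) powr (a - ?n)) \<partial>\<nu>)
    \<le> (\<integral>\<^sup>+x. (\<Sum>j. ennreal (c j) * indicator (ball y (R / 2 ^ j)) x) \<partial>\<nu>)"
    using pt by (intro nn_integral_mono)
  also have "\<dots> = (\<Sum>j. \<integral>\<^sup>+x. ennreal (c j) * indicator (ball y (R / 2 ^ j)) x \<partial>\<nu>)"
    by (intro nn_integral_suminf borel_measurable_times_ennreal borel_measurable_indicator borel_measurable_const)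
       (simp add: assms(1))
  also have "\<dots> = (\<Sum>j. ennreal (c j) * emeasure \<nu> (ball y (R / 2 ^ j)))"
    by (simp add: nn_integral_cmult_indicator assms(1))
  also have "\<dots> \<le> (\<Sum>j. ennreal (2 powr (?n - a) * R powr a * r ^ j) * D)"
  proof (intro suminf_le summableI)
    fix j
    have "R / 2 ^ j \<le> R" using R by (simp add: field_simps)
    then have "ennreal (c j) * emeasure \<nu> (ball y (R / 2 ^ j)) \<le> ennreal (c j) * (D * ennreal ((R / 2 ^ j) ^ CARD('n)))"
      using R by (intro mult_left_mono D) auto
    also have "\<dots> = ennreal (c j * (R / 2 ^ j) ^ CARD('n)) * D"
      using c0 R by (simp add: ennreal_mult ac_simps)
    finally show "ennreal (c j) * emeasure \<nu> (ball y (R / 2 ^ j)) \<le> ennreal (2 powr (?n - a) * R powr a * r ^ j) * D"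
      unfolding scale_j .
  qed
  also have "\<dots> = (\<Sum>j. ennreal (2 powr (?n - a) * R powr a * r ^ j)) * D"
    by (rule ennreal_suminf_multc)
  also have "(\<Sum>j. ennreal (2 powr (?n - a) * R powr a * r ^ j)) = ennreal (\<Sum>j. 2 powr (?n - a) * R powr a * r ^ j)"
    using r by (intro suminf_ennreal2 summable_mult summable_geometric) auto
  also have "(\<Sum>j. 2 powr (?n - a) * R powr a * r ^ j) = 2 powr (?n - a) / (1 - r) * R powr a"
    using r by (simp add: suminf_mult suminf_geometric)
  finally show ?thesis unfolding r_def .
qed

text \<open>
  Hedberg's inequality. Split the integral at radius R: the near part is at most a multiple of
  R^a M g(y), the far part at most R^(a-n) \<integral>g. The choice R^n = (\<integral>g)/(M
  g(y)) makes both equal to the right hand side.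
\<close>
lemma riesz_le_grid_maximal:
  fixes y :: "real ^ 'n" and g :: "real ^ 'n \<Rightarrow> ennreal"
  assumes [measurable]: "g \<in> borel_measurable borel"
    and a: "0 < a" "a < real CARD('n)"
    and fin: "(\<integral>\<^sup>+x. g x \<partial>lborel) < top"
  shows "(\<integral>\<^sup>+x. ennreal (norm (x - y) powr (a - real CARD('n))) * g x \<partial>lborel)
    \<le> ennreal (12 ^ CARD('n) * 2 powr (real CARD('n) - a) / (1 - 2 powr - a) + 1)
       * (ennpowr (\<integral>\<^sup>+x. g x \<partial>lborel) (a / real CARD('n))
       * ennpowr (grid_maximal g y) (1 - a / real CARD('n)))"
proof -
  let ?n = "real CARD('n)"
  let ?K = "\<lambda>x. ennreal (norm (x - y) powr (a - ?n))"
  define G where "G = (\<integral>\<^sup>+x. g x \<partial>lborel)"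
  define \<mu> where "\<mu> = grid_maximal g y"
  define C where "C = 12 ^ CARD('n) * 2 powr (?n - a) / (1 - 2 powr - a)"
  have r: "2 powr - a < (1::real)" using a by (simp add: powr_less_one)
  have C0: "0 \<le> C" using r by (simp add: C_def)
  have n: "0 < ?n" by simp
  have ex: "0 < a / ?n" "0 < 1 - a / ?n" using a by auto
  have "\<mu> \<noteq> 0" if "G \<noteq> 0"
  proof
    assume "\<mu> = 0"
    then have "(\<integral>\<^sup>+x\<in>ball y (Suc k). g x \<partial>lborel) = 0" for k :: nat
      using ball_integral_le_grid_maximal[of "Suc k" g y] by (simp add: \<mu>_def)
    then have "AE x in lborel. g x * indicator (ball y (Suc k)) x = 0" for k :: nat
      by (subst nn_integral_0_iff_AE[symmetric]) (measurable, simp)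
    then have "AE x in lborel. \<forall>k::nat. g x * indicator (ball y (Suc k)) x = 0"
      unfolding AE_all_countable by blast
    then have "AE x in lborel. g x = 0"
    proof eventually_elim
      case (elim x)
      obtain k :: nat where "dist y x < k" using reals_Archimedean2 by blast
      then have "x \<in> ball y (Suc k)" by auto
      with elim show ?case by (metis indicator_simps(1) mult.right_neutral)
    qed
    then have "G = 0" unfolding G_def by (subst nn_integral_0_iff_AE) auto
    with that show False by simp
  qed
  then consider "G = 0" | "G \<noteq> 0" "\<mu> = top" | \<gamma> m where "0 < \<gamma>" "G = ennreal \<gamma>" "0 < m" "\<mu> = ennreal m"
    using fin unfolding G_def[symmetric]
    by (cases G rule: ennreal_pos_cases; cases \<mu> rule: ennreal_pos_cases) auto
  then have "(\<integral>\<^sup>+x. ?K x * g x \<partial>lborel) \<le> ennreal (C + 1) * (ennpowr G (a / ?n) * ennpowr \<mu> (1 - a / ?n))"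
  proof cases
    case 1
    then have "AE x in lborel. g x = 0" unfolding G_def by (subst (asm) nn_integral_0_iff_AE) auto
    then have "AE x in lborel. ?K x * g x = 0" by eventually_elim simp
    then have "(\<integral>\<^sup>+x. ?K x * g x \<partial>lborel) = 0" by (subst nn_integral_0_iff_AE) auto
    then show ?thesis by simp
  next
    case 2
    then have "ennpowr G (a / ?n) \<noteq> 0" using ex by (simp add: ennpowr_eq_0_iff)
    then show ?thesis using 2 ex C0 by (simp add: ennreal_mult_top)
  next
    case (3 \<gamma> m)
    define R where "R = (\<gamma> / m) powr (1 / ?n)"
    have R: "0 < R" using 3 by (simp add: R_def)
    have Rpow: "R powr b = (\<gamma> / m) powr (b / ?n)" for b by (simp add: R_def powr_powr)
    have near: "(\<integral>\<^sup>+x\<in>ball y R. ?K x * g x \<partial>lborel) \<le> ennreal (C * (\<gamma> powr (a / ?n) * m powr (1 - a / ?n)))"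
    proof -
      have "(\<integral>\<^sup>+x\<in>ball y R. ?K x * g x \<partial>lborel) = (\<integral>\<^sup>+x\<in>ball y R. ?K x \<partial>density lborel g)"
      proof -
        have "(\<lambda>x. ?K x * indicator (ball y R) x) \<in> borel_measurable lborel"
          by (intro borel_measurable_times_ennreal borel_measurable_indicator) auto
        then show ?thesis by (subst nn_integral_density) (auto simp: ac_simps)
      qed
      also have "\<dots> \<le> ennreal (2 powr (?n - a) / (1 - 2 powr - a) * R powr a) * ennreal (12 ^ CARD('n) * m)"
      proof (rule nn_integral_riesz_ball)
        fix \<rho> :: real assume \<rho>: "0 < \<rho>"
        have "emeasure (density lborel g) (ball y \<rho>) = (\<integral>\<^sup>+x\<in>ball y \<rho>. g x \<partial>lborel)"
          by (rule emeasure_density) auto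
        also have "\<dots> \<le> ennreal ((12 * \<rho>) ^ CARD('n)) * ennreal m"
          using ball_integral_le_grid_maximal[OF \<rho>, of g y] 3 by (simp add: \<mu>_def)
        also have "\<dots> = ennreal (12 ^ CARD('n) * m) * ennreal (\<rho> ^ CARD('n))"
          using \<rho> 3 by (simp add: power_mult_distrib ac_simps flip: ennreal_mult)
        finally show "emeasure (density lborel g) (ball y \<rho>) \<le> \<dots>" .
      qed (use a R in auto)
      also have "\<dots> = ennreal (C * (R powr a * m))"
        using r 3 by (simp add: C_def ac_simps flip: ennreal_mult)
      also have "R powr a * m = \<gamma> powr (a / ?n) * m powr (1 - a / ?n)"
        using 3 by (simp add: Rpow powr_divide powr_diff)
      finally show ?thesis .
    qed
    have far: "(\<integral>\<^sup>+x\<in>- ball y R. ?K x * g x \<partial>lborel) \<le> ennreal (\<gamma> powr (a / ?n) * m powr (1 - a / ?n))"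
    proof -
      have "(\<integral>\<^sup>+x\<in>- ball y R. ?K x * g x \<partial>lborel) \<le> (\<integral>\<^sup>+x. ennreal (R powr (a - ?n)) * g x \<partial>lborel)"
      proof (intro nn_integral_mono)
        fix x
        have "?K x \<le> ennreal (R powr (a - ?n))" if "x \<notin> ball y R"
          using that R a by (intro ennreal_leI powr_mono2') (auto simp: dist_norm norm_minus_commute)
        then show "?K x * g x * indicator (- ball y R) x \<le> ennreal (R powr (a - ?n)) * g x"
          by (auto simp: indicator_def mult_right_mono)
      qed
      also have "\<dots> = ennreal (R powr (a - ?n) * \<gamma>)"
        using 3 by (simp add: nn_integral_cmult ennreal_mult G_def)
      also have "R powr (a - ?n) * \<gamma> = \<gamma> powr (a / ?n) * m powr (1 - a / ?n)"
        using 3 by (simp add: Rpow powr_divide powr_diff diff_divide_distrib)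
      finally show ?thesis .
    qed
    have "(\<integral>\<^sup>+x. ?K x * g x \<partial>lborel)
      = (\<integral>\<^sup>+x. ?K x * g x * indicator (ball y R) x + ?K x * g x * indicator (- ball y R) x \<partial>lborel)"
      by (intro nn_integral_cong) (auto simp: indicator_def)
    also have "\<dots> = (\<integral>\<^sup>+x\<in>ball y R. ?K x * g x \<partial>lborel) + (\<integral>\<^sup>+x\<in>- ball y R. ?K x * g x \<partial>lborel)"
      by (intro nn_integral_add borel_measurable_times_ennreal borel_measurable_indicator) auto
    also have "\<dots> \<le> ennreal (C * (\<gamma> powr (a / ?n) * m powr (1 - a / ?n))) + ennreal (\<gamma> powr (a / ?n) * m powr (1 - a / ?n))"
      by (intro add_mono near far)
    also have "\<dots> = ennreal ((C + 1) * (\<gamma> powr (a / ?n) * m powr (1 - a / ?n)))"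
      using C0 by (simp add: algebra_simps flip: ennreal_plus)
    also have "\<dots> = ennreal (C + 1) * (ennpowr G (a / ?n) * ennpowr \<mu> (1 - a / ?n))"
      using 3 C0 by (simp add: ennpowr_ennreal ennreal_mult)
    finally show ?thesis .
  qed
  then show ?thesis by (simp add: G_def \<mu>_def C_def)
qed

section \<open>Buckley's estimate for restricted functions\<close>

lemma set_nn_integral_pos:
  assumes [measurable]: "h \<in> borel_measurable M" "Q \<in> sets M"
    and Q: "0 < emeasure M Q" and h: "\<And>x. x \<in> Q \<Longrightarrow> 0 < h x"
  shows "0 < (\<integral>\<^sup>+x\<in>Q. h x \<partial>M)"
proof -
  have "\<not> (AE x in M. h x * indicator Q x = 0)"
  proof
    assume "AE x in M. h x * indicator Q x = 0"
    then have "AE x in M. x \<notin> Q"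
    proof eventually_elim
      case (elim x)
      then show ?case using h[of x] by (auto simp: indicator_def split: if_splits)
    qed
    then have "emeasure M Q = 0"
      using sets.sets_into_space[of Q M] by (subst (asm) AE_iff_measurable[of Q]) auto
    with Q show False by simp
  qed
  then show ?thesis by (subst (asm) nn_integral_0_iff_AE[symmetric]) (auto simp: zero_less_iff_neq_zero)
qed

text \<open>
  Buckley's estimate on the function u 1_E, with Lerner's proof. Let M1 be the maximal function
  of 1_E with respect to u, and let G = M1^(s-1)/\<sigma>. For a cube Q containing x, the
  average of u 1_E over Q is u(Q)/|Q| times u(E \<inter> Q)/u(Q), and the second factor is at
  most M1 on all of Q. Its power s-1 is thus dominated by the Lebesgue average of M1^(s-1) = G
  \<sigma>, which is \<sigma>(Q)/|Q| times the \<sigma>-average of G. The quotients u(Q)/|Q| and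
  \<sigma>(Q)/|Q| combine to the Muckenhoupt expression, and the rest is the maximal function of
  G with respect to \<sigma>. Now apply the strong type bound twice: for \<sigma> with exponent
  s/(s-1), then for u with exponent s; in between, \<sigma>^(1 - s/(s-1)) = u.
\<close>
lemma maximal_fn_restricted_bound:
  fixes u \<sigma> :: "real ^ 'n \<Rightarrow> ennreal"
  assumes [measurable]: "u \<in> borel_measurable borel" "E \<in> sets borel"
    and u: "\<And>x. 0 < u x" "\<And>x. u x < top"
    and s: "1 < s"
    and \<sigma>: "\<And>x. \<sigma> x = ennpowr (u x) (1 - s)"
    and A: "A < top"
      "\<And>Q. Q \<in> cubes \<Longrightarrow> (\<integral>\<^sup>+x\<in>Q. u x \<partial>lborel) / emeasure lborel Q
          * ennpowr ((\<integral>\<^sup>+x\<in>Q. \<sigma> x \<partial>lborel) / emeasure lborel Q) (1 / (s - 1)) \<le> A"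
    and \<tau>: "\<tau> \<in> shifts"
  shows "(\<integral>\<^sup>+x. ennpowr (maximal_fn lborel (grid \<tau>) (\<lambda>x. u x * indicator E x) x) s * \<sigma> x \<partial>lborel)
     \<le> ennreal (s * 2 powr (s / (s - 1)) * (s / (s - 1) * 2 powr s)) * (ennpowr A s * (\<integral>\<^sup>+x\<in>E. u x \<partial>lborel))"
proof -
  define t where "t = s / (s - 1)"
  have t: "1 < t" using s by (simp add: t_def field_simps)
  have [measurable]: "\<sigma> \<in> borel_measurable borel" using \<sigma> by (subst measurable_cong[OF \<sigma>]) auto
  have \<sigma>fin: "0 < \<sigma> x" "\<sigma> x < top" for x
    using u[of x] unfolding \<sigma>
    by (cases "u x" rule: ennreal_pos_cases; simp add: ennpowr_ennreal)+
  define Nu where "Nu = density lborel u"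
  define N\<sigma> where "N\<sigma> = density lborel \<sigma>"
  have sf: "sigma_finite_measure Nu" "sigma_finite_measure N\<sigma>"
    unfolding Nu_def N\<sigma>_def using u(2) \<sigma>fin(2)
    by (subst sigma_finite_measure.sigma_finite_iff_density_finite[OF sigma_finite_lborel]; auto simp: less_top)+
  have sets [simp, measurable_cong]: "sets Nu = sets borel" "sets N\<sigma> = sets borel"
    by (simp_all add: Nu_def N\<sigma>_def)
  note grid = countable_grid[of \<tau>] laminar_grid[OF \<tau>] grid_sets[of \<tau>]
  let ?g = "\<lambda>x. u x * indicator E x"
  define M1 where "M1 = maximal_fn Nu (grid \<tau>) (indicator E)"
  define G where "G = (\<lambda>x. ennpowr (M1 x) (s - 1) / \<sigma> x)"
  define M2 where "M2 = maximal_fn N\<sigma> (grid \<tau>) G"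
  have "M1 \<in> borel_measurable Nu" "M2 \<in> borel_measurable N\<sigma>"
    unfolding M1_def M2_def by (intro maximal_fn_measurable; use grid in simp)+
  then have [measurable]: "M1 \<in> borel_measurable borel" "M2 \<in> borel_measurable borel"
    by (simp_all cong: measurable_cong_sets)
  have [measurable]: "G \<in> borel_measurable borel" unfolding G_def by measurable
  have G\<sigma>: "G x * \<sigma> x = ennpowr (M1 x) (s - 1)" for x
    using \<sigma>fin[of x] by (simp add: G_def ennreal_divide_times ennreal_divide_self less_top)
  \<comment> \<open>In the notation of the proof: U, S, V are the masses of Q for u, \<sigma> and Lebesgue measure, v that of E within Q.\<close>
  have pt: "maximal_fn lborel (grid \<tau>) ?g x \<le> A * ennpowr (M2 x) (1 / (s - 1))" for x
    unfolding maximal_fn_def[of lborel]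
  proof (intro SUP_least)
    fix Q assume "Q \<in> {Q \<in> grid \<tau>. x \<in> Q}"
    then have Q: "Q \<in> grid \<tau>" "x \<in> Q" by auto
    then have [measurable]: "Q \<in> sets borel" using grid_sets by auto
    define U S where "U = (\<integral>\<^sup>+x\<in>Q. u x \<partial>lborel)" and "S = (\<integral>\<^sup>+x\<in>Q. \<sigma> x \<partial>lborel)"
    define V where "V = emeasure lborel Q"
    define v where "v = (\<integral>\<^sup>+x\<in>Q. ?g x \<partial>lborel)"
    have V: "0 < V" "V < top" using grid_emeasure[OF Q(1)] by (auto simp: V_def)
    have U0: "0 < U" and S0: "0 < S" unfolding U_def S_def using u \<sigma>fin V
      by (auto intro!: set_nn_integral_pos simp: V_def)
    \<comment> \<open>Cells are half open, the cubes of the hypothesis closed; the closed cube is larger and has the same volume.\<close>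
    have AQ: "U / V * ennpowr (S / V) (1 / (s - 1)) \<le> A"
    proof -
      obtain R where R: "R \<in> cubes" "Q \<subseteq> R" "emeasure lborel R = emeasure lborel Q" by (rule grid_cube[OF Q(1)])
      have "U / V * ennpowr (S / V) (1 / (s - 1)) \<le> (\<integral>\<^sup>+x\<in>R. u x \<partial>lborel) / emeasure lborel R
          * ennpowr ((\<integral>\<^sup>+x\<in>R. \<sigma> x \<partial>lborel) / emeasure lborel R) (1 / (s - 1))"
        unfolding U_def S_def V_def R(3)
        using R(2) s by (intro mult_mono ennpowr_mono divide_right_mono_ennreal nn_integral_mono mult_left_mono)
           (auto simp: indicator_def)
      also have "\<dots> \<le> A" by (rule A(2)[OF R(1)])
      finally show ?thesis .
    qed
    obtain V' where V': "V = ennreal V'" "0 < V'" using V by (cases V rule: ennreal_pos_cases) auto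
    have UV: "0 < U / V" and SV: "0 < S / V" using U0 S0 V by (auto simp: zero_less_iff_neq_zero ennreal_divide_eq_0_iff less_top)
    \<comment> \<open>Finiteness of A excludes infinite mass, since the other average is positive.\<close>
    have "U \<noteq> top"
    proof
      assume "U = top"
      then have "U / V = top" using V by (simp add: ennreal_top_divide less_top)
      moreover have "ennpowr (S / V) (1 / (s - 1)) \<noteq> 0" using SV s by (simp add: ennpowr_eq_0_iff zero_less_iff_neq_zero)
      ultimately show False using AQ A(1) by (simp add: ennreal_top_mult top_unique)
    qed
    moreover have "S \<noteq> top"
    proof
      assume "S = top"
      then have "S / V = top" using V by (simp add: ennreal_top_divide less_top)
      then show False using AQ A(1) U0 V s
        by (simp add: ennreal_mult_top ennreal_top_mult top_unique zero_less_iff_neq_zero less_top split: if_splits)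
    qed
    ultimately obtain U' S' where US: "U = ennreal U'" "0 < U'" "S = ennreal S'" "0 < S'"
      using U0 S0 by (cases U rule: ennreal_pos_cases; cases S rule: ennreal_pos_cases) auto
    have "v \<le> U" unfolding v_def U_def by (intro nn_integral_mono) (auto simp: indicator_def)
    then obtain v' where v: "v = ennreal v'" "0 \<le> v'" using US by (cases v) (auto simp: top_unique)
    have "v / U \<le> M1 z" if "z \<in> Q" for z
    proof -
      have "(\<integral>\<^sup>+y\<in>Q. indicator E y \<partial>Nu) / emeasure Nu Q \<le> M1 z"
        unfolding M1_def using Q(1) that by (rule maximal_fn_upper)
      moreover have "(\<integral>\<^sup>+y\<in>Q. indicator E y \<partial>Nu) = v"
        unfolding Nu_def v_def by (subst nn_integral_density) (auto simp: ac_simps)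
      moreover have "emeasure Nu Q = U" unfolding Nu_def U_def by (rule emeasure_density) auto
      ultimately show ?thesis by simp
    qed
    then have "(\<integral>\<^sup>+z\<in>Q. ennpowr (v / U) (s - 1) \<partial>lborel) \<le> (\<integral>\<^sup>+z\<in>Q. ennpowr (M1 z) (s - 1) \<partial>lborel)"
      using s by (intro nn_integral_mono) (auto simp: indicator_def intro!: ennpowr_mono)
    also have "\<dots> = (\<integral>\<^sup>+z\<in>Q. G z \<partial>N\<sigma>)"
      unfolding N\<sigma>_def by (subst nn_integral_density) (auto simp: G\<sigma>[symmetric] ac_simps)
    finally have *: "ennpowr (v / U) (s - 1) * V \<le> (\<integral>\<^sup>+z\<in>Q. G z \<partial>N\<sigma>)"
      by (simp add: nn_integral_cmult_indicator V_def)
    have "ennpowr (v / U) (s - 1) * V / S \<le> (\<integral>\<^sup>+z\<in>Q. G z \<partial>N\<sigma>) / S"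
      by (rule divide_right_mono_ennreal) fact
    also have "\<dots> = (\<integral>\<^sup>+z\<in>Q. G z \<partial>N\<sigma>) / emeasure N\<sigma> Q"
      unfolding N\<sigma>_def S_def by (subst emeasure_density) auto
    also have "\<dots> \<le> M2 x" unfolding M2_def using Q by (rule maximal_fn_upper)
    finally have M2: "ennpowr (v / U) (s - 1) * V / S \<le> M2 x" .
    have "v / V = (U / V * ennpowr (S / V) (1 / (s - 1))) * ennpowr (ennpowr (v / U) (s - 1) * V / S) (1 / (s - 1))"
    proof -
      let ?r = "1 / (s - 1)"
      have "ennpowr (v / U) (s - 1) * V / S = ennreal ((v' / U') powr (s - 1) * V' / S')"
        using US V' v s by (simp add: divide_ennreal ennpowr_ennreal_nonneg flip: ennreal_mult)
      then have "ennpowr (ennpowr (v / U) (s - 1) * V / S) ?r = ennreal (((v' / U') powr (s - 1) * V' / S') powr ?r)"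
        using US V' v s by (simp add: ennpowr_ennreal_nonneg)
      also have "((v' / U') powr (s - 1) * V' / S') powr ?r = (v' / U') * (V' / S') powr ?r"
        using US V' v s by (simp add: powr_mult powr_divide powr_powr)
      finally have 1: "ennpowr (ennpowr (v / U) (s - 1) * V / S) ?r = ennreal ((v' / U') * (V' / S') powr ?r)" .
      have 2: "U / V * ennpowr (S / V) ?r = ennreal ((U' / V') * (S' / V') powr ?r)"
        using US V' s by (simp add: divide_ennreal ennpowr_ennreal flip: ennreal_mult)
      have "(U' / V') * (S' / V') powr ?r * ((v' / U') * (V' / S') powr ?r) = v' / V'"
        using US V' by (simp add: powr_divide)
      then show ?thesis unfolding 1 2 using US V' v by (simp add: divide_ennreal flip: ennreal_mult)
    qed
    also have "\<dots> \<le> A * ennpowr (M2 x) (1 / (s - 1))"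
      using AQ M2 s by (intro mult_mono ennpowr_mono) auto
    finally show "(\<integral>\<^sup>+y\<in>Q. ?g y \<partial>lborel) / emeasure lborel Q \<le> A * ennpowr (M2 x) (1 / (s - 1))"
      by (simp add: v_def V_def)
  qed
  have "(\<integral>\<^sup>+x. ennpowr (maximal_fn lborel (grid \<tau>) ?g x) s * \<sigma> x \<partial>lborel)
    \<le> (\<integral>\<^sup>+x. \<sigma> x * (ennpowr A s * ennpowr (M2 x) t) \<partial>lborel)"
  proof (intro nn_integral_mono)
    fix x
    have "ennpowr (maximal_fn lborel (grid \<tau>) ?g x) s \<le> ennpowr (A * ennpowr (M2 x) (1 / (s - 1))) s"
      using pt s by (intro ennpowr_mono) auto
    also have "\<dots> = ennpowr A s * ennpowr (M2 x) t"
      using s by (simp add: ennpowr_mult ennpowr_ennpowr t_def)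
    finally show "ennpowr (maximal_fn lborel (grid \<tau>) ?g x) s * \<sigma> x \<le> \<sigma> x * (ennpowr A s * ennpowr (M2 x) t)"
      by (simp add: mult.commute mult_left_mono)
  qed
  also have "\<dots> = (\<integral>\<^sup>+x. ennpowr A s * ennpowr (M2 x) t \<partial>N\<sigma>)"
    unfolding N\<sigma>_def by (subst nn_integral_density) auto
  also have "\<dots> = ennpowr A s * (\<integral>\<^sup>+x. ennpowr (M2 x) t \<partial>N\<sigma>)" by (rule nn_integral_cmult) simp
  also have "(\<integral>\<^sup>+x. ennpowr (M2 x) t \<partial>N\<sigma>) \<le> ennreal (t / (t - 1) * 2 powr t) * (\<integral>\<^sup>+x. ennpowr (G x) t \<partial>N\<sigma>)"
    unfolding M2_def using sf grid t by (intro maximal_fn_strong_type) auto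
  also have "(\<integral>\<^sup>+x. ennpowr (G x) t \<partial>N\<sigma>) = (\<integral>\<^sup>+x. ennpowr (M1 x) s \<partial>Nu)"
  proof -
    have "\<sigma> x * ennpowr (G x) t = u x * ennpowr (M1 x) s" for x
    proof -
      obtain w where w: "u x = ennreal w" "0 < w" using u[of x] by (cases "u x" rule: ennreal_pos_cases) auto
      have "G x = ennpowr (M1 x) (s - 1) * ennreal (w powr (s - 1))"
        using w unfolding G_def \<sigma> by (simp add: ennpowr_ennreal divide_ennreal_def inverse_ennreal powr_minus[symmetric])
      then have "ennpowr (G x) t = ennpowr (M1 x) s * ennreal (w powr s)"
        using s w t by (simp add: ennpowr_mult ennpowr_ennpowr ennpowr_ennreal powr_powr t_def)
      moreover have "\<sigma> x = ennreal (w powr (1 - s))" using w by (simp add: \<sigma> ennpowr_ennreal)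
      moreover have "w powr (1 - s) * w powr s = w" using w by (simp add: powr_add[symmetric])
      then have "ennreal (w powr (1 - s)) * ennreal (w powr s) = ennreal w" by (simp flip: ennreal_mult)
      ultimately show ?thesis using w by (metis mult.commute mult.assoc)
    qed
    then show ?thesis unfolding N\<sigma>_def Nu_def by (subst (1 2) nn_integral_density) auto
  qed
  also have "(\<integral>\<^sup>+x. ennpowr (M1 x) s \<partial>Nu) \<le> ennreal (s / (s - 1) * 2 powr s) * (\<integral>\<^sup>+x. ennpowr (indicator E x) s \<partial>Nu)"
    unfolding M1_def using sf grid s by (intro maximal_fn_strong_type) auto
  also have "(\<integral>\<^sup>+x. ennpowr (indicator E x) s \<partial>Nu) = (\<integral>\<^sup>+x\<in>E. u x \<partial>lborel)"
    unfolding Nu_def using s by (subst nn_integral_density) (auto intro!: nn_integral_cong simp: indicator_def)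
  finally have "(\<integral>\<^sup>+x. ennpowr (maximal_fn lborel (grid \<tau>) ?g x) s * \<sigma> x \<partial>lborel)
     \<le> ennpowr A s * (ennreal (t / (t - 1) * 2 powr t) * (ennreal (s / (s - 1) * 2 powr s) * (\<integral>\<^sup>+x\<in>E. u x \<partial>lborel)))"
    by (simp add: mult_left_mono)
  also have "t / (t - 1) = s" using s by (simp add: t_def field_simps)
  also have "ennpowr A s * (ennreal (s * 2 powr t) * (ennreal (s / (s - 1) * 2 powr s) * (\<integral>\<^sup>+x\<in>E. u x \<partial>lborel)))
    = ennreal ((s * 2 powr t) * (s / (s - 1) * 2 powr s)) * (ennpowr A s * (\<integral>\<^sup>+x\<in>E. u x \<partial>lborel))"
  proof -
    have "ennreal ((s * 2 powr t) * (s / (s - 1) * 2 powr s)) = ennreal (s * 2 powr t) * ennreal (s / (s - 1) * 2 powr s)"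
      using s by (intro ennreal_mult) auto
    then show ?thesis by (simp only: ac_simps)
  qed
  finally show ?thesis unfolding t_def .
qed

text \<open>
  A supremum over the finitely many shifts is at most the sum over them.
\<close>
lemma grid_maximal_restricted_bound:
  fixes u \<sigma> :: "real ^ 'n \<Rightarrow> ennreal"
  assumes [measurable]: "u \<in> borel_measurable borel" "E \<in> sets borel"
    and u: "\<And>x. 0 < u x" "\<And>x. u x < top"
    and s: "1 < s"
    and \<sigma>: "\<And>x. \<sigma> x = ennpowr (u x) (1 - s)"
    and A: "A < top"
      "\<And>Q. Q \<in> cubes \<Longrightarrow> (\<integral>\<^sup>+x\<in>Q. u x \<partial>lborel) / emeasure lborel Q
          * ennpowr ((\<integral>\<^sup>+x\<in>Q. \<sigma> x \<partial>lborel) / emeasure lborel Q) (1 / (s - 1)) \<le> A"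
  shows "(\<integral>\<^sup>+x. ennpowr (grid_maximal (\<lambda>x. u x * indicator E x) x) s * \<sigma> x \<partial>lborel)
     \<le> ennreal (real (card (shifts :: ('n \<Rightarrow> real) set)) * (s * 2 powr (s / (s - 1)) * (s / (s - 1) * 2 powr s)))
        * (ennpowr A s * (\<integral>\<^sup>+x\<in>E. u x \<partial>lborel))"
proof -
  let ?S = "shifts :: ('n \<Rightarrow> real) set"
  let ?M = "\<lambda>\<tau>. maximal_fn lborel (grid \<tau>) (\<lambda>x. u x * indicator E x)"
  let ?K = "s * 2 powr (s / (s - 1)) * (s / (s - 1) * 2 powr s)"
  have fin: "finite ?S" by (rule finite_shifts)
  have ne: "?S \<noteq> {}" by (auto simp: shifts_def intro!: exI[of _ "\<lambda>_. 0"])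
  have [measurable]: "\<sigma> \<in> borel_measurable borel" using \<sigma> by (subst measurable_cong[OF \<sigma>]) auto
  have M [measurable]: "?M \<tau> \<in> borel_measurable borel" for \<tau> :: "'n \<Rightarrow> real"
  proof -
    have "?M \<tau> \<in> borel_measurable lborel"
      by (rule maximal_fn_measurable) (simp_all add: countable_grid grid_sets)
    then show ?thesis by simp
  qed
  have "ennpowr (grid_maximal (\<lambda>x. u x * indicator E x) x) s \<le> (\<Sum>\<tau>\<in>?S. ennpowr (?M \<tau> x) s)" for x
  proof -
    have "grid_maximal (\<lambda>x. u x * indicator E x) x \<in> (\<lambda>\<tau>. ?M \<tau> x) ` ?S"
      unfolding grid_maximal_def using fin ne by (subst Max_Sup[symmetric]) (auto intro!: Max_in)
    then obtain \<tau> where "\<tau> \<in> ?S" "grid_maximal (\<lambda>x. u x * indicator E x) x = ?M \<tau> x" by auto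
    then show ?thesis
      using member_le_sum[of \<tau> ?S "\<lambda>\<tau>. ennpowr (?M \<tau> x) s"] fin by simp
  qed
  then have "(\<integral>\<^sup>+x. ennpowr (grid_maximal (\<lambda>x. u x * indicator E x) x) s * \<sigma> x \<partial>lborel)
    \<le> (\<integral>\<^sup>+x. (\<Sum>\<tau>\<in>?S. ennpowr (?M \<tau> x) s * \<sigma> x) \<partial>lborel)"
    by (intro nn_integral_mono) (simp add: sum_distrib_right[symmetric] mult_right_mono)
  also have "\<dots> = (\<Sum>\<tau>\<in>?S. \<integral>\<^sup>+x. ennpowr (?M \<tau> x) s * \<sigma> x \<partial>lborel)"
    by (rule nn_integral_sum) simp
  also have "\<dots> \<le> (\<Sum>\<tau>\<in>?S. ennreal ?K * (ennpowr A s * (\<integral>\<^sup>+x\<in>E. u x \<partial>lborel)))"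
    using assms by (intro sum_mono maximal_fn_restricted_bound) auto
  also have "\<dots> = ennreal (real (card ?S) * ?K) * (ennpowr A s * (\<integral>\<^sup>+x\<in>E. u x \<partial>lborel))"
  proof -
    have "0 \<le> ?K" using s by simp
    then have "ennreal (real (card ?S) * ?K) = of_nat (card ?S) * ennreal ?K"
      by (subst ennreal_mult) (simp_all add: ennreal_of_nat_eq_real_of_nat)
    then show ?thesis by (simp only: sum_constant mult.assoc)
  qed
  finally show ?thesis .
qed

section \<open>The weak type bound for Borel functions\<close>

text \<open>
  The fractional integral of a nonnegative function, with values in [0, \<infinity>].
\<close>
definition riesz_pot :: "real \<Rightarrow> (real ^ 'n \<Rightarrow> ennreal) \<Rightarrow> real ^ 'n \<Rightarrow> ennreal" where
  "riesz_pot \<alpha> f x = (\<integral>\<^sup>+y. ennreal (norm (x - y) powr (\<alpha> - real CARD('n))) * f y \<partial>lborel)"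

lemma riesz_pot_measurable [measurable]:
  fixes f :: "real ^ 'n \<Rightarrow> ennreal"
  assumes [measurable]: "f \<in> borel_measurable borel"
  shows "riesz_pot \<alpha> f \<in> borel_measurable borel"
  unfolding riesz_pot_def by measurable

lemma riesz_pot_symmetric:
  fixes f g :: "real ^ 'n \<Rightarrow> ennreal"
  assumes [measurable]: "f \<in> borel_measurable borel" "g \<in> borel_measurable borel"
  shows "(\<integral>\<^sup>+x. riesz_pot \<alpha> f x * g x \<partial>lborel) = (\<integral>\<^sup>+y. f y * riesz_pot \<alpha> g y \<partial>lborel)"
proof -
  let ?K = "\<lambda>x y. ennreal (norm (x - y) powr (\<alpha> - real CARD('n)))"
  have "(\<integral>\<^sup>+x. riesz_pot \<alpha> f x * g x \<partial>lborel) = (\<integral>\<^sup>+x. \<integral>\<^sup>+y. ?K x y * f y * g x \<partial>lborel \<partial>lborel)"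
    unfolding riesz_pot_def by (intro nn_integral_cong nn_integral_multc[symmetric]) measurable
  also have "\<dots> = (\<integral>\<^sup>+y. \<integral>\<^sup>+x. ?K x y * f y * g x \<partial>lborel \<partial>lborel)"
    by (rule lborel_pair.Fubini') measurable
  also have "\<dots> = (\<integral>\<^sup>+y. \<integral>\<^sup>+x. f y * (?K y x * g x) \<partial>lborel \<partial>lborel)"
    by (simp add: norm_minus_commute ac_simps)
  also have "\<dots> = (\<integral>\<^sup>+y. f y * riesz_pot \<alpha> g y \<partial>lborel)"
    unfolding riesz_pot_def by (intro nn_integral_cong nn_integral_cmult) measurable
  finally show ?thesis .
qed

text \<open>
  The argument of type \<^typ>\<open>'n itself\<close> carries the dimension.
\<close>
definition hedberg_const :: "'n::finite itself \<Rightarrow> real \<Rightarrow> real" where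
  "hedberg_const _ \<alpha> = 12 ^ CARD('n) * 2 powr (real CARD('n) - \<alpha>) / (1 - 2 powr - \<alpha>) + 1"

lemma riesz_pot_pairing_le:
  fixes f u :: "real ^ 'n \<Rightarrow> ennreal"
  assumes [measurable]: "f \<in> borel_measurable borel" "u \<in> borel_measurable borel" "E \<in> sets borel"
    and \<alpha>: "0 < \<alpha>" "\<alpha> < real CARD('n)"
    and fin: "(\<integral>\<^sup>+x\<in>E. u x \<partial>lborel) < top"
  shows "(\<integral>\<^sup>+x\<in>E. riesz_pot \<alpha> f x * u x \<partial>lborel)
    \<le> ennreal (hedberg_const TYPE('n) \<alpha>) * ennpowr (\<integral>\<^sup>+x\<in>E. u x \<partial>lborel) (\<alpha> / real CARD('n))
       * (\<integral>\<^sup>+y. f y * ennpowr (grid_maximal (\<lambda>x. u x * indicator E x) y) (1 - \<alpha> / real CARD('n)) \<partial>lborel)"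
proof -
  let ?g = "\<lambda>x. u x * indicator E x"
  let ?c = "ennreal (hedberg_const TYPE('n) \<alpha>) * ennpowr (\<integral>\<^sup>+x\<in>E. u x \<partial>lborel) (\<alpha> / real CARD('n))"
  have "(\<integral>\<^sup>+x\<in>E. riesz_pot \<alpha> f x * u x \<partial>lborel) = (\<integral>\<^sup>+x. riesz_pot \<alpha> f x * ?g x \<partial>lborel)"
    by (simp add: mult.assoc)
  also have "\<dots> = (\<integral>\<^sup>+y. f y * riesz_pot \<alpha> ?g y \<partial>lborel)"
    by (rule riesz_pot_symmetric) measurable
  also have "\<dots> \<le> (\<integral>\<^sup>+y. ?c * (f y * ennpowr (grid_maximal ?g y) (1 - \<alpha> / real CARD('n))) \<partial>lborel)"
  proof (intro nn_integral_mono)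
    fix y
    have "riesz_pot \<alpha> ?g y \<le> ?c * ennpowr (grid_maximal ?g y) (1 - \<alpha> / real CARD('n))"
      using riesz_le_grid_maximal[of ?g \<alpha> y] \<alpha> fin
      unfolding riesz_pot_def hedberg_const_def by (simp add: norm_minus_commute mult.assoc)
    then have "f y * riesz_pot \<alpha> ?g y \<le> f y * (?c * ennpowr (grid_maximal ?g y) (1 - \<alpha> / real CARD('n)))"
      by (rule mult_left_mono) simp
    then show "f y * riesz_pot \<alpha> ?g y \<le> ?c * (f y * ennpowr (grid_maximal ?g y) (1 - \<alpha> / real CARD('n)))"
      by (simp only: ac_simps)
  qed
  also have "\<dots> = ?c * (\<integral>\<^sup>+y. f y * ennpowr (grid_maximal ?g y) (1 - \<alpha> / real CARD('n)) \<partial>lborel)"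
    by (rule nn_integral_cmult) measurable
  finally show ?thesis .
qed

text \<open>
  Test the hypothesis on the parts of {h > t} in balls, where the measure is finite and may be
  cancelled; then exhaust.
\<close>
lemma weak_type_of_pairing:
  fixes h u :: "real ^ 'n \<Rightarrow> ennreal"
  assumes [measurable]: "h \<in> borel_measurable borel" "u \<in> borel_measurable borel"
    and loc: "\<And>N::nat. (\<integral>\<^sup>+x\<in>ball 0 (real N). u x \<partial>lborel) < top"
    and q: "0 < q"
    and pair: "\<And>E. E \<in> sets borel \<Longrightarrow> (\<integral>\<^sup>+x\<in>E. u x \<partial>lborel) < top \<Longrightarrow>
      (\<integral>\<^sup>+x\<in>E. h x * u x \<partial>lborel) \<le> B * ennpowr (\<integral>\<^sup>+x\<in>E. u x \<partial>lborel) (1 - 1 / q)"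
    and t: "0 < t"
  shows "ennreal t * ennpowr (\<integral>\<^sup>+x\<in>{x. ennreal t < h x}. u x \<partial>lborel) (1 / q) \<le> B"
proof -
  define E where "E = (\<lambda>N::nat. {x. ennreal t < h x} \<inter> ball 0 (real N))"
  have [measurable]: "E N \<in> sets borel" for N unfolding E_def by measurable
  define m where "m = (\<lambda>N. \<integral>\<^sup>+x\<in>E N. u x \<partial>lborel)"
  have div: "ennreal t * x \<le> B \<longleftrightarrow> x \<le> B / ennreal t" for x
  proof
    assume "ennreal t * x \<le> B"
    then have "ennreal t * x / ennreal t \<le> B / ennreal t" by (rule divide_right_mono_ennreal)
    then show "x \<le> B / ennreal t" using t by (simp add: mult.commute[of "ennreal t"] ennreal_mult_divide_eq)
  next
    assume "x \<le> B / ennreal t"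
    then have "ennreal t * x \<le> ennreal t * (B / ennreal t)" by (rule mult_left_mono) simp
    then show "ennreal t * x \<le> B" using t by (simp add: ennreal_times_divide mult.commute[of "ennreal t"] ennreal_mult_divide_eq)
  qed
  have mN: "m N \<le> ennpowr (B / ennreal t) q" for N
  proof -
    have "m N \<le> (\<integral>\<^sup>+x\<in>ball 0 (real N). u x \<partial>lborel)"
      unfolding m_def E_def by (intro nn_integral_mono) (auto simp: indicator_def)
    then have fin: "m N < top" using loc[of N] by (rule order.strict_trans1)
    have "ennreal t * m N = (\<integral>\<^sup>+x. ennreal t * (u x * indicator (E N) x) \<partial>lborel)"
      unfolding m_def by (subst nn_integral_cmult) auto
    also have "\<dots> \<le> (\<integral>\<^sup>+x\<in>E N. h x * u x \<partial>lborel)"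
      by (intro nn_integral_mono) (auto simp: E_def indicator_def intro!: mult_right_mono)
    also have "\<dots> \<le> B * ennpowr (m N) (1 - 1 / q)"
      using pair[of "E N"] fin by (simp add: m_def)
    finally have le: "ennreal t * m N \<le> B * ennpowr (m N) (1 - 1 / q)" .
    show ?thesis
    proof (cases "m N = 0")
      case False
      \<comment> \<open>The finite positive mass is cancelled by multiplying with its power 1/q - 1.\<close>
      let ?y = "ennpowr (m N) (1 / q - 1)"
      have "ennreal t * (m N * ?y) \<le> B * (ennpowr (m N) (1 - 1 / q) * ?y)"
        using mult_right_mono[OF le, of ?y] by (simp only: mult.assoc) simp
      moreover have "m N * ?y = ennpowr (m N) (1 / q)"
        using ennpowr_add_fin[of "m N" 1 "1 / q - 1"] False fin by simp
      moreover have "ennpowr (m N) (1 - 1 / q) * ?y = 1"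
        using ennpowr_add_fin[of "m N" "1 - 1 / q" "1 / q - 1"] False fin by simp
      ultimately have "ennreal t * ennpowr (m N) (1 / q) \<le> B" by simp
      then have "ennpowr (m N) (1 / q) \<le> B / ennreal t" by (simp add: div)
      then have "ennpowr (ennpowr (m N) (1 / q)) q \<le> ennpowr (B / ennreal t) q"
        using q by (intro ennpowr_mono) auto
      then show ?thesis using q by (simp add: ennpowr_ennpowr)
    qed simp
  qed
  have "(\<integral>\<^sup>+x\<in>{x. ennreal t < h x}. u x \<partial>lborel) = (SUP N. m N)"
  proof -
    have "{x. ennreal t < h x} = (\<Union>N. E N)"
    proof -
      have "\<exists>N. x \<in> ball 0 (real N)" for x :: "real ^ 'n"
        using reals_Archimedean2[of "norm x"] by (auto simp: dist_norm)
      then show ?thesis unfolding E_def by blast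
    qed
    moreover have "incseq E" unfolding E_def incseq_def by auto
    ultimately have "emeasure (density lborel u) {x. ennreal t < h x} = (SUP N. emeasure (density lborel u) (E N))"
      by (subst SUP_emeasure_incseq) auto
    then show ?thesis by (simp add: emeasure_density m_def)
  qed
  also have "\<dots> \<le> ennpowr (B / ennreal t) q" by (intro SUP_least mN)
  finally have "ennpowr (\<integral>\<^sup>+x\<in>{x. ennreal t < h x}. u x \<partial>lborel) (1 / q) \<le> ennpowr (ennpowr (B / ennreal t) q) (1 / q)"
    using q by (intro ennpowr_mono) auto
  then show ?thesis using q by (simp add: div ennpowr_ennpowr)
qed

lemma grid_maximal_le_of_A1:
  fixes u :: "real ^ 'n \<Rightarrow> ennreal"
  assumes [measurable]: "u \<in> borel_measurable borel" "E \<in> sets borel"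
    and A: "\<And>Q. Q \<in> cubes \<Longrightarrow> AE x in lborel. x \<in> Q \<longrightarrow> (\<integral>\<^sup>+x\<in>Q. u x \<partial>lborel) / emeasure lborel Q \<le> A * u x"
  shows "AE x in lborel. grid_maximal (\<lambda>x. u x * indicator E x) x \<le> A * u x"
proof -
  have "AE x in lborel. x \<in> Q \<longrightarrow> (\<integral>\<^sup>+x\<in>Q. u x * indicator E x \<partial>lborel) / emeasure lborel Q \<le> A * u x"
    if Q: "Q \<in> grid \<tau>" for \<tau> Q
  proof -
    obtain R where R: "R \<in> cubes" "Q \<subseteq> R" "emeasure lborel R = emeasure lborel Q" by (rule grid_cube[OF Q])
    have "(\<integral>\<^sup>+x\<in>Q. u x * indicator E x \<partial>lborel) / emeasure lborel Q \<le> (\<integral>\<^sup>+x\<in>R. u x \<partial>lborel) / emeasure lborel R"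
      unfolding R(3) using R(2)
      by (intro divide_right_mono_ennreal nn_integral_mono) (auto simp: indicator_def)
    then show ?thesis using A[OF R(1)] R(2) by (auto elim!: eventually_mono intro: order_trans)
  qed
  then have "AE x in lborel. \<forall>\<tau>\<in>shifts. \<forall>Q\<in>grid \<tau>. x \<in> Q \<longrightarrow>
      (\<integral>\<^sup>+x\<in>Q. u x * indicator E x \<partial>lborel) / emeasure lborel Q \<le> A * u x"
    by (intro AE_ball_countable[THEN iffD2] ballI countable_grid countable_finite[OF finite_shifts])
  then show ?thesis
    unfolding grid_maximal_def maximal_fn_def by eventually_elim (auto intro!: SUP_least)
qed

text \<open>
  For p = 1 the exponent satisfies q \<theta> = 1, so that (A u)^\<theta> = A^\<theta> w.
\<close>
lemma riesz_pairing_A1q: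
  fixes f :: "real ^ 'n \<Rightarrow> ennreal" and W :: "real ^ 'n \<Rightarrow> real"
  assumes [measurable]: "f \<in> borel_measurable borel" "W \<in> borel_measurable borel" "E \<in> sets borel"
    and W: "\<And>x. 0 < W x"
    and \<alpha>: "0 < \<alpha>" "\<alpha> < real CARD('n)"
    and q: "1 / q = 1 - \<alpha> / real CARD('n)"
    and A: "\<And>Q. Q \<in> cubes \<Longrightarrow> AE x in lborel. x \<in> Q \<longrightarrow>
        (\<integral>\<^sup>+x\<in>Q. ennreal (W x powr q) \<partial>lborel) / emeasure lborel Q \<le> A * ennreal (W x powr q)"
    and fin: "(\<integral>\<^sup>+x\<in>E. ennreal (W x powr q) \<partial>lborel) < top"
  shows "(\<integral>\<^sup>+x\<in>E. riesz_pot \<alpha> f x * ennreal (W x powr q) \<partial>lborel)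
    \<le> ennreal (hedberg_const TYPE('n) \<alpha>) * ennpowr A (1 - \<alpha> / real CARD('n))
       * (\<integral>\<^sup>+x. f x * ennreal (W x) \<partial>lborel)
       * ennpowr (\<integral>\<^sup>+x\<in>E. ennreal (W x powr q) \<partial>lborel) (1 - 1 / q)"
proof -
  let ?u = "\<lambda>x. ennreal (W x powr q)"
  let ?G = "\<integral>\<^sup>+x\<in>E. ?u x \<partial>lborel"
  define \<theta> where "\<theta> = 1 - \<alpha> / real CARD('n)"
  have \<theta>: "0 < \<theta>" using \<alpha> by (simp add: \<theta>_def)
  have q\<theta>: "q * \<theta> = 1" using q \<theta> unfolding \<theta>_def[symmetric] by (metis divide_eq_0_iff less_irrefl nonzero_eq_divide_eq zero_neq_one mult.commute)
  have "(\<integral>\<^sup>+y. f y * ennpowr (grid_maximal (\<lambda>x. ?u x * indicator E x) y) \<theta> \<partial>lborel)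
    \<le> (\<integral>\<^sup>+y. ennpowr A \<theta> * (f y * ennreal (W y)) \<partial>lborel)"
  proof (intro nn_integral_mono_AE)
    have "AE x in lborel. grid_maximal (\<lambda>x. ?u x * indicator E x) x \<le> A * ?u x"
      by (intro grid_maximal_le_of_A1 A) auto
    then show "AE y in lborel. f y * ennpowr (grid_maximal (\<lambda>x. ?u x * indicator E x) y) \<theta>
      \<le> ennpowr A \<theta> * (f y * ennreal (W y))"
    proof eventually_elim
      case (elim y)
      then have "ennpowr (grid_maximal (\<lambda>x. ?u x * indicator E x) y) \<theta> \<le> ennpowr (A * ?u y) \<theta>"
        using \<theta> by (intro ennpowr_mono) auto
      also have "\<dots> = ennpowr A \<theta> * ennreal (W y)"
        using \<theta> W[of y] q\<theta> by (simp add: ennpowr_mult ennpowr_ennreal powr_powr)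
      finally have "f y * ennpowr (grid_maximal (\<lambda>x. ?u x * indicator E x) y) \<theta>
        \<le> f y * (ennpowr A \<theta> * ennreal (W y))" by (rule mult_left_mono) simp
      then show ?case by (simp only: ac_simps)
    qed
  qed
  also have "\<dots> = ennpowr A \<theta> * (\<integral>\<^sup>+x. f x * ennreal (W x) \<partial>lborel)"
    by (rule nn_integral_cmult) measurable
  finally have *: "(\<integral>\<^sup>+y. f y * ennpowr (grid_maximal (\<lambda>x. ?u x * indicator E x) y) \<theta> \<partial>lborel)
    \<le> ennpowr A \<theta> * (\<integral>\<^sup>+x. f x * ennreal (W x) \<partial>lborel)" .
  have "(\<integral>\<^sup>+x\<in>E. riesz_pot \<alpha> f x * ?u x \<partial>lborel) \<le> ennreal (hedberg_const TYPE('n) \<alpha>)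
      * ennpowr ?G (\<alpha> / real CARD('n)) * (\<integral>\<^sup>+y. f y * ennpowr (grid_maximal (\<lambda>x. ?u x * indicator E x) y) \<theta> \<partial>lborel)"
    unfolding \<theta>_def using \<alpha> fin by (intro riesz_pot_pairing_le) auto
  also have "\<dots> \<le> ennreal (hedberg_const TYPE('n) \<alpha>)
      * ennpowr ?G (\<alpha> / real CARD('n)) * (ennpowr A \<theta> * (\<integral>\<^sup>+x. f x * ennreal (W x) \<partial>lborel))"
    using * by (rule mult_left_mono) simp
  also have "\<alpha> / real CARD('n) = 1 - 1 / q" using q by simp
  finally show ?thesis unfolding \<theta>_def by (simp only: ac_simps)
qed

text \<open>
  With s = 1 + p'/q, the power 1/p' of Buckley's constant times the constant of Hedberg's
  inequality.
\<close>
definition pairing_const :: "'n::finite itself \<Rightarrow> real \<Rightarrow> real \<Rightarrow> real \<Rightarrow> real" where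
  "pairing_const _ \<alpha> s p' = hedberg_const TYPE('n) \<alpha>
     * (real (card (shifts :: ('n \<Rightarrow> real) set)) * (s * 2 powr (s / (s - 1)) * (s / (s - 1) * 2 powr s))) powr (1 / p')"

text \<open>
  Here \<theta> p' = s turns the dual norm into the integral in Buckley's estimate, and u(E)
  collects the exponent \<alpha>/n + 1/p' = 1 - 1/q.
\<close>
lemma riesz_pairing_Apq:
  fixes f :: "real ^ 'n \<Rightarrow> ennreal" and W :: "real ^ 'n \<Rightarrow> real"
  assumes [measurable]: "f \<in> borel_measurable borel" "W \<in> borel_measurable borel" "E \<in> sets borel"
    and W: "\<And>x. 0 < W x"
    and \<alpha>: "0 < \<alpha>" "\<alpha> < real CARD('n)"
    and p: "1 < p" "1 < p'" "1 / p + 1 / p' = 1"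
    and q: "0 < q" "1 / q = 1 / p - \<alpha> / real CARD('n)"
    and A: "A < top"
      "\<And>Q. Q \<in> cubes \<Longrightarrow> (\<integral>\<^sup>+x\<in>Q. ennreal (W x powr q) \<partial>lborel) / emeasure lborel Q
          * ennpowr ((\<integral>\<^sup>+x\<in>Q. ennreal (W x powr - p') \<partial>lborel) / emeasure lborel Q) (q / p') \<le> A"
    and fin: "(\<integral>\<^sup>+x\<in>E. ennreal (W x powr q) \<partial>lborel) < top"
  shows "(\<integral>\<^sup>+x\<in>E. riesz_pot \<alpha> f x * ennreal (W x powr q) \<partial>lborel)
    \<le> ennreal (pairing_const TYPE('n) \<alpha> (1 + p' / q) p') * ennpowr A (1 - \<alpha> / real CARD('n))
       * ennpowr (\<integral>\<^sup>+x. ennpowr (f x * ennreal (W x)) p \<partial>lborel) (1 / p)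
       * ennpowr (\<integral>\<^sup>+x\<in>E. ennreal (W x powr q) \<partial>lborel) (1 - 1 / q)"
proof -
  let ?u = "\<lambda>x. ennreal (W x powr q)"
  let ?\<sigma> = "\<lambda>x. ennreal (W x powr - p')"
  let ?G = "\<integral>\<^sup>+x\<in>E. ?u x \<partial>lborel"
  let ?M = "grid_maximal (\<lambda>x. ?u x * indicator E x)"
  let ?F = "ennpowr (\<integral>\<^sup>+x. ennpowr (f x * ennreal (W x)) p \<partial>lborel) (1 / p)"
  define \<theta> where "\<theta> = 1 - \<alpha> / real CARD('n)"
  define s where "s = 1 + p' / q"
  define K where "K = real (card (shifts :: ('n \<Rightarrow> real) set)) * (s * 2 powr (s / (s - 1)) * (s / (s - 1) * 2 powr s))"
  have s: "1 < s" using p q by (simp add: s_def)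
  have K0: "0 \<le> K" using s by (simp add: K_def)
  have \<theta>: "0 < \<theta>" using \<alpha> by (simp add: \<theta>_def)
  have sp: "s / p' = \<theta>"
  proof -
    have "s / p' = 1 / p' + 1 / q" using p q by (simp add: s_def add_divide_distrib)
    also have "\<dots> = \<theta>" using p q by (simp add: \<theta>_def)
    finally show ?thesis .
  qed
  have \<theta>p: "\<theta> * p' = s" using sp p by (simp add: field_simps)
  have \<sigma>u: "?\<sigma> x = ennpowr (?u x) (1 - s)" for x
    using W[of x] q by (simp add: ennpowr_ennreal powr_powr s_def)
  have 1: "1 / (s - 1) = q / p'" using p q by (simp add: s_def)
  have W': "W x \<noteq> 0" for x using W[of x] by simp
  have buckley: "(\<integral>\<^sup>+x. ennpowr (?M x) s * ?\<sigma> x \<partial>lborel) \<le> ennreal K * (ennpowr A s * ?G)"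
    unfolding K_def
  proof (rule grid_maximal_restricted_bound[where u = ?u and \<sigma> = ?\<sigma>])
    show "0 < ?u x" for x using W' by simp
    show "?\<sigma> x = ennpowr (?u x) (1 - s)" for x by (rule \<sigma>u)
  qed (simp_all add: s A 1)
  have "(\<integral>\<^sup>+y. f y * ennpowr (?M y) \<theta> \<partial>lborel)
    = (\<integral>\<^sup>+y. (f y * ennreal (W y)) * (ennreal (W y powr - 1) * ennpowr (?M y) \<theta>) \<partial>lborel)"
  proof (intro nn_integral_cong)
    fix y
    have "ennreal (W y) * ennreal (W y powr - 1) = 1"
    proof -
      have "W y * W y powr - 1 = 1" using W[of y] by (simp add: powr_minus)
      then show ?thesis using W[of y] by (simp flip: ennreal_mult)
    qed
    then have "f y * ennpowr (?M y) \<theta> = f y * (ennreal (W y) * ennreal (W y powr - 1)) * ennpowr (?M y) \<theta>"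
      by simp
    then show "f y * ennpowr (?M y) \<theta> = (f y * ennreal (W y)) * (ennreal (W y powr - 1) * ennpowr (?M y) \<theta>)"
      by (simp only: mult.assoc)
  qed
  also have "\<dots> \<le> ?F * ennpowr (\<integral>\<^sup>+y. ennpowr (ennreal (W y powr - 1) * ennpowr (?M y) \<theta>) p' \<partial>lborel) (1 / p')"
    using p by (intro Holder_nn_integral) auto
  also have "(\<integral>\<^sup>+y. ennpowr (ennreal (W y powr - 1) * ennpowr (?M y) \<theta>) p' \<partial>lborel)
      = (\<integral>\<^sup>+x. ennpowr (?M x) s * ?\<sigma> x \<partial>lborel)"
  proof (intro nn_integral_cong)
    fix y
    have "0 < W y powr - 1" using W' by simp
    then have "ennpowr (ennreal (W y powr - 1)) p' = ?\<sigma> y"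
      by (simp only: ennpowr_ennreal powr_powr) simp
    then show "ennpowr (ennreal (W y powr - 1) * ennpowr (?M y) \<theta>) p' = ennpowr (?M y) s * ?\<sigma> y"
      using p by (simp only: ennpowr_mult ennpowr_ennpowr \<theta>p mult.commute)
  qed
  also have "ennpowr \<dots> (1 / p') \<le> ennpowr (ennreal K * (ennpowr A s * ?G)) (1 / p')"
    using buckley p by (intro ennpowr_mono) auto
  also have "\<dots> = ennreal (K powr (1 / p')) * (ennpowr A \<theta> * ennpowr ?G (1 / p'))"
    using p K0 by (simp add: ennpowr_mult ennpowr_ennpowr sp ennpowr_ennreal_nonneg)
  finally have *: "(\<integral>\<^sup>+y. f y * ennpowr (?M y) \<theta> \<partial>lborel)
    \<le> ?F * (ennreal (K powr (1 / p')) * (ennpowr A \<theta> * ennpowr ?G (1 / p')))" by (simp add: mult_left_mono)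
  have "(\<integral>\<^sup>+x\<in>E. riesz_pot \<alpha> f x * ?u x \<partial>lborel) \<le> ennreal (hedberg_const TYPE('n) \<alpha>)
      * ennpowr ?G (\<alpha> / real CARD('n)) * (\<integral>\<^sup>+y. f y * ennpowr (?M y) \<theta> \<partial>lborel)"
    unfolding \<theta>_def using \<alpha> fin by (intro riesz_pot_pairing_le) auto
  also have "\<dots> \<le> ennreal (hedberg_const TYPE('n) \<alpha>) * ennpowr ?G (\<alpha> / real CARD('n))
      * (?F * (ennreal (K powr (1 / p')) * (ennpowr A \<theta> * ennpowr ?G (1 / p'))))"
    using * by (rule mult_left_mono) simp
  also have "\<dots> = ennreal (hedberg_const TYPE('n) \<alpha>) * ennreal (K powr (1 / p')) * ennpowr A \<theta> * ?F
      * (ennpowr ?G (\<alpha> / real CARD('n)) * ennpowr ?G (1 / p'))"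
    by (simp only: ac_simps)
  also have "ennpowr ?G (\<alpha> / real CARD('n)) * ennpowr ?G (1 / p') = ennpowr ?G (1 - 1 / q)"
  proof -
    have "1 - 1 / q = \<alpha> / real CARD('n) + 1 / p'" using p q by simp
    then show ?thesis using \<alpha> p by (simp add: ennpowr_add)
  qed
  also have "ennreal (hedberg_const TYPE('n) \<alpha>) * ennreal (K powr (1 / p')) = ennreal (pairing_const TYPE('n) \<alpha> s p')"
    unfolding pairing_const_def K_def by (subst ennreal_mult'') auto
  finally show ?thesis unfolding \<theta>_def s_def .
qed

section \<open>The weak type bound for A_{p,q} weights\<close>

lemma weight_measurable:
  fixes w :: "real ^ 'n \<Rightarrow> real"
  assumes "weight w"
  shows "w \<in> borel_measurable lebesgue"
proof (rule borel_measurable_LIMSEQ_real)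
  show "(\<lambda>x. indicator (cball 0 (real N)) x * w x) \<in> borel_measurable lebesgue" for N :: nat
    using assms unfolding weight_def set_integrable_def by (auto dest!: spec[of _ "cball 0 (real N)"])
  fix x :: "real ^ 'n"
  obtain N :: nat where N: "norm x < real N" using reals_Archimedean2 by blast
  have "\<forall>\<^sub>F k in sequentially. indicator (cball 0 (real k)) x * w x = w x"
    using eventually_ge_at_top[of N] by eventually_elim (use N in \<open>auto simp: indicator_def\<close>)
  then show "(\<lambda>k. indicator (cball 0 (real k)) x * w x) \<longlonglongrightarrow> w x"
    by (rule tendsto_eventually)
qed

text \<open>
  The set in the definition is closed under countable suprema, so its supremum is attained.
\<close>
lemma ess_inf_on_le:
  "AE x in lebesgue. x \<in> Q \<longrightarrow> ess_inf_on Q g \<le> g x"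
proof -
  let ?T = "{t. AE x in lebesgue. x \<in> Q \<longrightarrow> t \<le> g x}"
  have "?T \<noteq> {}" by (auto intro!: exI[of _ 0])
  then obtain f :: "nat \<Rightarrow> ennreal" where f: "range f \<subseteq> ?T" "Sup ?T = (SUP i. f i)"
    using ennreal_Sup_countable_SUP[of ?T] by blast
  have "AE x in lebesgue. \<forall>i. x \<in> Q \<longrightarrow> f i \<le> g x" using f(1) unfolding AE_all_countable by blast
  then show ?thesis unfolding ess_inf_on_def f(2) by eventually_elim (auto intro: SUP_least)
qed

text \<open>
  Written as a corner plus a side length, the form in which \<^const>\<open>cubes\<close> is
  defined.
\<close>
definition centered_cube :: "nat \<Rightarrow> (real ^ 'n) set" where
  "centered_cube N = cbox (\<chi> i. - real (Suc N)) (\<chi> i. (\<chi> i. - real (Suc N)) $ i + 2 * real (Suc N))"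

lemma mem_centered_cube: "x \<in> centered_cube N \<longleftrightarrow> (\<forall>i. \<bar>x $ i\<bar> \<le> real (Suc N))"
proof -
  have "(- a \<le> b \<and> b \<le> - a + 2 * a) = (\<bar>b\<bar> \<le> a)" for a b :: real by (auto simp: abs_le_iff)
  then show ?thesis unfolding centered_cube_def mem_box_cart by (simp only: vec_lambda_beta)
qed

lemma centered_cube:
  fixes x :: "real ^ 'n"
  shows "(centered_cube N :: (real ^ 'n) set) \<in> cubes"
    and "incseq (centered_cube :: nat \<Rightarrow> (real ^ 'n) set)"
    and "ball 0 (real N) \<subseteq> (centered_cube N :: (real ^ 'n) set)"
    and "\<exists>N. x \<in> centered_cube N"
proof -
  show "(centered_cube N :: (real ^ 'n) set) \<in> cubes" unfolding cubes_def centered_cube_def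
    by (intro CollectI exI[of _ "\<chi> i. - real (Suc N)"] exI[of _ "2 * real (Suc N)"]) simp
  show "incseq (centered_cube :: nat \<Rightarrow> (real ^ 'n) set)"
    by (intro incseq_SucI subsetI) (auto simp: mem_centered_cube intro: order_trans)
  show b: "ball 0 (real N) \<subseteq> (centered_cube N :: (real ^ 'n) set)" for N
  proof
    fix x :: "real ^ 'n" assume "x \<in> ball 0 (real N)"
    then have "\<bar>x $ i\<bar> \<le> real (Suc N)" for i using component_le_norm_cart[of x i] by simp
    then show "x \<in> centered_cube N" by (simp add: mem_centered_cube)
  qed
  obtain N :: nat where "norm x < real N" using reals_Archimedean2 by blast
  then have "x \<in> ball 0 (real N)" by simp
  with b show "\<exists>N. x \<in> centered_cube N" by blast
qed

lemma cube_emeasure: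
  assumes "Q \<in> cubes"
  shows "Q \<in> sets borel" "0 < emeasure lborel Q" "emeasure lborel Q < top"
  using assms by (auto simp: cubes_def emeasure_cube)

lemma average_lborel: "Q \<in> cubes \<Longrightarrow> average Q g = (\<integral>\<^sup>+x\<in>Q. g x \<partial>lborel) / emeasure lborel Q"
  by (simp add: average_def nn_integral_completion cube_emeasure)

lemma conj_exponent_conjugate:
  assumes "1 < p"
  shows "1 < conj_exponent p" "1 / p + 1 / conj_exponent p = 1"
  using assms by (auto simp: conj_exponent_def field_simps)

lemma ess_inf_on_less_top:
  assumes Q: "Q \<in> cubes" and g: "\<And>x. g x < top"
  shows "ess_inf_on Q g < top"
proof (rule ccontr)
  assume "\<not> ess_inf_on Q g < top"
  then have top: "ess_inf_on Q g = top" by (simp add: less_top[symmetric])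
  have "g x \<noteq> top" for x using g[of x] by simp
  then have "AE x in lborel. x \<notin> Q"
    using ess_inf_on_le[of Q g] unfolding AE_completion_iff
    by (auto elim!: eventually_mono simp: top top_unique)
  then have "emeasure lborel Q = 0"
    using cube_emeasure[OF Q] by (subst (asm) AE_iff_measurable[of Q]) auto
  with cube_emeasure[OF Q] show False by simp
qed

lemma ennpowr_ennreal_less_top: "0 < q \<Longrightarrow> ennpowr (ennreal r) q < top"
  by (simp add: less_top[symmetric] ennpowr_eq_top_iff)

text \<open>
  The infimum in the definition of the constant is attained. This needs the essential infimum to
  be finite: if it were \<infinity>, the product would jump at a constant 0.
\<close>
lemma A1q_condition:
  fixes w :: "real ^ 'n \<Rightarrow> real"
  assumes fin: "Apq_const 1 q w < top" and q: "0 < q" and Q: "Q \<in> cubes"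
  shows "average Q (\<lambda>x. ennpowr (ennreal (w x)) q)
     \<le> Apq_const 1 q w * ess_inf_on Q (\<lambda>x. ennpowr (ennreal (w x)) q)" (is "?a \<le> _ * ?m")
proof -
  define S where "S = {c. \<forall>Q\<in>cubes. average Q (\<lambda>x. ennpowr (ennreal (w x)) q)
      \<le> c * ess_inf_on Q (\<lambda>x. ennpowr (ennreal (w x)) q)}"
  have A: "Apq_const 1 q w = Inf S" by (simp add: Apq_const_def S_def)
  have ne: "S \<noteq> {}" using fin A by (metis Inf_empty less_irrefl)
  have m: "?m < top" using Q q by (intro ess_inf_on_less_top ennpowr_ennreal_less_top)
  show ?thesis
  proof (cases "?m = 0")
    case True
    obtain c where "c \<in> S" using ne by auto
    with Q have "?a \<le> c * ?m" by (simp add: S_def)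
    with True show ?thesis by simp
  next
    case False
    have "?a / ?m \<le> Inf S"
    proof (intro Inf_greatest)
      fix c assume "c \<in> S"
      then have "?a / ?m \<le> c * ?m / ?m" using Q by (intro divide_right_mono_ennreal) (auto simp: S_def)
      also have "\<dots> \<le> c" by (rule ennreal_divide_self_le)
      finally show "?a / ?m \<le> c" .
    qed
    then have "?a / ?m * ?m \<le> Inf S * ?m" by (rule mult_right_mono) simp
    with False m show ?thesis unfolding A by (simp add: ennreal_divide_times ennreal_divide_self less_top)
  qed
qed

lemma Apq_condition:
  assumes "p \<noteq> 1" "Q \<in> cubes"
  shows "average Q (\<lambda>x. ennpowr (ennreal (w x)) q) *
      ennpowr (average Q (\<lambda>x. ennpowr (ennreal (w x)) (- conj_exponent p))) (q / conj_exponent p)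
    \<le> Apq_const p q w"
  using assms by (auto simp: Apq_const_def intro: SUP_upper)

text \<open>
  If w vanishes on a part of Q of positive measure, then the average of w^(-p') (or the
  reciprocal of the essential infimum, for p = 1) is infinite. The product with the average of
  w^q is finite only if that average is 0, by the convention that 0 times \<infinity> is 0.
\<close>
lemma Apq_zero_or_positive_on_cube:
  fixes w :: "real ^ 'n \<Rightarrow> real"
  assumes w: "w \<in> borel_measurable lebesgue" "\<And>x. 0 \<le> w x"
    and p: "1 \<le> p" and q: "0 < q" and fin: "Apq_const p q w < top" and Q: "Q \<in> cubes"
  shows "(AE x in lebesgue. x \<in> Q \<longrightarrow> w x = 0) \<or> (AE x in lebesgue. x \<in> Q \<longrightarrow> 0 < w x)"
proof -
  let ?u = "\<lambda>x. ennpowr (ennreal (w x)) q"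
  have [measurable]: "w \<in> borel_measurable lebesgue" by fact
  have [measurable]: "Q \<in> sets lebesgue" using cube_emeasure(1)[OF Q] by simp
  have V: "emeasure lebesgue Q \<noteq> 0" "emeasure lebesgue Q \<noteq> top" using cube_emeasure[OF Q] by auto
  have zero: "AE x in lebesgue. x \<in> Q \<longrightarrow> w x = 0" if "average Q ?u = 0"
  proof -
    have "(\<integral>\<^sup>+x\<in>Q. ?u x \<partial>lebesgue) = 0"
      using that V by (simp add: average_def ennreal_divide_eq_0_iff)
    then have "AE x in lebesgue. ?u x * indicator Q x = 0"
      by (subst (asm) nn_integral_0_iff_AE) auto
    then show ?thesis
    proof eventually_elim
      case (elim x)
      then show ?case using q w(2)[of x] by (auto simp: ennpowr_eq_0_iff)
    qed
  qed
  show ?thesis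
  proof (cases "p = 1")
    case True
    have c: "average Q ?u \<le> Apq_const 1 q w * ess_inf_on Q ?u"
      using fin q Q True by (intro A1q_condition) auto
    show ?thesis
    proof (cases "ess_inf_on Q ?u = 0")
      case True
      with c zero show ?thesis by simp
    next
      case False
      have "AE x in lebesgue. x \<in> Q \<longrightarrow> 0 < w x"
        using ess_inf_on_le[of Q ?u]
      proof eventually_elim
        case (elim x)
        then show ?case using w(2)[of x] q False by (cases "w x = 0") auto
      qed
      then show ?thesis ..
    qed
  next
    case False
    let ?s = "\<lambda>x. ennpowr (ennreal (w x)) (- conj_exponent p)"
    have p': "1 < conj_exponent p" using p False by (intro conj_exponent_conjugate) simp
    have c: "average Q ?u * ennpowr (average Q ?s) (q / conj_exponent p) \<le> Apq_const p q w"
      using False Q by (rule Apq_condition)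
    show ?thesis
    proof (cases "average Q ?u = 0")
      case True
      with zero show ?thesis by simp
    next
      case False
      have "ennpowr (average Q ?s) (q / conj_exponent p) \<noteq> top"
      proof
        assume "ennpowr (average Q ?s) (q / conj_exponent p) = top"
        with c False fin show False by (simp add: ennreal_mult_top top_unique)
      qed
      then have "average Q ?s \<noteq> top" using p' q by (simp add: ennpowr_eq_top_iff)
      then have "(\<integral>\<^sup>+x\<in>Q. ?s x \<partial>lebesgue) \<noteq> top"
        using V by (auto simp: average_def ennreal_top_divide)
      then have "AE x in lebesgue. ?s x * indicator Q x \<noteq> \<infinity>"
        by (intro nn_integral_noteq_infinite) auto
      then have "AE x in lebesgue. x \<in> Q \<longrightarrow> 0 < w x"
      proof eventually_elim
        case (elim x)
        then show ?case using w(2)[of x] p' by (cases "w x = 0") (auto simp: ennpowr_def)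
      qed
      then show ?thesis ..
    qed
  qed
qed

text \<open>
  Otherwise a large cube would contain parts of positive measure of {w = 0} and of {w > 0}.
\<close>
lemma Apq_zero_or_positive:
  fixes w :: "real ^ 'n \<Rightarrow> real"
  assumes "w \<in> borel_measurable lebesgue" "\<And>x. 0 \<le> w x"
    and "1 \<le> p" "0 < q" "Apq_const p q w < top"
  shows "(AE x in lborel. w x = 0) \<or> (AE x in lborel. 0 < w x)"
proof -
  define Z where "Z = (\<lambda>N. AE x in lebesgue. x \<in> centered_cube N \<longrightarrow> w x = 0)"
  define P where "P = (\<lambda>N. AE x in lebesgue. x \<in> centered_cube N \<longrightarrow> 0 < w x)"
  have ZP: "Z N \<or> P N" for N
    unfolding Z_def P_def using assms by (intro Apq_zero_or_positive_on_cube centered_cube(1)) auto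
  have mono: "Z N \<Longrightarrow> M \<le> N \<Longrightarrow> Z M" "P N \<Longrightarrow> M \<le> N \<Longrightarrow> P M" for M N
    using incseqD[OF centered_cube(2)] unfolding Z_def P_def by (auto elim!: eventually_mono)
  have "(\<forall>N. Z N) \<or> (\<forall>N. P N)"
    using ZP mono by (metis nle_le)
  then show ?thesis
  proof
    assume "\<forall>N. Z N"
    then have "AE x in lebesgue. \<forall>N. x \<in> centered_cube N \<longrightarrow> w x = 0" unfolding Z_def AE_all_countable by blast
    then have "AE x in lebesgue. w x = 0" by eventually_elim (use centered_cube(4) in blast)
    then show ?thesis by (simp add: AE_completion_iff)
  next
    assume "\<forall>N. P N"
    then have "AE x in lebesgue. \<forall>N. x \<in> centered_cube N \<longrightarrow> 0 < w x" unfolding P_def AE_all_countable by blast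
    then have "AE x in lebesgue. 0 < w x" by eventually_elim (use centered_cube(4) in blast)
    then show ?thesis by (simp add: AE_completion_iff)
  qed
qed

text \<open>
  Passage from the given Lebesgue measurable data to Borel functions: W is a positive Borel
  version of w, and |w f|/W is one of |f|. The modulus of the fractional integral is everywhere
  at most the potential of |f|; where the integral does not converge absolutely both are
  infinite.
\<close>
lemma weak_norm_le_of_pairing:
  fixes w W :: "real ^ 'n \<Rightarrow> real" and f :: "real ^ 'n \<Rightarrow> complex"
  assumes wm: "w \<in> borel_measurable lebesgue"
    and [measurable]: "W \<in> borel_measurable borel" and W: "\<And>x. 0 < W x" "AE x in lborel. w x = W x"
    and q: "0 < q"
    and wf: "(\<lambda>x. w x *\<^sub>R f x) \<in> borel_measurable lebesgue"
    and loc: "\<And>N::nat. (\<integral>\<^sup>+x\<in>ball 0 (real N). ennreal (W x powr q) \<partial>lborel) < top"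
    and pair: "\<And>g E. g \<in> borel_measurable borel \<Longrightarrow> E \<in> sets borel \<Longrightarrow>
       (\<integral>\<^sup>+x\<in>E. ennreal (W x powr q) \<partial>lborel) < top \<Longrightarrow>
       (\<integral>\<^sup>+x\<in>E. riesz_pot \<alpha> g x * ennreal (W x powr q) \<partial>lborel)
       \<le> C * ennpowr (\<integral>\<^sup>+x. ennpowr (g x * ennreal (W x)) p \<partial>lborel) (1 / p)
          * ennpowr (\<integral>\<^sup>+x\<in>E. ennreal (W x powr q) \<partial>lborel) (1 - 1 / q)"
  shows "weak_norm q (\<lambda>x. ennpowr (ennreal (w x)) q) (fractional_integral_abs \<alpha> f)
    \<le> C * Lp_norm p (\<lambda>x. w x *\<^sub>R f x)"
proof -
  let ?K = "\<lambda>x y. norm (x - y) powr (real CARD('n) - \<alpha>)"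
  have "(\<lambda>x. ennreal (norm (w x *\<^sub>R f x))) \<in> borel_measurable lebesgue" using wf by measurable
  then obtain \<phi> where [measurable]: "\<phi> \<in> borel_measurable lborel"
    and \<phi>: "AE x in lborel. ennreal (norm (w x *\<^sub>R f x)) = \<phi> x"
    by (blast dest: completion_ex_borel_measurable)
  define g where "g = (\<lambda>x. \<phi> x / ennreal (W x))"
  have [measurable]: "g \<in> borel_measurable borel" unfolding g_def by measurable
  have g: "AE x in lborel. g x = ennreal (norm (f x))"
    using W(2) \<phi>
  proof eventually_elim
    case (elim x)
    then have "\<phi> x = ennreal (norm (f x)) * ennreal (W x)"
      using W(1)[of x] by (metis abs_of_pos mult.commute norm_scaleR ennreal_mult'' less_imp_le)
    then show ?case using W(1)[of x] by (simp add: g_def ennreal_mult_divide_eq)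
  qed
  have norm_g: "ennpowr (\<integral>\<^sup>+x. ennpowr (g x * ennreal (W x)) p \<partial>lborel) (1 / p) = Lp_norm p (\<lambda>x. w x *\<^sub>R f x)"
  proof -
    have "(\<integral>\<^sup>+x. ennpowr (g x * ennreal (W x)) p \<partial>lborel) = (\<integral>\<^sup>+x. ennpowr (ennreal (norm (w x *\<^sub>R f x))) p \<partial>lborel)"
    proof (intro nn_integral_cong_AE)
      show "AE x in lborel. ennpowr (g x * ennreal (W x)) p = ennpowr (ennreal (norm (w x *\<^sub>R f x))) p"
        using \<phi>
      proof eventually_elim
        case (elim x)
        have "g x * ennreal (W x) = \<phi> x"
          using W(1)[of x] by (simp add: g_def ennreal_divide_times ennreal_divide_self)
        with elim show ?case by simp
      qed
    qed
    then show ?thesis by (simp add: Lp_norm_def nn_integral_completion)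
  qed
  have fm: "f \<in> borel_measurable lebesgue"
  proof (rule borel_measurable_AE)
    show "(\<lambda>x. inverse (w x) *\<^sub>R (w x *\<^sub>R f x)) \<in> borel_measurable lebesgue"
      using wm wf by measurable
    show "AE x in lebesgue. inverse (w x) *\<^sub>R (w x *\<^sub>R f x) = f x"
      using W(2) unfolding AE_completion_iff
    proof eventually_elim
      case (elim x)
      then show ?case using W(1)[of x] by simp
    qed
  qed
  have pot: "(\<integral>\<^sup>+y. ennreal (norm (riesz_integrand \<alpha> f x y)) \<partial>lebesgue) = riesz_pot \<alpha> g x" for x
    unfolding nn_integral_completion riesz_pot_def
  proof (intro nn_integral_cong_AE)
    show "AE y in lborel. ennreal (norm (riesz_integrand \<alpha> f x y)) = ennreal (norm (x - y) powr (\<alpha> - real CARD('n))) * g y"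
      using g
    proof eventually_elim
      case (elim y)
      have "inverse (?K x y) = norm (x - y) powr (\<alpha> - real CARD('n))"
        by (simp flip: powr_minus)
      then show ?case using elim by (simp add: riesz_integrand_def flip: ennreal_mult)
    qed
  qed
  have le: "fractional_integral_abs \<alpha> f x \<le> riesz_pot \<alpha> g x" for x
  proof (cases "integrable lebesgue (riesz_integrand \<alpha> f x)")
    case True
    then show ?thesis using integral_norm_bound_ennreal[OF True]
      by (simp add: fractional_integral_abs_def fractional_integral_def pot)
  next
    case False
    have "riesz_integrand \<alpha> f x \<in> borel_measurable lebesgue"
    proof -
      have "(\<lambda>y. ?K x y) \<in> borel_measurable lborel" by measurable
      then have "(\<lambda>y. ?K x y) \<in> borel_measurable lebesgue" by (rule measurable_completion)
      with fm have "(\<lambda>y. f y /\<^sub>R ?K x y) \<in> borel_measurable lebesgue" by measurable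
      then show ?thesis by (simp add: riesz_integrand_def[abs_def])
    qed
    with False have "\<not> (\<integral>\<^sup>+y. ennreal (norm (riesz_integrand \<alpha> f x y)) \<partial>lebesgue) < \<infinity>"
      using integrableI_bounded by blast
    then show ?thesis unfolding pot by (simp add: less_top[symmetric])
  qed
  show ?thesis unfolding weak_norm_def
  proof (intro SUP_least)
    fix t :: real assume t: "t \<in> {0<..}"
    have "weighted_measure (\<lambda>x. ennpowr (ennreal (w x)) q) {x. ennreal t < fractional_integral_abs \<alpha> f x}
      \<le> (\<integral>\<^sup>+x\<in>{x. ennreal t < riesz_pot \<alpha> g x}. ennreal (W x powr q) \<partial>lborel)"
      unfolding weighted_measure_def nn_integral_completion
    proof (intro nn_integral_mono_AE)
      show "AE x in lborel. ennpowr (ennreal (w x)) q * indicator {x. ennreal t < fractional_integral_abs \<alpha> f x} x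
          \<le> ennreal (W x powr q) * indicator {x. ennreal t < riesz_pot \<alpha> g x} x"
        using W(2)
      proof eventually_elim
        case (elim x)
        then show ?case using W(1)[of x] le[of x] by (auto simp: indicator_def ennpowr_ennreal)
      qed
    qed
    then have "ennreal t * ennpowr (weighted_measure (\<lambda>x. ennpowr (ennreal (w x)) q) {x. ennreal t < fractional_integral_abs \<alpha> f x}) (1 / q)
      \<le> ennreal t * ennpowr (\<integral>\<^sup>+x\<in>{x. ennreal t < riesz_pot \<alpha> g x}. ennreal (W x powr q) \<partial>lborel) (1 / q)"
      using q by (intro mult_left_mono ennpowr_mono) auto
    also have "\<dots> \<le> C * Lp_norm p (\<lambda>x. w x *\<^sub>R f x)"
      using q t loc pair[of g] unfolding norm_g by (intro weak_type_of_pairing) auto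
    finally show "ennreal t * ennpowr (weighted_measure (\<lambda>x. ennpowr (ennreal (w x)) q) {x. ennreal t < fractional_integral_abs \<alpha> f x}) (1 / q)
      \<le> C * Lp_norm p (\<lambda>x. w x *\<^sub>R f x)" .
  qed
qed

definition weak_const :: "'n::finite itself \<Rightarrow> real \<Rightarrow> real \<Rightarrow> real \<Rightarrow> real" where
  "weak_const _ \<alpha> p q = (if p = 1 then hedberg_const TYPE('n) \<alpha>
     else pairing_const TYPE('n) \<alpha> (1 + conj_exponent p / q) (conj_exponent p))"

theorem riesz_weak_type:
  fixes w :: "real ^ 'n \<Rightarrow> real" and f :: "real ^ 'n \<Rightarrow> complex"
  assumes \<alpha>: "0 < \<alpha>" "\<alpha> < real CARD('n)" and p: "1 \<le> p"
    and q: "0 < q" "1 / q = 1 / p - \<alpha> / real CARD('n)"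
    and w: "w \<in> Apq p q" and f: "in_Lp p (\<lambda>x. w x *\<^sub>R f x)"
  shows "weak_norm q (\<lambda>x. ennpowr (ennreal (w x)) q) (fractional_integral_abs \<alpha> f)
    \<le> ennreal (weak_const TYPE('n) \<alpha> p q) * ennpowr (Apq_const p q w) (1 - \<alpha> / real CARD('n))
      * Lp_norm p (\<lambda>x. w x *\<^sub>R f x)"
proof -
  have wm: "w \<in> borel_measurable lebesgue" and w0: "0 \<le> w x" and fin: "Apq_const p q w < top" for x
    using w weight_measurable by (auto simp: Apq_def weight_def)
  have wf: "(\<lambda>x. w x *\<^sub>R f x) \<in> borel_measurable lebesgue" using f by (simp add: in_Lp_def)
  \<comment> \<open>A finite constant also admits w = 0; then the left hand side vanishes.\<close>
  consider "AE x in lborel. w x = 0" | "AE x in lborel. 0 < w x"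
    using Apq_zero_or_positive[OF wm w0 p q(1) fin] by auto
  then show ?thesis
  proof cases
    case 1
    have "weighted_measure (\<lambda>x. ennpowr (ennreal (w x)) q) E = 0" for E
    proof -
      have "weighted_measure (\<lambda>x. ennpowr (ennreal (w x)) q) E = (\<integral>\<^sup>+x. 0 \<partial>(lborel :: (real ^ 'n) measure))"
        unfolding weighted_measure_def nn_integral_completion
        using 1 q by (intro nn_integral_cong_AE) (auto elim!: eventually_mono)
      then show ?thesis by simp
    qed
    then show ?thesis using q(1) by (simp add: weak_norm_def)
  next
    case 2
    obtain w' where w' [measurable]: "w' \<in> borel_measurable lborel" "AE x in lborel. w x = w' x"
      using completion_ex_borel_measurable_real[OF wm] by blast
    define W where "W = (\<lambda>x. if 0 < w' x then w' x else 1)"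
    have [measurable]: "W \<in> borel_measurable borel" unfolding W_def by measurable
    have W: "0 < W x" for x by (simp add: W_def)
    have wW: "AE x in lborel. w x = W x" using 2 w'(2) by eventually_elim (simp add: W_def)
    have powW: "ennpowr (ennreal (W x)) r = ennreal (W x powr r)" for x r using W by (simp add: ennpowr_ennreal)
    have avg: "average Q (\<lambda>x. ennpowr (ennreal (w x)) r) = (\<integral>\<^sup>+x\<in>Q. ennreal (W x powr r) \<partial>lborel) / emeasure lborel Q"
      if Q: "Q \<in> cubes" for Q r
    proof -
      have "(\<integral>\<^sup>+x\<in>Q. ennpowr (ennreal (w x)) r \<partial>lborel) = (\<integral>\<^sup>+x\<in>Q. ennreal (W x powr r) \<partial>lborel)"
        using wW by (intro nn_integral_cong_AE) (auto elim!: eventually_mono simp: powW)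
      then show ?thesis by (simp add: average_lborel Q)
    qed
    let ?A = "Apq_const p q w"
    have A1: "AE x in lborel. x \<in> Q \<longrightarrow> (\<integral>\<^sup>+x\<in>Q. ennreal (W x powr q) \<partial>lborel) / emeasure lborel Q \<le> ?A * ennreal (W x powr q)"
      if Q: "Q \<in> cubes" and "p = 1" for Q
    proof -
      let ?m = "ess_inf_on Q (\<lambda>x. ennpowr (ennreal (w x)) q)"
      have a: "(\<integral>\<^sup>+x\<in>Q. ennreal (W x powr q) \<partial>lborel) / emeasure lborel Q \<le> ?A * ?m"
        using A1q_condition[of q w Q] fin q Q \<open>p = 1\<close> by (simp add: avg)
      have "AE x in lborel. x \<in> Q \<longrightarrow> ?m \<le> ennpowr (ennreal (w x)) q"
        using ess_inf_on_le[of Q "\<lambda>x. ennpowr (ennreal (w x)) q"] by (simp add: AE_completion_iff)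
      then show ?thesis using wW
      proof eventually_elim
        case (elim x)
        show ?case
        proof
          assume "x \<in> Q"
          with elim have "?A * ?m \<le> ?A * ennreal (W x powr q)" by (intro mult_left_mono) (simp_all add: powW)
          with a show "(\<integral>\<^sup>+x\<in>Q. ennreal (W x powr q) \<partial>lborel) / emeasure lborel Q \<le> ?A * ennreal (W x powr q)"
            by (rule order_trans)
        qed
      qed
    qed
    have Ap: "(\<integral>\<^sup>+x\<in>Q. ennreal (W x powr q) \<partial>lborel) / emeasure lborel Q
          * ennpowr ((\<integral>\<^sup>+x\<in>Q. ennreal (W x powr - conj_exponent p) \<partial>lborel) / emeasure lborel Q) (q / conj_exponent p) \<le> ?A"
      if Q: "Q \<in> cubes" and "p \<noteq> 1" for Q
      using Apq_condition[OF that(2) Q, of w q] by (simp add: avg Q)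
    have loc: "(\<integral>\<^sup>+x\<in>ball 0 (real N). ennreal (W x powr q) \<partial>lborel) < top" for N :: nat
    proof -
      let ?Q = "centered_cube N :: (real ^ 'n) set"
      let ?U = "\<integral>\<^sup>+x\<in>?Q. ennreal (W x powr q) \<partial>lborel"
      have Q: "?Q \<in> cubes" by (rule centered_cube)
      note V = cube_emeasure[OF Q]
      have W': "W x \<noteq> 0" for x using W[of x] by simp
      have "?U / emeasure lborel ?Q \<noteq> top"
      proof (cases "p = 1")
        case True
        show ?thesis
        proof
          assume "?U / emeasure lborel ?Q = top"
          then have "AE x in lborel. x \<notin> ?Q"
            using A1[OF Q True] fin[THEN less_imp_neq]
            by (auto elim!: eventually_mono simp: top_unique ennreal_mult_eq_top_iff)
          then have "emeasure lborel ?Q = 0" using V by (subst (asm) AE_iff_measurable[of ?Q]) auto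
          with V show False by simp
        qed
      next
        case False
        let ?S = "\<integral>\<^sup>+x\<in>?Q. ennreal (W x powr - conj_exponent p) \<partial>lborel"
        have p': "0 < conj_exponent p" using conj_exponent_conjugate[of p] p False by simp
        have "0 < ?S" using V W' by (intro set_nn_integral_pos) auto
        then have "?S / emeasure lborel ?Q \<noteq> 0"
          using V by (simp add: ennreal_divide_eq_0_iff less_top)
        then have "ennpowr (?S / emeasure lborel ?Q) (q / conj_exponent p) \<noteq> 0"
          using p' q by (simp add: ennpowr_eq_0_iff)
        then show ?thesis using Ap[OF Q False] fin by (auto simp: ennreal_top_mult top_unique)
      qed
      then have "?U < top" using V by (auto simp: ennreal_top_divide less_top[symmetric])
      moreover have "(\<integral>\<^sup>+x\<in>ball 0 (real N). ennreal (W x powr q) \<partial>lborel) \<le> ?U"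
        using centered_cube(3)[of N] by (intro nn_integral_mono) (auto simp: indicator_def)
      ultimately show ?thesis by (rule order.strict_trans1[rotated])
    qed
    show ?thesis
    proof (rule weak_norm_le_of_pairing[OF wm _ W wW q(1) wf loc])
      fix g :: "real ^ 'n \<Rightarrow> ennreal" and E :: "(real ^ 'n) set"
      assume [measurable]: "g \<in> borel_measurable borel" "E \<in> sets borel"
        and E: "(\<integral>\<^sup>+x\<in>E. ennreal (W x powr q) \<partial>lborel) < top"
      show "(\<integral>\<^sup>+x\<in>E. riesz_pot \<alpha> g x * ennreal (W x powr q) \<partial>lborel)
        \<le> ennreal (weak_const TYPE('n) \<alpha> p q) * ennpowr ?A (1 - \<alpha> / real CARD('n))
          * ennpowr (\<integral>\<^sup>+x. ennpowr (g x * ennreal (W x)) p \<partial>lborel) (1 / p)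
          * ennpowr (\<integral>\<^sup>+x\<in>E. ennreal (W x powr q) \<partial>lborel) (1 - 1 / q)"
      proof (cases "p = 1")
        case True
        then show ?thesis using riesz_pairing_A1q[of g W E \<alpha> q ?A] W \<alpha> q A1 E
          by (simp add: weak_const_def)
      next
        case False
        then show ?thesis using riesz_pairing_Apq[of g W E \<alpha> p "conj_exponent p" q ?A]
          conj_exponent_conjugate[of p] W \<alpha> p q fin Ap E by (simp add: weak_const_def)
      qed
    qed simp
  qed
qed

section \<open>Power weights\<close>

lemma emeasure_ball_vec:
  fixes y :: "real ^ 'n"
  assumes "0 \<le> r"
  shows "emeasure lborel (ball y r) = ennreal (unit_ball_vol (real CARD('n)) * r ^ CARD('n))"
proof -
  have "emeasure lborel (ball y r) = ennreal (measure lborel (ball y r))"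
    using emeasure_lborel_ball_finite[of y r] by (intro emeasure_eq_ennreal_measure) simp
  then show ?thesis using assms by (simp add: content_ball)
qed

text \<open>
  By Bernoulli's inequality, (1 - 1/(2J))^J \<ge> 1/2. This turns the factor 1/(1 - 2^(-a)) of
  the annulus decomposition, for a = 1/J, into a bound linear in J.
\<close>
lemma one_minus_two_powr_ge:
  assumes "0 < J"
  shows "1 / (2 * real J) \<le> 1 - 2 powr - (1 / real J)"
proof -
  let ?b = "1 - 1 / (2 * real J)"
  have b: "0 < ?b" using assms by (simp add: field_simps)
  have "1 + real J * (- (1 / (2 * real J))) \<le> (1 + (- (1 / (2 * real J)))) ^ J"
    using b by (intro Bernoulli_inequality) simp
  then have "1 / 2 \<le> ?b ^ J" using assms by simp
  then have "(1 / 2) powr (1 / real J) \<le> (?b ^ J) powr (1 / real J)" by (intro powr_mono2) auto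
  also have "\<dots> = ?b" using b assms by (simp add: powr_realpow[symmetric] powr_powr)
  also have "(1 / 2) powr (1 / real J) = 2 powr - (1 / real J)" by (simp add: powr_divide powr_minus_divide)
  finally show ?thesis by simp
qed

definition mass_const :: "'n::finite itself \<Rightarrow> real" where
  "mass_const _ = 2 powr real CARD('n) * 2 * unit_ball_vol (real CARD('n))"

lemma mass_const_pos: "0 < mass_const TYPE('n::finite)"
  by (simp add: mass_const_def)

lemma nn_integral_power_weight_ball_le:
  fixes J :: nat
  assumes J: "0 < J" and R: "0 < R"
  shows "(\<integral>\<^sup>+x\<in>ball 0 R. ennreal (norm (x :: real ^ 'n) powr (1 / J - real CARD('n))) \<partial>lborel)
    \<le> ennreal (mass_const TYPE('n) * J * R powr (1 / J))"
proof -
  let ?n = "real CARD('n)" and ?e = "1 / real J" and ?V = "unit_ball_vol (real CARD('n))"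
  have e: "0 < ?e" "?e \<le> 1" using J by auto
  have n: "1 \<le> ?n" by (simp add: Suc_leI)
  have en: "?e \<le> ?n" using e(2) n by (rule order_trans)
  have "(\<integral>\<^sup>+x\<in>ball (0 :: real ^ 'n) R. ennreal (norm (x - 0) powr (?e - ?n)) \<partial>lborel)
    \<le> ennreal (2 powr (?n - ?e) / (1 - 2 powr - ?e) * R powr ?e) * ennreal ?V"
    using e(1) en R by (intro nn_integral_riesz_ball)
      (auto simp: emeasure_ball_vec simp flip: ennreal_mult)
  also have "\<dots> = ennreal (2 powr (?n - ?e) / (1 - 2 powr - ?e) * R powr ?e * ?V)"
  proof -
    have "2 powr - ?e \<le> (2::real) powr 0" using e by (intro powr_mono) auto
    then show ?thesis by (intro ennreal_mult[symmetric] mult_nonneg_nonneg divide_nonneg_nonneg) auto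
  qed
  also have "\<dots> \<le> ennreal (mass_const TYPE('n) * J * R powr ?e)"
  proof (intro ennreal_leI)
    have "2 powr (?n - ?e) / (1 - 2 powr - ?e) \<le> 2 powr ?n / (1 / (2 * real J))"
      using one_minus_two_powr_ge[OF J] e J by (intro frac_le powr_mono) auto
    then have "2 powr (?n - ?e) / (1 - 2 powr - ?e) * (R powr ?e * ?V) \<le> 2 powr ?n / (1 / (2 * real J)) * (R powr ?e * ?V)"
      by (rule mult_right_mono) simp
    then show "2 powr (?n - ?e) / (1 - 2 powr - ?e) * R powr ?e * ?V \<le> mass_const TYPE('n) * J * R powr ?e"
      by (simp add: mass_const_def ac_simps)
  qed
  finally show ?thesis by simp
qed

definition shell :: "nat \<Rightarrow> (real ^ 'n) set" where
  "shell j = ball 0 ((1/2) ^ j) - ball 0 ((1/2) ^ Suc j)"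

lemma shell_measurable [measurable]: "shell j \<in> sets borel"
  by (simp add: shell_def)

lemma mem_shell: "y \<in> shell j \<longleftrightarrow> (1/2) ^ Suc j \<le> norm y \<and> norm y < (1/2) ^ j"
  by (auto simp: shell_def)

text \<open>
  Each annulus has volume comparable to 2^(-jn), so a function of size 2^(jn) there has an
  integral over it that is bounded below independently of j.
\<close>
lemma shell_lower_bound:
  fixes h :: "real ^ 'n \<Rightarrow> ennreal"
  assumes [measurable]: "h \<in> borel_measurable borel"
    and F: "finite F" and c: "0 \<le> c"
    and h: "\<And>j y. j \<in> F \<Longrightarrow> y \<in> shell j \<Longrightarrow> ennreal (c * (2 ^ j) ^ CARD('n)) \<le> h y"
    and S: "\<And>j. j \<in> F \<Longrightarrow> shell j \<subseteq> S"
  shows "ennreal (card F * (c * unit_ball_vol (real CARD('n)) / 2)) \<le> (\<integral>\<^sup>+x\<in>S. h x \<partial>lborel)"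
proof -
  let ?V = "unit_ball_vol (real CARD('n))" and ?n = "CARD('n)"
  have vol: "ennreal (?V / 2 * ((1/2) ^ j) ^ ?n) \<le> emeasure lborel (shell j :: (real ^ 'n) set)" for j
  proof -
    have "emeasure lborel (shell j :: (real ^ 'n) set)
      = emeasure lborel (ball (0 :: real ^ 'n) ((1/2) ^ j)) - emeasure lborel (ball (0 :: real ^ 'n) ((1/2) ^ Suc j))"
      unfolding shell_def
    proof (rule emeasure_Diff)
      show "ball 0 ((1/2) ^ Suc j) \<subseteq> ball (0 :: real ^ 'n) ((1/2) ^ j)"
        by (intro subset_ball power_decreasing) auto
    qed (auto simp: emeasure_ball_vec)
    also have "\<dots> = ennreal (?V * ((1/2) ^ j) ^ ?n - ?V * ((1/2) ^ Suc j) ^ ?n)"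
      by (simp add: emeasure_ball_vec ennreal_minus del: power_Suc)
    finally have *: "emeasure lborel (shell j :: (real ^ 'n) set) = \<dots>" .
    have "((1/2::real) ^ Suc j) ^ ?n = (1/2) ^ ?n * ((1/2) ^ j) ^ ?n"
      by (simp only: power_Suc power_mult_distrib)
    moreover have "(1/2::real) ^ ?n \<le> (1/2) ^ 1" by (intro power_decreasing) (auto simp: Suc_leI)
    ultimately have "((1/2::real) ^ Suc j) ^ ?n \<le> 1/2 * ((1/2) ^ j) ^ ?n"
      by (simp add: mult_right_mono)
    then have "?V * ((1/2) ^ Suc j) ^ ?n \<le> ?V * (1/2 * ((1/2) ^ j) ^ ?n)" by (rule mult_left_mono) simp
    then show ?thesis unfolding * by (intro ennreal_leI) (simp del: power_Suc)
  qed
  have disj: "disjoint_family_on (shell :: nat \<Rightarrow> (real ^ 'n) set) F"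
  proof -
    have "(shell i :: (real ^ 'n) set) \<inter> shell j = {}" if "i < j" for i j
    proof -
      have "(1/2::real) ^ j \<le> (1/2) ^ Suc i" using that by (intro power_decreasing) auto
      moreover have "(1/2) ^ Suc i \<le> norm x \<and> norm x < (1/2) ^ j" if "x \<in> shell i \<inter> shell j" for x :: "real ^ 'n"
        using that unfolding Int_iff mem_shell by blast
      ultimately show ?thesis by (meson disjoint_iff IntI less_le_trans not_less)
    qed
    note less = this
    show ?thesis unfolding disjoint_family_on_def
    proof (intro ballI impI)
      fix i j :: nat assume "i \<noteq> j"
      then consider "i < j" | "j < i" by linarith
      then show "(shell i :: (real ^ 'n) set) \<inter> shell j = {}"
        using less[of i j] less[of j i] by cases auto
    qed
  qed
  have "ennreal (card F * (c * ?V / 2)) = (\<Sum>j\<in>F. ennreal (c * ?V / 2))"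
  proof -
    have "ennreal (card F * (c * ?V / 2)) = ennreal (card F) * ennreal (c * ?V / 2)"
      using c by (intro ennreal_mult) auto
    then show ?thesis by (simp only: sum_constant ennreal_of_nat_eq_real_of_nat)
  qed
  also have "\<dots> \<le> (\<Sum>j\<in>F. \<integral>\<^sup>+x\<in>shell j. h x \<partial>lborel)"
  proof (intro sum_mono)
    fix j assume j: "j \<in> F"
    have "c * ?V / 2 = c * (2 ^ j) ^ ?n * (?V / 2 * ((1/2) ^ j) ^ ?n)"
    proof -
      have "((2::real) ^ j) ^ ?n * ((1/2) ^ j) ^ ?n = 1"
        by (simp add: power_one_over)
      then show ?thesis by (simp add: ac_simps)
    qed
    moreover have "ennreal (c * (2 ^ j) ^ ?n * (?V / 2 * ((1/2) ^ j) ^ ?n))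
        = ennreal (c * (2 ^ j) ^ ?n) * ennreal (?V / 2 * ((1/2) ^ j) ^ ?n)"
      using c by (intro ennreal_mult) auto
    ultimately have "ennreal (c * ?V / 2) = ennreal (c * (2 ^ j) ^ ?n) * ennreal (?V / 2 * ((1/2) ^ j) ^ ?n)"
      by (simp only:)
    also have "\<dots> \<le> ennreal (c * (2 ^ j) ^ ?n) * emeasure lborel (shell j :: (real ^ 'n) set)"
      using vol by (intro mult_left_mono) auto
    also have "\<dots> = (\<integral>\<^sup>+x\<in>(shell j :: (real ^ 'n) set). ennreal (c * (2 ^ j) ^ ?n) \<partial>lborel)"
      by (simp add: nn_integral_cmult_indicator)
    also have "\<dots> \<le> (\<integral>\<^sup>+x\<in>shell j. h x \<partial>lborel)"
      using h[OF j] by (intro nn_integral_mono) (auto simp: indicator_def)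
    finally show "ennreal (c * ?V / 2) \<le> (\<integral>\<^sup>+x\<in>shell j. h x \<partial>lborel)" .
  qed
  also have "\<dots> = (\<Sum>j\<in>F. emeasure (density lborel h) (shell j))"
    by (simp add: emeasure_density)
  also have "\<dots> = emeasure (density lborel h) (\<Union>j\<in>F. shell j)"
    using F disj by (intro sum_emeasure) auto
  also have "\<dots> = (\<integral>\<^sup>+x\<in>(\<Union>j\<in>F. shell j). h x \<partial>lborel)"
    using F by (intro emeasure_density) auto
  also have "\<dots> \<le> (\<integral>\<^sup>+x\<in>S. h x \<partial>lborel)"
    using S by (intro nn_integral_mono) (auto simp: indicator_def)
  finally show ?thesis .
qed

text \<open>
  The q-th power of this weight is |x|^(1/J - n).
\<close>
definition power_weight :: "real \<Rightarrow> nat \<Rightarrow> real ^ 'n \<Rightarrow> real" where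
  "power_weight q J x = norm x powr ((1 / J - real CARD('n)) / q)"

definition power_fun :: "real \<Rightarrow> nat \<Rightarrow> real ^ 'n \<Rightarrow> real" where
  "power_fun \<alpha> J y = norm y powr (1 / J - \<alpha>) * indicator (ball 0 1) y"

lemma power_weight_measurable [measurable]: "power_weight q J \<in> borel_measurable borel"
  unfolding power_weight_def by measurable

lemma power_fun_measurable [measurable]: "power_fun \<alpha> J \<in> borel_measurable borel"
proof -
  have "indicator (ball (0::real ^ 'n) 1) \<in> borel_measurable borel" by (intro borel_measurable_indicator) simp
  then show ?thesis unfolding power_fun_def by measurable
qed

lemma ennpowr_power_weight:
  fixes x :: "real ^ 'n"
  assumes "x \<noteq> 0"
  shows "ennpowr (ennreal (power_weight q J x)) r = ennreal (norm x powr ((1 / J - real CARD('n)) / q * r))"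
  using assms by (simp add: power_weight_def ennpowr_ennreal powr_powr)

lemma AE_nonzero: "AE x in lborel. x \<noteq> (0 :: real ^ 'n)"
  by (rule AE_lborel_singleton)

definition cube_const :: "'n::finite itself \<Rightarrow> real" where
  "cube_const _ = 3 powr real CARD('n) + 2 * mass_const TYPE('n) * (3 * real CARD('n)) ^ CARD('n)"

text \<open>
  Compare the diameter of Q with its distance from the origin. Far from the origin |x| is
  comparable to R on Q; near it, Q fills a fixed proportion of the ball of radius R, whose mass
  is at most a multiple of J R^(1/J).
\<close>
lemma power_weight_average_le:
  fixes Q :: "(real ^ 'n) set" and J :: nat
  assumes J: "0 < J" and Q: "Q \<in> cubes"
  obtains R where "0 < R" "\<And>x. x \<in> Q \<Longrightarrow> norm x \<le> R"
    "(\<integral>\<^sup>+x\<in>Q. ennreal (norm x powr (1 / J - real CARD('n))) \<partial>lborel) / emeasure lborel Q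
      \<le> ennreal (cube_const TYPE('n) * J * R powr (1 / J - real CARD('n)))"
proof -
  let ?n = "real CARD('n)" and ?e = "1 / real J"
  have e: "0 < ?e" "?e \<le> 1" using J by auto
  have n: "1 \<le> ?n" by (simp add: Suc_leI)
  have en: "?e \<le> ?n" using e(2) n by (rule order_trans)
  have J1: "1 \<le> real J" using J by simp
  obtain a s where as: "Q = cbox a (\<chi> i. a $ i + s)" "0 < s" using Q by (auto simp: cubes_def)
  have vol: "emeasure lborel Q = ennreal (s ^ CARD('n))" using as by (simp add: emeasure_cube)
  have near: "norm (x - a) \<le> ?n * s" if "x \<in> Q" for x
  proof -
    have "norm (x - a) \<le> (\<Sum>i\<in>UNIV. \<bar>(x - a) $ i\<bar>)" by (rule norm_le_l1_cart)
    also have "\<dots> \<le> (\<Sum>i\<in>(UNIV :: 'n set). s)"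
    proof (intro sum_mono)
      fix i
      have "a $ i \<le> x $ i" "x $ i \<le> a $ i + s" using that unfolding as mem_box_cart by auto
      then show "\<bar>(x - a) $ i\<bar> \<le> s" by (simp add: abs_le_iff)
    qed
    finally show ?thesis by simp
  qed
  define R where "R = norm a + ?n * s"
  have R: "0 < R" using as n by (simp add: R_def add_nonneg_pos)
  have upper: "norm x \<le> R" if "x \<in> Q" for x
    using near[OF that] norm_triangle_ineq2[of x a] by (simp add: R_def)
  have mc: "0 \<le> mass_const TYPE('n)" using mass_const_pos[where 'n='n] by simp
  have "(\<integral>\<^sup>+x\<in>Q. ennreal (norm x powr (?e - ?n)) \<partial>lborel)
      \<le> ennreal (cube_const TYPE('n) * J * R powr (?e - ?n)) * emeasure lborel Q"
  proof (cases "2 * (?n * s) \<le> norm a")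
    case True
    have "(\<integral>\<^sup>+x\<in>Q. ennreal (norm x powr (?e - ?n)) \<partial>lborel) \<le> (\<integral>\<^sup>+x\<in>Q. ennreal ((R / 3) powr (?e - ?n)) \<partial>lborel)"
    proof (intro nn_integral_mono)
      fix x
      have "norm x powr (?e - ?n) \<le> (R / 3) powr (?e - ?n)" if "x \<in> Q"
      proof (rule powr_mono2')
        have "norm a - ?n * s \<le> norm x"
          using near[OF that] norm_triangle_ineq2[of a x] by (simp add: norm_minus_commute)
        moreover have "R / 3 \<le> norm a - ?n * s"
        proof -
          have "(b + m) / 3 \<le> b - m" if "2 * m \<le> b" for b m :: real using that by simp
          from this[OF True] show ?thesis by (simp only: R_def)
        qed
        ultimately show "R / 3 \<le> norm x" by linarith
      qed (use en R in auto)
      then show "ennreal (norm x powr (?e - ?n)) * indicator Q x \<le> ennreal ((R / 3) powr (?e - ?n)) * indicator Q x"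
        by (auto simp: indicator_def ennreal_leI)
    qed
    also have "\<dots> = ennreal ((R / 3) powr (?e - ?n)) * emeasure lborel Q"
      using as by (simp add: nn_integral_cmult_indicator)
    also have "\<dots> \<le> ennreal (cube_const TYPE('n) * J * R powr (?e - ?n)) * emeasure lborel Q"
    proof (intro mult_right_mono ennreal_leI)
      have "(R / 3) powr (?e - ?n) = 3 powr (?n - ?e) * R powr (?e - ?n)"
        using R by (simp add: powr_divide powr_diff)
      also have "\<dots> \<le> 3 powr ?n * R powr (?e - ?n)" using e by (intro mult_right_mono powr_mono) auto
      also have "\<dots> \<le> cube_const TYPE('n) * J * R powr (?e - ?n)"
      proof (intro mult_right_mono)
        have "3 powr ?n \<le> cube_const TYPE('n)" using mc by (simp add: cube_const_def)
        also have "\<dots> \<le> cube_const TYPE('n) * J"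
        proof -
          have "0 \<le> cube_const TYPE('n)" using mc by (simp add: cube_const_def)
          from mult_left_mono[OF J1 this] show ?thesis by simp
        qed
        finally show "3 powr ?n \<le> cube_const TYPE('n) * J" .
      qed simp
      finally show "(R / 3) powr (?e - ?n) \<le> cube_const TYPE('n) * J * R powr (?e - ?n)" .
    qed simp
    finally show ?thesis .
  next
    case False
    have Rs: "R \<le> 3 * (?n * s)"
    proof -
      have "b + m \<le> 3 * m" if "\<not> 2 * m \<le> b" for b m :: real using that by simp
      from this[OF False] show ?thesis by (simp only: R_def)
    qed
    have "(\<integral>\<^sup>+x\<in>Q. ennreal (norm x powr (?e - ?n)) \<partial>lborel) \<le> (\<integral>\<^sup>+x\<in>ball (0 :: real ^ 'n) (2 * R). ennreal (norm x powr (?e - ?n)) \<partial>lborel)"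
    proof (intro nn_integral_mono mult_left_mono)
      fix x :: "real ^ 'n"
      show "indicator Q x \<le> (indicator (ball 0 (2 * R)) x :: ennreal)"
        using upper[of x] R by (auto simp: indicator_def)
    qed simp
    also have "\<dots> \<le> ennreal (mass_const TYPE('n) * J * (2 * R) powr ?e)"
      using J R by (intro nn_integral_power_weight_ball_le) auto
    also have "\<dots> \<le> ennreal (cube_const TYPE('n) * J * R powr (?e - ?n) * s ^ CARD('n))"
    proof (intro ennreal_leI)
      have "R powr ?n = R ^ CARD('n)" using R by (rule powr_realpow)
      also have "\<dots> \<le> (3 * (?n * s)) ^ CARD('n)" using Rs R by (intro power_mono) auto
      also have "\<dots> = (3 * ?n) ^ CARD('n) * s ^ CARD('n)" by (simp only: power_mult_distrib mult.assoc)
      finally have pw: "R powr ?n \<le> (3 * ?n) ^ CARD('n) * s ^ CARD('n)" .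
      have "(2::real) powr ?e \<le> 2 powr 1" using e by (intro powr_mono) auto
      then have "2 powr ?e * R powr ?e \<le> 2 * R powr ?e" by (intro mult_right_mono) auto
      then have "(2 * R) powr ?e \<le> 2 * R powr ?e" using R by (simp only: powr_mult)
      also have "R powr ?e = R powr (?e - ?n) * R powr ?n" by (subst powr_add[symmetric]) simp
      also have "2 * (R powr (?e - ?n) * R powr ?n) \<le> 2 * (R powr (?e - ?n) * ((3 * ?n) ^ CARD('n) * s ^ CARD('n)))"
        using pw by (intro mult_left_mono) auto
      finally have "mass_const TYPE('n) * J * (2 * R) powr ?e
        \<le> mass_const TYPE('n) * J * (2 * (R powr (?e - ?n) * ((3 * ?n) ^ CARD('n) * s ^ CARD('n))))"
        using mc by (intro mult_left_mono) auto
      also have "\<dots> = (2 * mass_const TYPE('n) * (3 * ?n) ^ CARD('n)) * (J * R powr (?e - ?n) * s ^ CARD('n))"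
        by (simp only: ac_simps)
      also have "\<dots> \<le> cube_const TYPE('n) * (J * R powr (?e - ?n) * s ^ CARD('n))"
      proof (rule mult_right_mono)
        show "2 * mass_const TYPE('n) * (3 * ?n) ^ CARD('n) \<le> cube_const TYPE('n)" by (simp add: cube_const_def)
        show "0 \<le> J * R powr (?e - ?n) * s ^ CARD('n)" using as by simp
      qed
      finally show "mass_const TYPE('n) * J * (2 * R) powr ?e \<le> cube_const TYPE('n) * J * R powr (?e - ?n) * s ^ CARD('n)"
        by (simp only: ac_simps)
    qed
    also have "\<dots> = ennreal (cube_const TYPE('n) * J * R powr (?e - ?n)) * emeasure lborel Q"
      unfolding vol
    proof (rule ennreal_mult)
      show "0 \<le> cube_const TYPE('n) * J * R powr (?e - ?n)" using mc by (simp add: cube_const_def)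
    qed (use as in simp)
    finally show ?thesis .
  qed
  then have "(\<integral>\<^sup>+x\<in>Q. ennreal (norm x powr (?e - ?n)) \<partial>lborel) / emeasure lborel Q
      \<le> ennreal (cube_const TYPE('n) * J * R powr (?e - ?n)) * emeasure lborel Q / emeasure lborel Q"
    by (rule divide_right_mono_ennreal)
  also have "\<dots> \<le> ennreal (cube_const TYPE('n) * J * R powr (?e - ?n))" by (rule ennreal_divide_self_le)
  finally show ?thesis using that[OF R upper] by simp
qed

text \<open>
  The weight u = w^q is an A_1 weight: its averages are at most a multiple of J times its lower
  bound R^(1/J - n) on Q. For p > 1 the same R bounds \<sigma> from above, and the powers of R
  cancel.
\<close>
lemma power_weight_const:
  fixes J :: nat
  assumes J: "0 < J" and p: "1 \<le> p" and q: "0 < q"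
  shows "Apq_const p q (power_weight q J :: real ^ 'n \<Rightarrow> real) \<le> ennreal (cube_const TYPE('n) * J)"
proof -
  let ?n = "real CARD('n)" and ?e = "1 / real J" and ?w = "power_weight q J :: real ^ 'n \<Rightarrow> real"
  have "?e \<le> 1" using J by auto
  moreover have "1 \<le> ?n" by (simp add: Suc_leI)
  ultimately have en: "?e \<le> ?n" by (rule order_trans)
  have cc: "0 \<le> cube_const TYPE('n) * J"
    using mass_const_pos[where 'n='n] by (simp add: cube_const_def)
  have u: "average Q (\<lambda>x. ennpowr (ennreal (?w x)) q)
      = (\<integral>\<^sup>+x\<in>Q. ennreal (norm x powr (?e - ?n)) \<partial>lborel) / emeasure lborel Q"
    if Q: "Q \<in> cubes" for Q
  proof -
    have "(\<integral>\<^sup>+x\<in>Q. ennpowr (ennreal (?w x)) q \<partial>lborel) = (\<integral>\<^sup>+x\<in>Q. ennreal (norm x powr (?e - ?n)) \<partial>lborel)"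
      using AE_nonzero q by (intro nn_integral_cong_AE) (auto elim!: eventually_mono simp: ennpowr_power_weight)
    then show ?thesis by (simp add: average_lborel Q)
  qed
  show ?thesis
  proof (cases "p = 1")
    case True
    have "average Q (\<lambda>x. ennpowr (ennreal (?w x)) q)
      \<le> ennreal (cube_const TYPE('n) * J) * ess_inf_on Q (\<lambda>x. ennpowr (ennreal (?w x)) q)"
      if Q: "Q \<in> cubes" for Q
    proof -
      obtain R where R: "0 < R" "\<And>x. x \<in> Q \<Longrightarrow> norm x \<le> R"
        "(\<integral>\<^sup>+x\<in>Q. ennreal (norm x powr (?e - ?n)) \<partial>lborel) / emeasure lborel Q
          \<le> ennreal (cube_const TYPE('n) * J * R powr (?e - ?n))"
        using power_weight_average_le[OF J Q] by blast
      have "ennreal (R powr (?e - ?n)) \<le> ess_inf_on Q (\<lambda>x. ennpowr (ennreal (?w x)) q)"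
        unfolding ess_inf_on_def
      proof (intro Sup_upper CollectI)
        show "AE x in lebesgue. x \<in> Q \<longrightarrow> ennreal (R powr (?e - ?n)) \<le> ennpowr (ennreal (?w x)) q"
          unfolding AE_completion_iff using AE_nonzero
        proof eventually_elim
          case (elim x)
          then show ?case using R(2)[of x] en q
            by (auto simp: ennpowr_power_weight intro!: ennreal_leI powr_mono2')
        qed
      qed
      then have "ennreal (cube_const TYPE('n) * J) * ennreal (R powr (?e - ?n))
        \<le> ennreal (cube_const TYPE('n) * J) * ess_inf_on Q (\<lambda>x. ennpowr (ennreal (?w x)) q)"
        by (rule mult_left_mono) simp
      with R(3) cc show ?thesis unfolding u[OF Q] by (simp add: ennreal_mult)
    qed
    then show ?thesis using True by (auto simp: Apq_const_def intro: Inf_lower)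
  next
    case False
    let ?p = "conj_exponent p"
    have p': "0 < ?p" using conj_exponent_conjugate[of p] p False by simp
    have "average Q (\<lambda>x. ennpowr (ennreal (?w x)) q) * ennpowr (average Q (\<lambda>x. ennpowr (ennreal (?w x)) (- ?p))) (q / ?p)
      \<le> ennreal (cube_const TYPE('n) * J)" if Q: "Q \<in> cubes" for Q
    proof -
      obtain R where R: "0 < R" "\<And>x. x \<in> Q \<Longrightarrow> norm x \<le> R"
        "(\<integral>\<^sup>+x\<in>Q. ennreal (norm x powr (?e - ?n)) \<partial>lborel) / emeasure lborel Q
          \<le> ennreal (cube_const TYPE('n) * J * R powr (?e - ?n))"
        using power_weight_average_le[OF J Q] by blast
      define b where "b = (?n - ?e) / q * ?p"
      have b: "0 \<le> b" using en q p' by (simp add: b_def)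
      have "(\<integral>\<^sup>+x\<in>Q. ennpowr (ennreal (?w x)) (- ?p) \<partial>lborel) \<le> (\<integral>\<^sup>+x\<in>Q. ennreal (R powr b) \<partial>lborel)"
      proof (intro nn_integral_mono_AE)
        show "AE x in lborel. ennpowr (ennreal (?w x)) (- ?p) * indicator Q x \<le> ennreal (R powr b) * indicator Q x"
          using AE_nonzero
        proof eventually_elim
          case (elim x)
          have "(?e - ?n) / q * - ?p = b" by (simp add: b_def left_diff_distrib diff_divide_distrib)
          then have "ennpowr (ennreal (?w x)) (- ?p) = ennreal (norm x powr b)"
            using ennpowr_power_weight[OF elim, of q J "- ?p"] by (simp only:)
          then show ?case using R(2)[of x] b
            by (auto simp: indicator_def intro!: ennreal_leI powr_mono2)
        qed
      qed
      also have "\<dots> = ennreal (R powr b) * emeasure lborel Q"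
        using cube_emeasure(1)[OF Q] by (simp add: nn_integral_cmult_indicator)
      finally have "average Q (\<lambda>x. ennpowr (ennreal (?w x)) (- ?p)) \<le> ennreal (R powr b) * emeasure lborel Q / emeasure lborel Q"
        unfolding average_lborel[OF Q] by (rule divide_right_mono_ennreal)
      also have "\<dots> \<le> ennreal (R powr b)" by (rule ennreal_divide_self_le)
      finally have "ennpowr (average Q (\<lambda>x. ennpowr (ennreal (?w x)) (- ?p))) (q / ?p) \<le> ennpowr (ennreal (R powr b)) (q / ?p)"
        using q p' by (intro ennpowr_mono) auto
      also have "\<dots> = ennreal (R powr (?n - ?e))"
        using R(1) q p' by (simp add: ennpowr_ennreal powr_powr b_def)
      finally have "average Q (\<lambda>x. ennpowr (ennreal (?w x)) q) * ennpowr (average Q (\<lambda>x. ennpowr (ennreal (?w x)) (- ?p))) (q / ?p)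
        \<le> ennreal (cube_const TYPE('n) * J * R powr (?e - ?n)) * ennreal (R powr (?n - ?e))"
        using R(3) unfolding u[OF Q] by (intro mult_mono) auto
      also have "\<dots> = ennreal (cube_const TYPE('n) * J * (R powr (?e - ?n) * R powr (?n - ?e)))"
        unfolding mult.assoc[of "cube_const TYPE('n) * J", symmetric]
        using cc by (intro ennreal_mult[symmetric]) auto
      also have "R powr (?e - ?n) * R powr (?n - ?e) = 1" using R by (simp add: powr_add[symmetric])
      finally show ?thesis by simp
    qed
    then show ?thesis using False by (auto simp: Apq_const_def intro: SUP_least)
  qed
qed

section \<open>Sharpness of the exponent\<close>

text \<open>
  Since q \<ge> 1, w is at most 1 + w^q, which has finite mass on balls.
\<close>
lemma weight_power_weight:
  assumes J: "0 < J" and q: "1 \<le> q"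
  shows "weight (power_weight q J :: real ^ 'n \<Rightarrow> real)"
  unfolding weight_def set_integrable_def
proof (intro conjI allI impI)
  let ?n = "real CARD('n)" and ?e = "1 / real J" and ?w = "power_weight q J :: real ^ 'n \<Rightarrow> real"
  show "0 \<le> ?w x" for x by (simp add: power_weight_def)
  have "?e \<le> 1" using J by auto
  moreover have "1 \<le> ?n" by (simp add: Suc_leI)
  ultimately have en: "?e \<le> ?n" by (rule order_trans)
  have le: "?w x \<le> 1 + norm x powr (?e - ?n)" for x
  proof (cases "1 \<le> norm x")
    case True
    then have "norm x powr ((?e - ?n) / q) \<le> 1 powr ((?e - ?n) / q)"
      using en q by (intro powr_mono2') (auto simp: divide_nonpos_pos)
    then show ?thesis by (simp add: power_weight_def add_increasing2)
  next
    case False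
    have "(?n - ?e) / q \<le> (?n - ?e) / 1" using en q by (intro divide_left_mono) auto
    then have "(?e - ?n) / q \<ge> (?e - ?n)" using minus_divide_left[of "?n - ?e" q] by simp
    then have "norm x powr ((?e - ?n) / q) \<le> norm x powr (?e - ?n)"
      using False by (intro powr_mono') auto
    then show ?thesis by (simp add: power_weight_def)
  qed
  fix K :: "(real ^ 'n) set" assume K: "compact K"
  then obtain R where R: "0 < R" "K \<subseteq> ball 0 R"
    using bounded_subset_ballD[of K 0] compact_imp_bounded by blast
  have [measurable]: "K \<in> sets borel" using K by (simp add: compact_imp_closed)
  show "integrable lebesgue (\<lambda>x. indicat_real K x *\<^sub>R ?w x)"
  proof (rule integrableI_bounded)
    have "(\<lambda>x. indicat_real K x *\<^sub>R ?w x) \<in> borel_measurable lborel" by measurable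
    then show "(\<lambda>x. indicat_real K x *\<^sub>R ?w x) \<in> borel_measurable lebesgue" by (rule measurable_completion)
    have "(\<integral>\<^sup>+x. ennreal (norm (indicat_real K x *\<^sub>R ?w x)) \<partial>lebesgue)
      = (\<integral>\<^sup>+x. ennreal (norm (indicat_real K x *\<^sub>R ?w x)) \<partial>lborel)"
      by (rule nn_integral_completion)
    also have "\<dots> \<le> (\<integral>\<^sup>+x. indicator (ball 0 R) x + ennreal (norm x powr (?e - ?n)) * indicator (ball (0 :: real ^ 'n) R) x \<partial>lborel)"
    proof (intro nn_integral_mono)
      fix x :: "real ^ 'n"
      have "ennreal (?w x) \<le> ennreal (1 + norm x powr (?e - ?n))" using le by (rule ennreal_leI)
      then have "ennreal (?w x) \<le> 1 + ennreal (norm x powr (?e - ?n))" by (subst (asm) ennreal_plus) auto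
      moreover have "0 \<le> ?w x" by (simp add: power_weight_def)
      ultimately show "ennreal (norm (indicat_real K x *\<^sub>R ?w x))
        \<le> indicator (ball 0 R) x + ennreal (norm x powr (?e - ?n)) * indicator (ball 0 R) x"
        using R(2) by (auto simp: indicator_def)
    qed
    also have "\<dots> = emeasure lborel (ball (0 :: real ^ 'n) R)
       + (\<integral>\<^sup>+x\<in>ball (0 :: real ^ 'n) R. ennreal (norm x powr (?e - ?n)) \<partial>lborel)"
      by (subst nn_integral_add) (auto intro!: borel_measurable_times_ennreal borel_measurable_indicator)
    also have "\<dots> \<le> ennreal (unit_ball_vol ?n * R ^ CARD('n)) + ennreal (mass_const TYPE('n) * J * R powr ?e)"
      using J R by (intro add_mono nn_integral_power_weight_ball_le) (auto simp: emeasure_ball_vec)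
    also have "\<dots> < \<infinity>" by simp
    finally show "(\<integral>\<^sup>+x. ennreal (norm (indicat_real K x *\<^sub>R ?w x)) \<partial>lebesgue) < \<infinity>" .
  qed
qed

text \<open>
  By the relation between p and q, |w f|^p is a power of |x| on the unit ball, with an exponent
  that is at least 1/J - n.
\<close>
lemma power_fun_norm_le:
  fixes \<alpha> p q :: real and J :: nat
  assumes J: "0 < J" and p: "1 \<le> p" and q: "0 < q" "1 / q = 1 / p - \<alpha> / real CARD('n)"
  shows "Lp_norm p (\<lambda>x :: real ^ 'n. power_weight q J x *\<^sub>R complex_of_real (power_fun \<alpha> J x))
    \<le> ennreal ((mass_const TYPE('n) * J) powr (1 / p))"
proof -
  let ?n = "real CARD('n)" and ?e = "1 / real J"
  let ?g = "\<lambda>x :: real ^ 'n. power_weight q J x *\<^sub>R complex_of_real (power_fun \<alpha> J x)"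
  define k where "k = ((?e - ?n) / q + (?e - \<alpha>)) * p"
  have "?n * p * (1 / q) = ?n * p * (1 / p - \<alpha> / ?n)" using q(2) by simp
  also have "\<dots> = ?n - \<alpha> * p" using p by (simp add: field_simps)
  finally have npq: "?n * p / q = ?n - \<alpha> * p" by simp
  have k: "?e - ?n \<le> k"
  proof -
    have "k = ?e * p / q - ?n * p / q + ?e * p - \<alpha> * p"
      by (simp add: k_def algebra_simps diff_divide_distrib)
    also have "\<dots> = ?e * (p / q) + ?e * p - ?n" unfolding npq by simp
    finally have "k = ?e * (p / q) + ?e * p - ?n" .
    moreover have "0 \<le> ?e * (p / q)" using p q by simp
    moreover have "?e * 1 \<le> ?e * p" using p by (intro mult_left_mono) auto
    ultimately show ?thesis by linarith
  qed
  have "(\<integral>\<^sup>+x. ennpowr (ennreal (norm (?g x))) p \<partial>lborel)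
    \<le> (\<integral>\<^sup>+x\<in>ball (0 :: real ^ 'n) 1. ennreal (norm x powr (?e - ?n)) \<partial>lborel)"
  proof (intro nn_integral_mono_AE)
    show "AE x in lborel. ennpowr (ennreal (norm (?g x))) p
      \<le> ennreal (norm x powr (?e - ?n)) * indicator (ball (0 :: real ^ 'n) 1) x"
      using AE_nonzero
    proof eventually_elim
      case (elim x)
      show ?case
      proof (cases "x \<in> ball 0 1")
        case True
        have "norm (?g x) = norm x powr ((?e - ?n) / q) * norm x powr (?e - \<alpha>)"
          using True by (simp add: power_weight_def power_fun_def norm_mult)
        also have "\<dots> = norm x powr ((?e - ?n) / q + (?e - \<alpha>))" by (simp add: powr_add)
        finally have "ennpowr (ennreal (norm (?g x))) p = ennreal (norm x powr k)"
          using elim by (simp only: k_def powr_powr[symmetric]) (simp add: ennpowr_ennreal)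
        also have "\<dots> \<le> ennreal (norm x powr (?e - ?n))"
          using k True by (intro ennreal_leI powr_mono') auto
        finally show ?thesis using True by simp
      next
        case False
        then show ?thesis using p by (simp add: power_fun_def)
      qed
    qed
  qed
  also have "\<dots> \<le> ennreal (mass_const TYPE('n) * J)"
    using nn_integral_power_weight_ball_le[OF J, of 1, where 'n = 'n] by simp
  finally have "Lp_norm p ?g \<le> ennpowr (ennreal (mass_const TYPE('n) * J)) (1 / p)"
    unfolding Lp_norm_def nn_integral_completion using p by (intro ennpowr_mono) auto
  then show ?thesis using J mass_const_pos[where 'n = 'n] by (simp add: ennpowr_ennreal)
qed

text \<open>
  For a nonnegative function there is no cancellation.
\<close>
lemma riesz_pot_le_fractional_integral_abs:
  fixes h :: "real ^ 'n \<Rightarrow> real"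
  assumes h: "\<And>y. 0 \<le> h y"
  shows "riesz_pot \<alpha> (\<lambda>y. ennreal (h y)) x \<le> fractional_integral_abs \<alpha> (\<lambda>y. complex_of_real (h y)) x"
proof (cases "integrable lebesgue (riesz_integrand \<alpha> (\<lambda>y. complex_of_real (h y)) x)")
  case True
  let ?k = "\<lambda>y. h y / norm (x - y) powr (real CARD('n) - \<alpha>)"
  have eq: "riesz_integrand \<alpha> (\<lambda>y. complex_of_real (h y)) x = (\<lambda>y. complex_of_real (?k y))"
    by (intro ext) (simp add: riesz_integrand_def scaleR_conv_of_real field_simps)
  then have int: "integrable lebesgue ?k" using True by (simp only: complex_of_real_integrable_eq)
  have "riesz_pot \<alpha> (\<lambda>y. ennreal (h y)) x = (\<integral>\<^sup>+y. ennreal (?k y) \<partial>lebesgue)"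
    unfolding riesz_pot_def nn_integral_completion
  proof (intro nn_integral_cong)
    fix y
    have "norm (x - y) powr (\<alpha> - real CARD('n)) * h y = ?k y"
      using powr_minus_divide[of "norm (x - y)" "real CARD('n) - \<alpha>"] by simp
    then show "ennreal (norm (x - y) powr (\<alpha> - real CARD('n))) * ennreal (h y) = ennreal (?k y)"
      using h[of y] by (simp flip: ennreal_mult)
  qed
  also have "\<dots> = ennreal (\<integral>y. ?k y \<partial>lebesgue)"
    using int h by (intro nn_integral_eq_integral) auto
  also have "\<dots> \<le> ennreal (norm (fractional_integral \<alpha> (\<lambda>y. complex_of_real (h y)) x))"
    unfolding fractional_integral_def eq by (simp add: ennreal_leI del: of_real_divide)
  finally show ?thesis using True by (simp add: fractional_integral_abs_def)
qed (simp add: fractional_integral_abs_def)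

lemma half_power_powr: "((1/2::real) ^ j) powr (1 / real J) = (1/2) powr (real j / real J)"
  by (simp add: powr_realpow[symmetric] powr_powr)

text \<open>
  On the annuli with j < m J the factor |y|^(1/J) is at least 2^(-m), so that |y|^(1/J - b)
  behaves like the homogeneous function |y|^(-b) on all of them.
\<close>
lemma power_shell_lower:
  fixes y :: "real ^ 'n"
  assumes y: "y \<in> shell j" and J: "0 < J" and j: "Suc j \<le> m * J" and b: "0 \<le> b"
  shows "(1/2) ^ m * ((1/2) ^ j) powr - b \<le> norm y powr (1 / J - b)"
proof -
  have y': "(1/2) ^ Suc j \<le> norm y" "norm y < (1/2) ^ j" using y by (auto simp: mem_shell)
  have pos: "0 < norm y" using y'(1) by (rule less_le_trans[rotated]) simp
  have "(1/2::real) ^ m = (1/2) powr real m" by (simp add: powr_realpow)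
  also have "\<dots> \<le> (1/2) powr (real (Suc j) / real J)"
    using J j by (intro powr_mono') (auto simp: field_simps simp flip: of_nat_mult)
  also have "\<dots> = ((1/2) ^ Suc j) powr (1 / real J)" by (simp only: half_power_powr)
  also have "\<dots> \<le> norm y powr (1 / J)" using y' by (intro powr_mono2) auto
  finally have 1: "(1/2) ^ m \<le> norm y powr (1 / J)" .
  have 2: "((1/2) ^ j) powr - b \<le> norm y powr - b"
    using y' pos b by (intro powr_mono2') auto
  have "norm y powr (1 / J - b) = norm y powr (1 / J) * norm y powr - b"
    using powr_add[of "norm y" "1 / J" "- b"] by simp
  with 1 2 show ?thesis by (simp add: mult_mono)
qed

text \<open>
  Each of the J annuli between 2^(-J) and 1 contributes a fixed amount: there |x - y| \<le> 2
  |y|, so the integrand is of size |y|^(-n).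
\<close>
lemma riesz_pot_power_fun_ge:
  fixes x :: "real ^ 'n"
  assumes J: "0 < J" and \<alpha>: "0 < \<alpha>" "\<alpha> < real CARD('n)" and x: "norm x < (1/2) ^ J"
  shows "ennreal (J * (2 powr (\<alpha> - real CARD('n)) / 2 * unit_ball_vol (real CARD('n)) / 2))
    \<le> riesz_pot \<alpha> (\<lambda>y. ennreal (power_fun \<alpha> J y)) x"
proof -
  let ?n = "real CARD('n)"
  let ?h = "\<lambda>y. ennreal (norm (x - y) powr (\<alpha> - ?n)) * ennreal (power_fun \<alpha> J y)"
  have "ennreal (card {..<J} * (2 powr (\<alpha> - ?n) / 2 * unit_ball_vol ?n / 2)) \<le> (\<integral>\<^sup>+y\<in>UNIV. ?h y \<partial>lborel)"
  proof (rule shell_lower_bound)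
    fix j and y :: "real ^ 'n" assume j: "j \<in> {..<J}" and y: "y \<in> shell j"
    have y': "(1/2) ^ Suc j \<le> norm y" "norm y < (1/2) ^ j" using y by (auto simp: mem_shell)
    have "(1/2::real) ^ J \<le> (1/2) ^ Suc j" using j by (intro power_decreasing) auto
    then have xy: "norm x < norm y" using x y' by linarith
    have "(1/2::real) ^ j \<le> 1" by (intro power_le_one) auto
    with y' have y1: "y \<in> ball 0 1" by simp
    have "norm (x - y) \<le> 2 * (1/2) ^ j" using norm_triangle_ineq4[of x y] xy y' by linarith
    moreover have "0 < norm (x - y)" using xy by auto
    ultimately have "(2 * (1/2) ^ j) powr (\<alpha> - ?n) \<le> norm (x - y) powr (\<alpha> - ?n)"
      using \<alpha> by (intro powr_mono2') auto
    then have 1: "2 powr (\<alpha> - ?n) * ((1/2) ^ j) powr (\<alpha> - ?n) \<le> norm (x - y) powr (\<alpha> - ?n)"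
      by (simp only: powr_mult)
    have 2: "(1/2) ^ 1 * ((1/2) ^ j) powr - \<alpha> \<le> power_fun \<alpha> J y"
      using power_shell_lower[OF y J, of 1 \<alpha>] j \<alpha> y1 by (simp add: power_fun_def)
    have "2 powr (\<alpha> - ?n) / 2 * (2 ^ j) ^ CARD('n)
      = (2 powr (\<alpha> - ?n) * ((1/2) ^ j) powr (\<alpha> - ?n)) * ((1/2) ^ 1 * ((1/2) ^ j) powr - \<alpha>)"
    proof -
      have "((1/2::real) ^ j) powr (\<alpha> - ?n) * ((1/2) ^ j) powr - \<alpha> = ((1/2) ^ j) powr - ?n"
        by (subst powr_add[symmetric]) simp
      also have "\<dots> = (2 ^ j) ^ CARD('n)"
        by (simp add: powr_minus powr_realpow power_one_over inverse_eq_divide power_divide)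
      finally show ?thesis by simp
    qed
    also have "\<dots> \<le> norm (x - y) powr (\<alpha> - ?n) * power_fun \<alpha> J y"
      using 1 2 by (intro mult_mono) auto
    finally have "ennreal (2 powr (\<alpha> - ?n) / 2 * (2 ^ j) ^ CARD('n)) \<le> ennreal (norm (x - y) powr (\<alpha> - ?n) * power_fun \<alpha> J y)"
      by (rule ennreal_leI)
    also have "\<dots> = ?h y" by (rule ennreal_mult) (auto simp: power_fun_def)
    finally show "ennreal (2 powr (\<alpha> - ?n) / 2 * (2 ^ j) ^ CARD('n)) \<le> ?h y" .
  qed auto
  then show ?thesis by (simp add: riesz_pot_def)
qed

text \<open>
  The J annuli between radii 2^(-2J) and 2^(-J) suffice.
\<close>
lemma power_weight_mass_ge:
  assumes J: "0 < J"
  shows "ennreal (J * (1 / 4 * unit_ball_vol (real CARD('n)) / 2))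
    \<le> (\<integral>\<^sup>+x\<in>ball (0 :: real ^ 'n) ((1/2) ^ J). ennreal (norm x powr (1 / J - real CARD('n))) \<partial>lborel)"
proof -
  let ?n = "real CARD('n)"
  have "ennreal (card {J..<2 * J} * (1 / 4 * unit_ball_vol ?n / 2))
    \<le> (\<integral>\<^sup>+x\<in>ball (0 :: real ^ 'n) ((1/2) ^ J). ennreal (norm x powr (1 / J - ?n)) \<partial>lborel)"
  proof (rule shell_lower_bound)
    fix j and y :: "real ^ 'n" assume j: "j \<in> {J..<2 * J}" and y: "y \<in> shell j"
    have "(1/2) ^ 2 * ((1/2) ^ j) powr - ?n \<le> norm y powr (1 / J - ?n)"
      using j by (intro power_shell_lower[OF y J]) auto
    moreover have "((1/2::real) ^ j) powr - ?n = (2 ^ j) ^ CARD('n)"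
      by (simp add: powr_minus powr_realpow power_one_over inverse_eq_divide power_divide)
    ultimately show "ennreal (1 / 4 * (2 ^ j) ^ CARD('n)) \<le> ennreal (norm y powr (1 / J - ?n))"
      by (intro ennreal_leI) (simp add: power2_eq_square)
  next
    fix j assume "j \<in> {J..<2 * J}"
    then have "(1/2::real) ^ j \<le> (1/2) ^ J" by (intro power_decreasing) auto
    then have "norm x < (1/2) ^ J" if "x \<in> shell j" for x :: "real ^ 'n"
      using that unfolding mem_shell by linarith
    then show "(shell j :: (real ^ 'n) set) \<subseteq> ball 0 ((1/2) ^ J)" by auto
  qed auto
  then show ?thesis by simp
qed

lemma power_fun_weak_norm_ge:
  fixes \<alpha> q :: real and J :: nat
  assumes J: "0 < J" and \<alpha>: "0 < \<alpha>" "\<alpha> < real CARD('n)" and q: "0 < q"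
  defines "V \<equiv> unit_ball_vol (real CARD('n))"
  shows "ennreal (2 powr (\<alpha> - real CARD('n)) * V / 8 * (V / 8) powr (1 / q) * J powr (1 + 1 / q))
    \<le> weak_norm q (\<lambda>x :: real ^ 'n. ennpowr (ennreal (power_weight q J x)) q)
        (fractional_integral_abs \<alpha> (\<lambda>y. complex_of_real (power_fun \<alpha> J y)))"
proof -
  let ?n = "real CARD('n)"
  let ?F = "fractional_integral_abs \<alpha> (\<lambda>y :: real ^ 'n. complex_of_real (power_fun \<alpha> J y))"
  let ?u = "\<lambda>x :: real ^ 'n. ennpowr (ennreal (power_weight q J x)) q"
  have V: "0 < V" by (simp add: V_def)
  define t where "t = J * (2 powr (\<alpha> - ?n) * V / 8)"
  have t: "0 < t" using J V by (simp add: t_def)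
  have level: "ball 0 ((1/2) ^ J) \<subseteq> {x. ennreal t < ?F x}"
  proof
    fix x :: "real ^ 'n" assume "x \<in> ball 0 ((1/2) ^ J)"
    then have x: "norm x < (1/2) ^ J" by simp
    have "t < J * (2 powr (\<alpha> - ?n) / 2 * V / 2)" using J V by (simp add: t_def)
    then have "ennreal t < ennreal (J * (2 powr (\<alpha> - ?n) / 2 * V / 2))" using t by (simp add: ennreal_less_iff)
    also have "\<dots> \<le> riesz_pot \<alpha> (\<lambda>y. ennreal (power_fun \<alpha> J y)) x"
      unfolding V_def using riesz_pot_power_fun_ge[OF J \<alpha> x] .
    also have "\<dots> \<le> ?F x" by (rule riesz_pot_le_fractional_integral_abs) (simp add: power_fun_def)
    finally show "x \<in> {x. ennreal t < ?F x}" by simp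
  qed
  have "ennreal (J * (V / 8)) \<le> (\<integral>\<^sup>+x\<in>ball (0 :: real ^ 'n) ((1/2) ^ J). ennreal (norm x powr (1 / J - ?n)) \<partial>lborel)"
    using power_weight_mass_ge[OF J, where 'n = 'n] by (simp add: V_def)
  also have "\<dots> \<le> weighted_measure ?u {x. ennreal t < ?F x}"
    unfolding weighted_measure_def nn_integral_completion
  proof (intro nn_integral_mono_AE)
    show "AE x in lborel. ennreal (norm x powr (1 / J - ?n)) * indicator (ball (0 :: real ^ 'n) ((1/2) ^ J)) x
      \<le> ?u x * indicator {x. ennreal t < ?F x} x"
      using AE_nonzero
    proof eventually_elim
      case (elim x)
      then have "?u x = ennreal (norm x powr (1 / J - ?n))" using q by (simp add: ennpowr_power_weight)
      then show ?case using level by (auto simp: indicator_def)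
    qed
  qed
  finally have "ennpowr (ennreal (J * (V / 8))) (1 / q) \<le> ennpowr (weighted_measure ?u {x. ennreal t < ?F x}) (1 / q)"
    using q by (intro ennpowr_mono) auto
  then have "ennreal t * ennpowr (ennreal (J * (V / 8))) (1 / q)
    \<le> ennreal t * ennpowr (weighted_measure ?u {x. ennreal t < ?F x}) (1 / q)" by (rule mult_left_mono) simp
  also have "\<dots> \<le> weak_norm q ?u ?F" unfolding weak_norm_def using t by (intro SUP_upper) auto
  also have "ennreal t * ennpowr (ennreal (J * (V / 8))) (1 / q)
    = ennreal (2 powr (\<alpha> - ?n) * V / 8 * (V / 8) powr (1 / q) * J powr (1 + 1 / q))"
  proof -
    have "ennpowr (ennreal (J * (V / 8))) (1 / q) = ennreal ((J * (V / 8)) powr (1 / q))"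
      using J V by (simp add: ennpowr_ennreal)
    moreover have "t * (J * (V / 8)) powr (1 / q) = 2 powr (\<alpha> - ?n) * V / 8 * (V / 8) powr (1 / q) * J powr (1 + 1 / q)"
    proof -
      have "(J * (V / 8)) powr (1 / q) = J powr (1 / q) * (V / 8) powr (1 / q)" by (rule powr_mult)
      moreover have "J powr (1 + 1 / q) = J * J powr (1 / q)" using J by (simp add: powr_add)
      ultimately show ?thesis by (simp only: t_def) (simp only: ac_simps times_divide_eq_right times_divide_eq_left)
    qed
    moreover have "ennreal t * ennreal ((J * (V / 8)) powr (1 / q)) = ennreal (t * (J * (V / 8)) powr (1 / q))"
      using t by (intro ennreal_mult[symmetric]) auto
    ultimately show ?thesis by (simp only:)
  qed
  finally show ?thesis .
qed

lemma eventually_less_nat_powr: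
  assumes "0 < \<delta>"
  shows "\<forall>\<^sub>F J in sequentially. M < real J powr \<delta>"
proof -
  have "filterlim (\<lambda>J. real J powr \<delta>) at_top sequentially"
    by (rule filterlim_compose[OF real_powr_at_top[OF assms] filterlim_real_sequentially])
  then show ?thesis by (simp add: filterlim_at_top_dense)
qed

text \<open>
  Along the weights |x|^(1/J - n) the inequality gives J^\<theta> \<le> D A^\<beta>, while A
  \<le> k J. For \<beta> \<ge> 0 this bounds J^(\<theta> - \<beta>), a contradiction. For
  negative \<beta> a lower bound on A is needed as well: the upper estimate
  \<open>riesz_weak_type\<close>, applied to the same examples, gives J^\<theta> \<le> C
  A^\<theta>, so that A \<ge> 1 for large J and \<beta> may be replaced by 0.
\<close>
theorem riesz_weak_type_exponent_sharp:
  fixes \<alpha> p q \<beta> c :: real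
  assumes \<alpha>: "0 < \<alpha>" "\<alpha> < real CARD('n)" and p: "1 \<le> p"
    and q: "0 < q" "1 / q = 1 / p - \<alpha> / real CARD('n)"
    and \<beta>: "\<beta> < 1 - \<alpha> / real CARD('n)"
    and bound: "\<And>w f. w \<in> Apq p q \<Longrightarrow> in_Lp p (\<lambda>x :: real ^ 'n. w x *\<^sub>R f x) \<Longrightarrow>
      weak_norm q (\<lambda>x. ennpowr (ennreal (w x)) q) (fractional_integral_abs \<alpha> f)
      \<le> ennreal c * ennpowr (Apq_const p q w) \<beta> * Lp_norm p (\<lambda>x. w x *\<^sub>R f x)"
  shows False
proof -
  let ?n = "real CARD('n)"
  define \<theta> where "\<theta> = 1 - \<alpha> / ?n"
  define \<gamma> where "\<gamma> = max \<beta> 0"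
  have \<theta>: "0 < \<theta>" "\<gamma> < \<theta>" using \<alpha> \<beta> by (auto simp: \<theta>_def \<gamma>_def)
  have \<theta>pq: "1 + 1 / q = \<theta> + 1 / p" using q by (simp add: \<theta>_def)
  have q1: "1 \<le> q"
  proof -
    have "1 / q \<le> 1 / p" using q(2) \<alpha> by simp
    then have "p \<le> q" using p q(1) by (simp add: field_simps)
    with p show ?thesis by simp
  qed
  define V where "V = unit_ball_vol ?n"
  define k2 where "k2 = 2 powr (\<alpha> - ?n) * V / 8 * (V / 8) powr (1 / q)"
  define k3 where "k3 = mass_const TYPE('n) powr (1 / p)"
  define k4 where "k4 = cube_const TYPE('n)"
  define C where "C = max 0 (weak_const TYPE('n) \<alpha> p q) * k3 / k2"
  define D where "D = max 0 c * k3 / k2"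
  have V: "0 < V" by (simp add: V_def)
  have k: "0 < k2" "0 < k3" "0 < k4"
    using V mass_const_pos[where 'n = 'n]
    by (auto simp: k2_def k3_def k4_def cube_const_def intro!: add_pos_nonneg)
  have "\<forall>\<^sub>F J in sequentially. C < real J powr \<theta> \<and> D * k4 powr \<gamma> < real J powr (\<theta> - \<gamma>) \<and> 0 < J"
    using \<theta> by (intro eventually_conj eventually_less_nat_powr eventually_gt_at_top) auto
  then obtain J :: nat where J: "0 < J" "C < J powr \<theta>" "D * k4 powr \<gamma> < J powr (\<theta> - \<gamma>)"
    by (auto simp: eventually_sequentially)
  let ?w = "power_weight q J :: real ^ 'n \<Rightarrow> real"
  let ?f = "\<lambda>y :: real ^ 'n. complex_of_real (power_fun \<alpha> J y)"
  let ?A = "Apq_const p q ?w"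
  let ?L = "Lp_norm p (\<lambda>x. ?w x *\<^sub>R ?f x)"
  let ?N = "weak_norm q (\<lambda>x. ennpowr (ennreal (?w x)) q) (fractional_integral_abs \<alpha> ?f)"
  have A: "?A \<le> ennreal (k4 * J)" unfolding k4_def using J(1) p q(1) by (rule power_weight_const)
  have w: "?w \<in> Apq p q"
    using weight_power_weight[OF J(1) q1] A by (auto simp: Apq_def intro: order.strict_trans1)
  have L: "?L \<le> ennreal (k3 * J powr (1 / p))"
    using power_fun_norm_le[OF J(1) p q] mass_const_pos[where 'n = 'n] by (simp add: k3_def powr_mult)
  have f: "in_Lp p (\<lambda>x. ?w x *\<^sub>R ?f x)"
  proof -
    have "(\<lambda>x. ?w x *\<^sub>R ?f x) \<in> borel_measurable lborel" by measurable
    then have "(\<lambda>x. ?w x *\<^sub>R ?f x) \<in> borel_measurable lebesgue" by (rule measurable_completion)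
    moreover have "?L < top" using L by (rule order.strict_trans1) simp
    ultimately show ?thesis by (simp add: in_Lp_def)
  qed
  have N: "ennreal (k2 * J powr (1 + 1 / q)) \<le> ?N"
    unfolding k2_def V_def using J(1) \<alpha> q(1) by (rule power_fun_weak_norm_ge)
  \<comment> \<open>What an inequality with the power b of the constant says about the example.\<close>
  have main: "J powr \<theta> \<le> max 0 c' * k3 / k2 * a powr b"
    if "?N \<le> ennreal c' * ennpowr ?A b * ?L" "?A = ennreal a" "0 < a" for c' b a
  proof -
    have "ennreal (k2 * J powr (1 + 1 / q)) \<le> ennreal (max 0 c') * ennreal (a powr b) * ennreal (k3 * J powr (1 / p))"
    proof -
      have "ennreal c' * ennpowr ?A b * ?L \<le> ennreal (max 0 c') * ennreal (a powr b) * ennreal (k3 * J powr (1 / p))"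
        using that L by (intro mult_mono) (auto simp: ennpowr_ennreal intro: ennreal_leI)
      with N that(1) show ?thesis by (meson order_trans)
    qed
    also have "\<dots> = ennreal (max 0 c' * a powr b * (k3 * J powr (1 / p)))"
      using k by (simp add: ennreal_mult)
    finally have "k2 * J powr (1 + 1 / q) \<le> max 0 c' * a powr b * (k3 * J powr (1 / p))"
      using k by (subst (asm) ennreal_le_iff) auto
    then have "(k2 * J powr \<theta>) * J powr (1 / p) \<le> (max 0 c' * a powr b * k3) * J powr (1 / p)"
      unfolding \<theta>pq powr_add by (simp only: mult.assoc)
    then have "k2 * J powr \<theta> \<le> max 0 c' * a powr b * k3" using J(1) by simp
    then show ?thesis using k by (simp add: field_simps)
  qed
  have up: "?N \<le> ennreal (weak_const TYPE('n) \<alpha> p q) * ennpowr ?A \<theta> * ?L"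
    unfolding \<theta>_def using \<alpha> p q w f by (rule riesz_weak_type)
  have "?A \<noteq> 0"
  proof
    assume "?A = 0"
    with up \<theta> have "?N = 0" by simp
    with N k J(1) show False by simp
  qed
  moreover have "?A < top" using w by (simp add: Apq_def)
  ultimately obtain a where a: "?A = ennreal a" "0 < a" by (cases ?A rule: ennreal_pos_cases) auto
  have C0: "0 \<le> C" and D0: "0 \<le> D" using k by (auto simp: C_def D_def)
  have "1 \<le> a"
  proof (rule ccontr)
    assume "\<not> 1 \<le> a"
    then have "a powr \<theta> \<le> 1 powr \<theta>" using a \<theta> by (intro powr_mono2) auto
    then have "C * a powr \<theta> \<le> C * 1" using C0 by (intro mult_left_mono) auto
    with main[OF up a] J(2) show False by (simp add: C_def)
  qed
  have ak: "a \<le> k4 * J" using A a k by (simp add: ennreal_le_iff)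
  \<comment> \<open>Since a is at least 1, the exponent may be raised to max \<beta> 0 before a is bounded by k4 J.\<close>
  have "J powr \<theta> \<le> D * a powr \<beta>" unfolding D_def by (rule main[OF bound[OF w f] a])
  also have "\<dots> \<le> D * (k4 * J) powr \<gamma>"
  proof (intro mult_left_mono D0)
    have "a powr \<beta> \<le> a powr \<gamma>" using \<open>1 \<le> a\<close> by (intro powr_mono) (auto simp: \<gamma>_def)
    also have "\<dots> \<le> (k4 * J) powr \<gamma>" using ak a by (intro powr_mono2) (auto simp: \<gamma>_def)
    finally show "a powr \<beta> \<le> (k4 * J) powr \<gamma>" .
  qed
  also have "\<dots> = (D * k4 powr \<gamma>) * J powr \<gamma>" by (simp only: powr_mult mult.assoc)
  also have "\<dots> < J powr (\<theta> - \<gamma>) * J powr \<gamma>" using J by (intro mult_strict_right_mono) auto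
  also have "\<dots> = J powr \<theta>" by (subst powr_add[symmetric]) simp
  finally show False by simp
qed

theorem theorem2p4:
  fixes \<alpha> p q :: real
  assumes "0 < \<alpha>" and "\<alpha> < real CARD('n)"
    and "1 \<le> p" and "p < real CARD('n) / \<alpha>"
    and "1 / q = 1 / p - \<alpha> / real CARD('n)"
  shows "(\<exists>c::real. \<forall>w\<in>Apq p q. \<forall>f :: real ^ 'n \<Rightarrow> complex. in_Lp p (\<lambda>x. w x *\<^sub>R f x) \<longrightarrow>
            weak_norm q (\<lambda>x. ennpowr (ennreal (w x)) q) (fractional_integral_abs \<alpha> f)
            \<le> ennreal c * ennpowr (Apq_const p q w) (1 - \<alpha> / real CARD('n))
                * Lp_norm p (\<lambda>x. w x *\<^sub>R f x))
       \<and> (\<forall>\<beta> < 1 - \<alpha> / real CARD('n).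
          \<not> (\<exists>c::real. \<forall>w\<in>Apq p q. \<forall>f :: real ^ 'n \<Rightarrow> complex. in_Lp p (\<lambda>x. w x *\<^sub>R f x) \<longrightarrow>
            weak_norm q (\<lambda>x. ennpowr (ennreal (w x)) q) (fractional_integral_abs \<alpha> f)
            \<le> ennreal c * ennpowr (Apq_const p q w) \<beta>
                * Lp_norm p (\<lambda>x. w x *\<^sub>R f x)))"
proof -
  have q: "0 < q"
  proof -
    have "\<alpha> / real CARD('n) < 1 / p" using assms by (simp add: field_simps)
    then have "0 < 1 / q" using assms(5) by simp
    then show ?thesis by simp
  qed
  show ?thesis
    using riesz_weak_type[OF assms(1-3) q assms(5)]
      riesz_weak_type_exponent_sharp[OF assms(1-3) q assms(5)]
    by blast
qed

end
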